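(* Let $M\ge 1$ be an integer and $\Delta>0$ a real number. Let $F\in\mathbb{D}_\infty([0,M\Delta])$ be of the form $F=g(W(\Delta),W(2\Delta),\ldots,W(M\Delta))$, where $g:\mathbb{R}^M\to\mathbb{R}$ is a deterministic infinitely differentiable function. Suppose that for each $m\in\{0,\ldots,M-1\}$, $$\sum_{i=0}^{L}\left\|D_{(m+1)\Delta}^{2L-i}F\right\|_{L^2(\Omega)}^2\binom{L}{i}^4\frac{i!}{(L!)^2}\Delta^{2L-i}\longrightarrow 0\quad\text{as } L\to\infty .$$ Then for each $m\in\{0,\ldots,M-1\}$, $$E[F|\mathcal{F}_{m\Delta}]=\sum_{l=0}^{\infty}\gamma(m,l)\,E[D_{(m+1)\Delta}^{l}F|\mathcal{F}_{(m+1)\Delta}]\quad\text{in } L^2(\Omega),$$ where $\gamma(m,0)=1$ and for $l\ge 1$, $$\gamma(m,l)=(-1)^l\Delta^{l/2}\sum_{j=0}^{\lfloor l/2\rfloor}\frac{1}{j!(l-2j)!}h_{l-2j}\left(\frac{W((m+1)\Delta)-W(m\Delta)}{\sqrt{\Delta}}\right).$$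
   Context: $(\Omega,\{\mathcal{F}_t\}_{t\ge0},P)$ is a complete filtered probability space, $W$ is a standard Brownian motion on $\mathbb{R}_+$, and $\{\mathcal{F}_t\}$ is the usual augmentation of the filtration generated by $W$. $L^2(\Omega)$ is the space of square-integrable random variables with norm $\|F\|_{L^2(\Omega)}=\sqrt{E[F^2]}$. $D_tF$ denotes the Malliavin derivative of $F$ at time $t$; if $F=\sum_{m\ge0}I_m(f_m)$ is the Wiener chaos expansion (symmetric kernels $f_m$), then $D_tF=\sum_{m\ge1}mI_{m-1}(f_m(\cdot,t))$. For $F=f(W(t_1),\ldots,W(t_n))$ with $f$ smooth, $D_sF=\sum_{i=1}^n\frac{\partial f}{\partial x_i}(W(t_1),\ldots,W(t_n))\chi_{[0,t_i]}(s)$, where $\chi$ is the indicator function. $D_t^lF$ denotes $D_t\cdots D_tF$ ($l$ times), with $D_t^0F=F$. $\mathbb{D}_\infty([0,T])$ is the set of $\mathcal{F}_T$-measurable $F\in L^2(\Omega)$ that are infinitely Malliavin differentiable in the sense that for every integer $n\ge1$, $\big\|\sup_{s_1,\ldots,s_n\in[0,T]}|D_{s_n}\cdots D_{s_1}F|\big\|_{L^2(\Omega)}<\infty$. $h_n$ is the Hermite polynomial of degree $n$: $h_0\equiv1$ and $h_n(x)=(-1)^n e^{x^2/2}\frac{d^n}{dx^n}e^{-x^2/2}$ for $n\ge1$. $\lfloor x\rfloor$ is the largest integer $\le x$. *)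

theory Defs
  imports "HOL-Probability.Probability"
begin

subsection \<open>Square-integrable functions\<close>

definition L2_space :: "'b measure \<Rightarrow> ('b \<Rightarrow> real) set" where
  "L2_space M = {X \<in> borel_measurable M. integrable M (\<lambda>x. (X x)\<^sup>2)}"

definition L2_norm :: "'b measure \<Rightarrow> ('b \<Rightarrow> real) \<Rightarrow> real" where
  "L2_norm M X = sqrt (\<integral>x. (X x)\<^sup>2 \<partial>M)"

definition L2_tendsto :: "'b measure \<Rightarrow> (nat \<Rightarrow> 'b \<Rightarrow> real) \<Rightarrow> ('b \<Rightarrow> real) \<Rightarrow> bool" where
  "L2_tendsto M X Y \<longleftrightarrow>
     (\<forall>n. X n \<in> L2_space M) \<and> Y \<in> L2_space M \<and>
     (\<lambda>n. L2_norm M (\<lambda>x. X n x - Y x)) \<longlonglongrightarrow> 0"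

definition L2_sums :: "'b measure \<Rightarrow> (nat \<Rightarrow> 'b \<Rightarrow> real) \<Rightarrow> ('b \<Rightarrow> real) \<Rightarrow> bool" where
  "L2_sums M X Y \<longleftrightarrow> L2_tendsto M (\<lambda>N x. \<Sum>n<N. X n x) Y"

subsection \<open>Brownian motion and its augmented filtration\<close>

definition brownian_motion :: "'a measure \<Rightarrow> (real \<Rightarrow> 'a \<Rightarrow> real) \<Rightarrow> bool" where
  "brownian_motion P W \<longleftrightarrow>
     (\<forall>t\<ge>0. W t \<in> borel_measurable P) \<and>
     (AE \<omega> in P. W 0 \<omega> = 0) \<and>
     (\<forall>n t. 0 \<le> t 0 \<and> strict_mono_on {..n} t \<longrightarrow>
        prob_space.indep_vars P (\<lambda>_. borel) (\<lambda>i \<omega>. W (t (Suc i)) \<omega> - W (t i) \<omega>) {..<n}) \<and>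
     (\<forall>s t. 0 \<le> s \<and> s < t \<longrightarrow>
        distributed P lborel (\<lambda>\<omega>. W t \<omega> - W s \<omega>) (normal_density 0 (sqrt (t - s)))) \<and>
     (AE \<omega> in P. continuous_on {0..} (\<lambda>t. W t \<omega>))"

definition null_completed_sets :: "'a measure \<Rightarrow> (real \<Rightarrow> 'a \<Rightarrow> real) \<Rightarrow> real \<Rightarrow> 'a set set" where
  "null_completed_sets P W t =
     sigma_sets (space P)
       ({W s -` B \<inter> space P | s B. 0 \<le> s \<and> s \<le> t \<and> B \<in> sets borel} \<union> null_sets P)"

text \<open>The usual augmentation: null sets are added and the filtration is made right-continuous.\<close>

definition augmented :: "'a measure \<Rightarrow> (real \<Rightarrow> 'a \<Rightarrow> real) \<Rightarrow> real \<Rightarrow> 'a measure" where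
  "augmented P W t = sigma (space P) (\<Inter>u\<in>{t<..}. null_completed_sets P W u)"

subsection \<open>Smooth functions of finitely many variables\<close>

text \<open>A point of the \<open>n\<close>-dimensional Euclidean space is an extensional function on \<open>{..<n}\<close>;
  functions of \<open>n\<close> variables are only ever looked at on this set, whose topology is the subspace
  topology of the product topology.\<close>

definition Rn :: "nat \<Rightarrow> (nat \<Rightarrow> real) set" where
  "Rn n = ({..<n} \<rightarrow>\<^sub>E UNIV)"

definition partial :: "nat \<Rightarrow> ((nat \<Rightarrow> real) \<Rightarrow> real) \<Rightarrow> (nat \<Rightarrow> real) \<Rightarrow> real" where
  "partial i f x = deriv (\<lambda>y. f (x(i := y))) (x i)"

definition smooth_fun :: "nat \<Rightarrow> ((nat \<Rightarrow> real) \<Rightarrow> real) \<Rightarrow> bool" where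
  "smooth_fun n f \<longleftrightarrow>
     (\<forall>js \<in> lists {..<n}.
        continuous_on (Rn n) (foldr partial js f) \<and>
        (\<forall>x\<in>Rn n. \<forall>i<n. (\<lambda>y. foldr partial js f (x(i := y))) differentiable (at (x i))))"

subsection \<open>Multiple Wiener integrals\<close>

definition time_measure :: "nat \<Rightarrow> (nat \<Rightarrow> real) measure" where
  "time_measure m = (\<Pi>\<^sub>M i\<in>{..<m}. restrict_space lborel {0..})"

text \<open>Off-diagonal step kernels on the grid \<open>p 0 < \<dots> < p n\<close>: \<open>a \<iota>\<close> is the value on the
  box with sides \<open>{p (\<iota> j)<..p (Suc (\<iota> j))}\<close>, \<open>j < m\<close>.\<close>

definition step_kernel ::
  "nat \<Rightarrow> nat \<Rightarrow> (nat \<Rightarrow> real) \<Rightarrow> ((nat \<Rightarrow> nat) \<Rightarrow> real) \<Rightarrow> (nat \<Rightarrow> real) \<Rightarrow> real" where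
  "step_kernel m n p a x =
     (\<Sum>\<iota> \<in> {..<m} \<rightarrow>\<^sub>E {..<n}. a \<iota> * (\<Prod>j<m. indicator {p (\<iota> j)<..p (Suc (\<iota> j))} (x j)))"

definition step_integral ::
  "(real \<Rightarrow> 'a \<Rightarrow> real) \<Rightarrow> nat \<Rightarrow> nat \<Rightarrow> (nat \<Rightarrow> real) \<Rightarrow> ((nat \<Rightarrow> nat) \<Rightarrow> real) \<Rightarrow> 'a \<Rightarrow> real" where
  "step_integral W m n p a \<omega> =
     (\<Sum>\<iota> \<in> {..<m} \<rightarrow>\<^sub>E {..<n}. a \<iota> * (\<Prod>j<m. W (p (Suc (\<iota> j))) \<omega> - W (p (\<iota> j)) \<omega>))"

definition valid_step :: "nat \<Rightarrow> nat \<Rightarrow> (nat \<Rightarrow> real) \<Rightarrow> ((nat \<Rightarrow> nat) \<Rightarrow> real) \<Rightarrow> bool" where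
  "valid_step m n p a \<longleftrightarrow>
     0 \<le> p 0 \<and> strict_mono_on {..n} p \<and>
     (\<forall>\<iota> \<in> {..<m} \<rightarrow>\<^sub>E {..<n}. \<not> inj_on \<iota> {..<m} \<longrightarrow> a \<iota> = 0)"

text \<open>\<open>is_multiple_integral P W m f X\<close>: \<open>X\<close> is a version of the \<open>m\<close>-fold Wiener integral
  of the square-integrable kernel \<open>f\<close>, i.e. the value of the \<open>L\<^sup>2\<close>-continuous extension of
  the integral of step kernels.\<close>

definition is_multiple_integral ::
  "'a measure \<Rightarrow> (real \<Rightarrow> 'a \<Rightarrow> real) \<Rightarrow> nat \<Rightarrow> ((nat \<Rightarrow> real) \<Rightarrow> real) \<Rightarrow> ('a \<Rightarrow> real) \<Rightarrow> bool" where
  "is_multiple_integral P W m f X \<longleftrightarrow>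
     (\<exists>n p a. (\<forall>k. valid_step m (n k) (p k) (a k)) \<and>
        L2_tendsto (time_measure m) (\<lambda>k. step_kernel m (n k) (p k) (a k)) f \<and>
        L2_tendsto P (\<lambda>k. step_integral W m (n k) (p k) (a k)) X)"

definition symmetric_kernel :: "nat \<Rightarrow> ((nat \<Rightarrow> real) \<Rightarrow> real) \<Rightarrow> bool" where
  "symmetric_kernel m f \<longleftrightarrow>
     (\<forall>\<pi>. \<pi> permutes {..<m} \<longrightarrow> (\<forall>x \<in> space (time_measure m). f (x \<circ> \<pi>) = f x))"

definition chaos_expansion ::
  "'a measure \<Rightarrow> (real \<Rightarrow> 'a \<Rightarrow> real) \<Rightarrow> (nat \<Rightarrow> (nat \<Rightarrow> real) \<Rightarrow> real) \<Rightarrow> ('a \<Rightarrow> real) \<Rightarrow> bool" where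
  "chaos_expansion P W f X \<longleftrightarrow>
     (\<forall>m. symmetric_kernel m (f m)) \<and>
     (\<exists>J. (\<forall>m. is_multiple_integral P W m (f m) (J m)) \<and> L2_sums P J X)"

subsection \<open>Malliavin derivative\<close>

text \<open>\<open>f(\<cdot>, t)\<close> is obtained by plugging \<open>t\<close> into the last argument of the kernel. The
  summability condition says that the derivative is square-integrable over time and probability
  space.\<close>

definition chaos_derivative ::
  "'a measure \<Rightarrow> (real \<Rightarrow> 'a \<Rightarrow> real) \<Rightarrow> ('a \<Rightarrow> real) \<Rightarrow> (real \<Rightarrow> 'a \<Rightarrow> real) \<Rightarrow> bool" where
  "chaos_derivative P W X Y \<longleftrightarrow>
     (\<exists>f. chaos_expansion P W f X \<and>
        summable (\<lambda>m. real m * fact m * (L2_norm (time_measure m) (f m))\<^sup>2) \<and>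
        (AE t in lborel. 0 \<le> t \<longrightarrow>
           (\<exists>K. (\<forall>m. is_multiple_integral P W m (\<lambda>x. f (Suc m) (x(m := t))) (K m)) \<and>
                L2_sums P (\<lambda>m \<omega>. real (Suc m) * K m \<omega>) (Y t))))"

definition cylinder_derivative ::
  "(real \<Rightarrow> 'a \<Rightarrow> real) \<Rightarrow> nat \<Rightarrow> (nat \<Rightarrow> real) \<Rightarrow> ((nat \<Rightarrow> real) \<Rightarrow> real) \<Rightarrow> real \<Rightarrow> 'a \<Rightarrow> real" where
  "cylinder_derivative W n t f s \<omega> =
     (\<Sum>i<n. partial i f (\<lambda>j\<in>{..<n}. W (t j) \<omega>) * indicator {0..t i} s)"

text \<open>The chaos formula determines \<open>Y t = D\<^sub>t X\<close> for almost every \<open>t\<close> only. For a smooth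
  function of finitely many values of \<open>W\<close>, the second condition selects the version given by the
  chain rule at every single time \<open>s\<close>, so that evaluation at a fixed time makes sense. The times
  \<open>t i\<close> are positive since \<open>W 0 = 0\<close> carries no randomness.\<close>

definition is_malliavin_derivative ::
  "'a measure \<Rightarrow> (real \<Rightarrow> 'a \<Rightarrow> real) \<Rightarrow> ('a \<Rightarrow> real) \<Rightarrow> (real \<Rightarrow> 'a \<Rightarrow> real) \<Rightarrow> bool" where
  "is_malliavin_derivative P W X Y \<longleftrightarrow>
     chaos_derivative P W X Y \<and>
     (\<forall>n t f. (\<forall>i<n. 0 < t i) \<and> smooth_fun n f \<and>
        (AE \<omega> in P. X \<omega> = f (\<lambda>j\<in>{..<n}. W (t j) \<omega>)) \<longrightarrow>
        (\<forall>s\<ge>0. AE \<omega> in P. Y s \<omega> = cylinder_derivative W n t f s \<omega>))"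

text \<open>\<open>D [s\<^sub>n, \<dots>, s\<^sub>1]\<close> is a version of \<open>D\<^sub>s\<^sub>n \<cdots> D\<^sub>s\<^sub>1 F\<close>.\<close>

definition malliavin_derivatives ::
  "'a measure \<Rightarrow> (real \<Rightarrow> 'a \<Rightarrow> real) \<Rightarrow> ('a \<Rightarrow> real) \<Rightarrow> (real list \<Rightarrow> 'a \<Rightarrow> real) \<Rightarrow> bool" where
  "malliavin_derivatives P W F D \<longleftrightarrow>
     D [] = F \<and>
     (\<forall>ss \<in> lists {0..}. is_malliavin_derivative P W (D ss) (\<lambda>t. D (t # ss)))"

definition D_infty :: "'a measure \<Rightarrow> (real \<Rightarrow> 'a \<Rightarrow> real) \<Rightarrow> real \<Rightarrow> ('a \<Rightarrow> real) set" where
  "D_infty P W T =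
     {F \<in> L2_space P. F \<in> borel_measurable (augmented P W T) \<and>
        (\<exists>D. malliavin_derivatives P W F D \<and>
           (\<forall>n\<ge>1. (\<lambda>\<omega>. \<Squnion>ss\<in>{ss \<in> lists {0..T}. length ss = n}. ennreal \<bar>D ss \<omega>\<bar>) \<in> borel_measurable P \<and>
              (\<integral>\<^sup>+\<omega>. (\<Squnion>ss\<in>{ss \<in> lists {0..T}. length ss = n}. ennreal \<bar>D ss \<omega>\<bar>)\<^sup>2 \<partial>P) < \<infinity>))}"

subsection \<open>Hermite polynomials and the coefficients\<close>

definition hermite :: "nat \<Rightarrow> real \<Rightarrow> real" where
  "hermite n x = (-1) ^ n * exp (x\<^sup>2 / 2) * (deriv ^^ n) (\<lambda>y. exp (- y\<^sup>2 / 2)) x"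

definition gamma_coeff :: "(real \<Rightarrow> 'a \<Rightarrow> real) \<Rightarrow> real \<Rightarrow> nat \<Rightarrow> nat \<Rightarrow> 'a \<Rightarrow> real" where
  "gamma_coeff W \<Delta> m l \<omega> =
     (if l = 0 then 1
      else (-1) ^ l * \<Delta> powr (real l / 2) *
        (\<Sum>j\<le>l div 2. 1 / (fact j * fact (l - 2 * j)) *
           hermite (l - 2 * j) ((W (real (m + 1) * \<Delta>) \<omega> - W (real m * \<Delta>) \<omega>) / sqrt \<Delta>)))"

end

theory Submission
  imports Defs "HOL-Computational_Algebra.Formal_Power_Series"
begin

text \<open>
  Fix \<open>m\<close> and let \<open>x = (W ((m + 1) \<Delta>) - W (m \<Delta>)) / sqrt \<Delta>\<close>, a standard normal variable. With the
  increments over the other grid intervals held fixed, \<open>F\<close> is a smooth function \<open>\<phi>(x)\<close>, and the chain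
  rule says that \<open>sqrt \<Delta> ^ l\<close> times the \<open>l\<close>-th Malliavin derivative of \<open>F\<close> at time \<open>(m + 1) \<Delta>\<close> is
  \<open>\<phi>\<^sup>(\<^sup>l\<^sup>)(x)\<close>. The coefficient \<open>\<gamma>(m, l)\<close> is \<open>sqrt \<Delta> ^ l\<close> times \<open>E[(Y - x)\<^sup>l] / l!\<close>, where \<open>Y\<close> is another
  standard normal variable: both sequences have the generating function \<open>exp (s\<^sup>2 / 2 - s x)\<close>
  (\<open>gamma_coeff_eq_mean_taylor\<close>). So the \<open>N\<close>-th partial sum of
  \<open>\<Sum>\<^sub>l \<gamma>(m, l) D\<^sup>l F\<close> is the mean over \<open>Y\<close> of the Taylor polynomial of \<open>\<phi>\<close> at \<open>x\<close> evaluated at \<open>Y\<close>, and its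
  limit is the mean of \<open>\<phi>(Y)\<close>, that is, \<open>F\<close> averaged over one increment. Taking conditional
  expectations given the past of \<open>(m + 1) \<Delta>\<close> is continuous in \<open>L\<^sup>2\<close> and leaves \<open>\<gamma>(m, l)\<close> alone; as the
  increments after a time are independent of the augmented past of that time
  (\<open>augmented_indep_future\<close>), it turns the average of \<open>F\<close> into the
  conditional expectation of \<open>F\<close> given the past of \<open>m \<Delta>\<close> (\<open>real_cond_exp_averaged_increment\<close>).

  What remains is the convergence in \<open>L\<^sup>2\<close>, and there the constants are tight. Take
  \<open>L = 2 n\<close> and \<open>i = n\<close> in the hypothesis. The weight of the derivative of order \<open>3 n\<close>, multiplied by
  \<open>(3 n)!\<close>, is \<open>binomial(2 n, n)\<^sup>3 binomial(3 n, n)\<close>, which grows like \<open>432\<^sup>n = (7.559\<dots>)\<^sup>3\<^sup>n\<close>. Hence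
  \<open>\<parallel>\<phi>\<^sup>(\<^sup>k\<^sup>)\<parallel>\<^sup>2\<close> is bounded by a multiple of \<open>k! / 7.4\<^sup>k\<close> (\<open>growth_of_weighted_sums\<close>), and
  the sum of \<open>(2 + \<mu>)\<^sup>k / k! \<parallel>\<phi>\<^sup>(\<^sup>k\<^sup>)\<parallel>\<^sup>2\<close> over \<open>k\<close> is finite for \<open>2 + \<mu> = 7.3\<close>. For almost all values of the
  other increments, so is the sum \<open>K\<close> in which the norm refers to \<open>x\<close> alone. Expanding \<open>\<phi>\<^sup>(\<^sup>l\<^sup>)(x)\<close> in a Taylor
  series around an arbitrary point \<open>X\<close>, applying the Cauchy-Schwarz inequality and integrating over a
  standard normal \<open>X\<close> gives
  \<open>\<phi>\<^sup>(\<^sup>l\<^sup>)(x)\<^sup>2 \<le> sqrt 2 exp (x\<^sup>2 / 4) l! \<mu>\<^sup>-\<^sup>l K\<close> (\<open>phi_square_le\<close>). On the other side,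
  \<open>l! (E[(Y - x)\<^sup>l] / l!)\<^sup>2\<close> is at most a constant times \<open>(l + 1) (1 + 1 / \<beta>)\<^sup>l exp (\<beta> x\<^sup>2)\<close> for every \<open>\<beta> > 0\<close>
  (\<open>fact_mult_mean_taylor_square_le\<close>). The square of the \<open>l\<close>-th term is thus at most a multiple of
  \<open>(l + 1) ((1 + 1 / \<beta>) / \<mu>)\<^sup>l exp ((\<beta> + 1 / 4) x\<^sup>2)\<close>. This decays geometrically in \<open>l\<close> and is integrable in \<open>x\<close> as soon
  as \<open>\<beta> < 1 / 4\<close> and \<open>1 + 1 / \<beta> < \<mu>\<close>, which is possible if and only if \<open>2 + \<mu> > 7\<close>. With \<open>\<beta> = 5 / 21\<close>, dominated
  convergence finishes the proof.
\<close>

section \<open>The coefficients as averaged Taylor monomials\<close>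

fun He :: "nat \<Rightarrow> real \<Rightarrow> real" where
  "He 0 x = 1"
| "He (Suc 0) x = x"
| "He (Suc (Suc n)) x = x * He (Suc n) x - real (Suc n) * He n x"

lemma He_Suc: "He (Suc n) x = x * He n x - real n * He (n - 1) x"
  by (cases n) auto

lemma has_real_derivative_He: "(He n has_real_derivative real n * He (n - 1) x) (at x)"
proof (induction n x rule: He.induct)
  case (1 x) then show ?case by (simp add: fun_eq_iff[symmetric])
next
  case (2 x) show ?case using DERIV_ident[of "at x"] by simp
next
  case (3 n x)
  have eq: "He (Suc (Suc n)) = (\<lambda>x. x * He (Suc n) x - real (Suc n) * He n x)" by auto
  show ?case unfolding eq
    by (rule derivative_eq_intros 3 refl)+ (simp add: He_Suc[of n] algebra_simps)
qed

lemma deriv_pow_gaussian: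
  "(deriv ^^ n) (\<lambda>y. exp (- y\<^sup>2 / 2)) = (\<lambda>x. (- 1) ^ n * He n x * exp (- x\<^sup>2 / 2))"
proof (induction n)
  case (Suc n)
  have "((\<lambda>x. (- 1) ^ n * He n x * exp (- x\<^sup>2 / 2)) has_real_derivative
      (- 1) ^ Suc n * He (Suc n) x * exp (- x\<^sup>2 / 2)) (at x)" for x
    by (rule derivative_eq_intros has_real_derivative_He refl | simp)+
       (simp add: He_Suc[of n] algebra_simps)
  then have "deriv (\<lambda>x. (- 1) ^ n * He n x * exp (- x\<^sup>2 / 2)) x
      = (- 1) ^ Suc n * He (Suc n) x * exp (- x\<^sup>2 / 2)" for x
    by (rule DERIV_imp_deriv)
  then show ?case unfolding funpow.simps(2) o_apply Suc.IH by (rule ext)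
qed simp

text \<open>The three-term recurrence replaces the derivatives of \<open>exp (- x\<^sup>2 / 2)\<close> in the definition of the
  Hermite polynomials by something that can be computed with.\<close>

lemma hermite_eq_He: "hermite n x = He n x"
proof -
  have "(-1::real) ^ n * (-1) ^ n = 1" by (simp flip: power_mult_distrib)
  moreover have "exp (x\<^sup>2 / 2) * exp (- x\<^sup>2 / 2) = 1" by (simp flip: exp_add)
  ultimately show ?thesis
    unfolding hermite_def deriv_pow_gaussian
    by (simp add: mult.assoc mult.left_commute[of "exp _"] mult.left_commute[of "He n x"])
qed

text \<open>The power series of \<open>exp (s\<^sup>2)\<close>.\<close>

definition even_exp_fps :: "real fps" where
  "even_exp_fps = Abs_fps (\<lambda>k. if even k then 1 / fact (k div 2) else 0)"

lemma Suc_over_fact_Suc: "real (Suc j) / fact (Suc j) = 1 / fact j"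
  by (simp del: of_nat_Suc)

lemma fps_deriv_even_exp: "fps_deriv even_exp_fps = 2 * fps_X * even_exp_fps"
proof (rule fps_ext)
  fix n show "fps_nth (fps_deriv even_exp_fps) n = fps_nth (2 * fps_X * even_exp_fps) n"
  proof (cases n)
    case (Suc k)
    show ?thesis
    proof (cases "even k")
      case True
      then obtain j where "k = 2 * j" by (elim evenE)
      then show ?thesis using Suc arg_cong[OF Suc_over_fact_Suc[of j], of "\<lambda>c. 2 * c"]
        by (simp add: even_exp_fps_def mult.assoc fps_numeral_fps_const del: fact_Suc)
    qed (simp add: Suc even_exp_fps_def mult.assoc fps_numeral_fps_const)
  qed (simp add: even_exp_fps_def mult.assoc fps_numeral_fps_const)
qed

definition hermite_fps :: "real \<Rightarrow> real fps" where
  "hermite_fps x = Abs_fps (\<lambda>n. hermite n x / fact n)"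

text \<open>The differential equation of the generating function \<open>exp (x s - s\<^sup>2 / 2)\<close>.\<close>

lemma fps_deriv_hermite: "fps_deriv (hermite_fps x) = (fps_const x - fps_X) * hermite_fps x"
proof (rule fps_ext)
  fix n show "fps_nth (fps_deriv (hermite_fps x)) n = fps_nth ((fps_const x - fps_X) * hermite_fps x) n"
  proof (cases n)
    case (Suc k)
    have "real (Suc n) * (He (Suc n) x / fact (Suc n)) = He (Suc n) x * (real (Suc n) / fact (Suc n))"
      by simp
    also have "\<dots> = (x * He n x - real (Suc k) * He k x) / fact n"
      unfolding Suc_over_fact_Suc using Suc by simp
    also have "\<dots> = x * (He n x / fact n) - He k x * (real (Suc k) / fact (Suc k))"
      using Suc by (simp add: diff_divide_distrib del: fact_Suc of_nat_Suc)
    also have "\<dots> = x * (He n x / fact n) - He k x / fact k"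
      unfolding Suc_over_fact_Suc by simp
    finally show ?thesis
      using Suc by (simp add: hermite_fps_def hermite_eq_He left_diff_distrib del: fact_Suc of_nat_Suc He.simps)
  qed (simp add: hermite_fps_def hermite_eq_He left_diff_distrib)
qed

text \<open>The sum over \<open>j\<close> in the coefficient \<open>\<gamma>\<close>; it is the coefficient of
  \<open>s\<^sup>l\<close> in \<open>exp (s\<^sup>2) exp (x s - s\<^sup>2 / 2) = exp (x s + s\<^sup>2 / 2)\<close>.\<close>

definition appell :: "nat \<Rightarrow> real \<Rightarrow> real" where
  "appell l x = (\<Sum>j\<le>l div 2. 1 / (fact j * fact (l - 2 * j)) * hermite (l - 2 * j) x)"

lemma appell_fps: "fps_nth (even_exp_fps * hermite_fps x) l = appell l x"
proof -
  have "fps_nth (even_exp_fps * hermite_fps x) l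
      = (\<Sum>i = 0..l. if even i then 1 / fact (i div 2) * (hermite (l - i) x / fact (l - i)) else 0)"
    by (simp add: fps_mult_nth even_exp_fps_def hermite_fps_def if_distrib if_distribR cong: if_cong)
  also have "\<dots> = (\<Sum>i\<in>{i\<in>{0..l}. even i}. 1 / fact (i div 2) * (hermite (l - i) x / fact (l - i)))"
    by (rule sum.inter_filter[symmetric]) simp
  also have "\<dots> = (\<Sum>j\<le>l div 2. 1 / fact j * (hermite (l - 2 * j) x / fact (l - 2 * j)))"
    by (rule sum.reindex_bij_witness[of _ "\<lambda>j. 2 * j" "\<lambda>i. i div 2"]) auto
  finally show ?thesis by (simp add: appell_def)
qed

lemma appell_recurrence:
  "real (Suc l) * appell (Suc l) x = x * appell l x + (if l = 0 then 0 else appell (l - 1) x)"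
proof -
  have "fps_deriv (even_exp_fps * hermite_fps x) = (fps_const x + fps_X) * (even_exp_fps * hermite_fps x)"
    by (simp add: fps_deriv_even_exp fps_deriv_hermite) (simp add: algebra_simps)
  from arg_cong[OF this, of "\<lambda>f. fps_nth f l"] show ?thesis
    by (simp add: distrib_right mult.assoc appell_fps del: fps_deriv_mult fps_exp_deriv)
qed

definition gauss :: "real measure" where
  "gauss = density lborel (\<lambda>x. ennreal (std_normal_density x))"

lemma sets_gauss [simp, measurable_cong]: "sets gauss = sets borel"
  and space_gauss [simp]: "space gauss = UNIV"
  by (simp_all add: gauss_def)

lemma prob_space_gauss: "prob_space gauss"
  unfolding gauss_def by (rule prob_space_normal_density) simp

interpretation gauss: prob_space gauss by (rule prob_space_gauss)

lemma has_bochner_integral_gaussI: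
  assumes "has_bochner_integral lborel (\<lambda>x. std_normal_density x * f x) c" "f \<in> borel_measurable borel"
  shows "has_bochner_integral gauss f c"
  unfolding gauss_def using assms
  by (intro has_bochner_integral_density) auto

lemma gauss_moment: "has_bochner_integral gauss (\<lambda>y. y ^ n) (if even n then fact n / (2 ^ (n div 2) * fact (n div 2)) else 0)"
proof (cases "even n")
  case True
  then show ?thesis
    by (intro has_bochner_integral_gaussI) (use std_normal_moment_even[of "n div 2"] in auto)
next
  case False
  then have "n = 2 * (n div 2) + 1" by presburger
  then show ?thesis using False
    by (intro has_bochner_integral_gaussI) (use std_normal_moment_odd[of "n div 2"] in auto)
qed

definition gauss_moment_fps :: "real fps" where
  "gauss_moment_fps = Abs_fps (\<lambda>n. (\<integral>y. y ^ n \<partial>gauss) / fact n)"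

lemma gauss_moment_fps_nth:
  "fps_nth gauss_moment_fps n = (if even n then 1 / (2 ^ (n div 2) * fact (n div 2)) else 0)"
  using has_bochner_integral_integral_eq[OF gauss_moment[of n]] by (simp add: gauss_moment_fps_def)

text \<open>The moment generating function \<open>exp (s\<^sup>2 / 2)\<close> solves \<open>f' = s f\<close>.\<close>

lemma fps_deriv_gauss_moment: "fps_deriv gauss_moment_fps = fps_X * gauss_moment_fps"
proof (rule fps_ext)
  fix n show "fps_nth (fps_deriv gauss_moment_fps) n = fps_nth (fps_X * gauss_moment_fps) n"
  proof (cases n)
    case (Suc k)
    show ?thesis
    proof (cases "even k")
      case True
      then obtain j where "k = 2 * j" by (elim evenE)
      then show ?thesis using Suc arg_cong[OF Suc_over_fact_Suc[of j], of "\<lambda>c. c / 2 ^ j"]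
        by (simp add: gauss_moment_fps_nth add_divide_distrib mult.commute del: fact_Suc)
    qed (simp add: Suc gauss_moment_fps_nth)
  qed (simp add: gauss_moment_fps_nth)
qed

definition mean_taylor :: "nat \<Rightarrow> real \<Rightarrow> real" where
  "mean_taylor l x = (\<integral>y. (y - x) ^ l / fact l \<partial>gauss)"

lemma integrable_gauss_shift_power: "integrable gauss (\<lambda>y. (y - x) ^ l)"
proof -
  have "(\<lambda>y. (y - x) ^ l) = (\<lambda>y. \<Sum>k\<le>l. of_nat (l choose k) * y ^ k * (- x) ^ (l - k))"
    using binomial_ring[of _ "- x" l] by (simp add: fun_eq_iff)
  moreover have "integrable gauss (\<lambda>y. y ^ k)" for k
    using gauss_moment[of k] by (rule integrable.intros)
  ultimately show ?thesis by simp
qed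

lemma mean_taylor_fps: "fps_nth (gauss_moment_fps * fps_exp (- x)) l = mean_taylor l x"
proof -
  have i: "integrable gauss (\<lambda>y. y ^ k)" for k
    using gauss_moment[of k] by (rule integrable.intros)
  have "mean_taylor l x = (\<integral>y. (\<Sum>k=0..l. y ^ k * ((- x) ^ (l - k) / (fact k * fact (l - k)))) \<partial>gauss)"
    unfolding mean_taylor_def
  proof (rule Bochner_Integration.integral_cong[OF refl])
    fix y
    have "(y - x) ^ l / fact l = (\<Sum>k\<le>l. of_nat (l choose k) * y ^ k * (- x) ^ (l - k) / fact l)"
      using binomial_ring[of y "- x" l] by (simp add: sum_divide_distrib)
    also have "\<dots> = (\<Sum>k=0..l. y ^ k * ((- x) ^ (l - k) / (fact k * fact (l - k))))"
      by (rule sum.cong) (auto simp: binomial_fact field_simps)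
    finally show "(y - x) ^ l / fact l = (\<Sum>k=0..l. y ^ k * ((- x) ^ (l - k) / (fact k * fact (l - k))))" .
  qed
  also have "\<dots> = (\<Sum>k=0..l. (\<integral>y. y ^ k \<partial>gauss) * ((- x) ^ (l - k) / (fact k * fact (l - k))))"
    using i by (subst Bochner_Integration.integral_sum) auto
  finally show ?thesis by (simp add: fps_mult_nth gauss_moment_fps_def)
qed

lemma mean_taylor_recurrence:
  "real (Suc l) * mean_taylor (Suc l) x = - x * mean_taylor l x + (if l = 0 then 0 else mean_taylor (l - 1) x)"
proof -
  have "fps_deriv (gauss_moment_fps * fps_exp (- x)) = (fps_const (- x) + fps_X) * (gauss_moment_fps * fps_exp (- x))"
    by (simp only: fps_deriv_mult fps_deriv_gauss_moment fps_exp_deriv) (simp add: algebra_simps)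
  from arg_cong[OF this, of "\<lambda>f. fps_nth f l"] show ?thesis
    by (simp add: distrib_right mult.assoc mean_taylor_fps del: fps_deriv_mult fps_exp_deriv)
qed

text \<open>The generating functions \<open>exp (s\<^sup>2 / 2 - x s)\<close> and \<open>exp (s\<^sup>2 / 2 + x s)\<close> are
  exchanged by \<open>s \<mapsto> - s\<close>; on the level of coefficients, both sides satisfy the same recurrence.\<close>

lemma mean_taylor_eq_appell: "mean_taylor l x = (- 1) ^ l * appell l x"
proof (induction l rule: less_induct)
  case (less l)
  show ?case
  proof (cases l)
    case 0
    then show ?thesis
      by (simp add: mean_taylor_def appell_def hermite_eq_He gauss.prob_space[simplified])
  next
    case (Suc k)
    have "real (Suc k) * mean_taylor (Suc k) x
        = - x * mean_taylor k x + (if k = 0 then 0 else mean_taylor (k - 1) x)"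
      by (rule mean_taylor_recurrence)
    also have "\<dots> = (- 1) ^ Suc k * (x * appell k x + (if k = 0 then 0 else appell (k - 1) x))"
      using less Suc by (cases k) (auto simp: algebra_simps)
    also have "\<dots> = (- 1) ^ Suc k * (real (Suc k) * appell (Suc k) x)"
      by (simp only: appell_recurrence)
    finally have "real (Suc k) * mean_taylor (Suc k) x = real (Suc k) * ((- 1) ^ Suc k * appell (Suc k) x)"
      by (simp only: mult.left_commute)
    then show ?thesis using Suc by (simp del: of_nat_Suc power_Suc)
  qed
qed

lemma gamma_coeff_eq_mean_taylor:
  assumes "\<Delta> > 0"
  shows "gamma_coeff W \<Delta> m l \<omega>
    = sqrt \<Delta> ^ l * mean_taylor l ((W (real (m + 1) * \<Delta>) \<omega> - W (real m * \<Delta>) \<omega>) / sqrt \<Delta>)"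
proof -
  have "\<Delta> powr (real l / 2) = sqrt \<Delta> ^ l"
    using assms by (simp add: powr_half_sqrt[symmetric] powr_powr flip: powr_realpow)
  then show ?thesis
    by (simp add: gamma_coeff_def mean_taylor_eq_appell)
       (auto simp: appell_def hermite_eq_He)
qed

section \<open>Gaussian integrals and the size of the coefficients\<close>

lemma gauss_exp_linear: "has_bochner_integral gauss (\<lambda>y. exp (t * y)) (exp (t\<^sup>2 / 2))"
proof (rule has_bochner_integral_gaussI)
  have eq: "std_normal_density y * exp (t * y) = exp (t\<^sup>2 / 2) * normal_density t 1 y" for y
    by (simp add: normal_density_def exp_add[symmetric] power2_eq_square field_simps)
  have "has_bochner_integral lborel (normal_density t 1) 1"
    using integral_normal_density[of 1 t] integrable_normal_density[of 1 t]
    by (simp add: has_bochner_integral_iff)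
  from has_bochner_integral_mult_right[of "exp (t\<^sup>2 / 2)", OF this]
  show "has_bochner_integral lborel (\<lambda>y. std_normal_density y * exp (t * y)) (exp (t\<^sup>2 / 2))"
    unfolding eq by simp
qed simp

lemma gauss_exp_square_integrable:
  assumes "c < 1 / 2"
  shows "integrable gauss (\<lambda>y. exp (c * y\<^sup>2))"
proof -
  define \<sigma> where "\<sigma> = 1 / sqrt (1 - 2 * c)"
  have \<sigma>: "\<sigma> > 0" "\<sigma>\<^sup>2 = 1 / (1 - 2 * c)"
    using assms by (auto simp: \<sigma>_def power_divide)
  have eq: "std_normal_density y * exp (c * y\<^sup>2) = \<sigma> * normal_density 0 \<sigma> y" for y
  proof -
    have "- y\<^sup>2 / 2 + c * y\<^sup>2 = - y\<^sup>2 / (2 * \<sigma>\<^sup>2)"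
      unfolding \<sigma>(2) using assms by (simp add: field_simps)
    moreover have "sqrt (2 * pi * \<sigma>\<^sup>2) = sqrt (2 * pi) * \<sigma>"
      using \<sigma>(1) by (simp add: real_sqrt_mult)
    ultimately show ?thesis using \<sigma>(1)
      by (simp add: normal_density_def mult_exp_exp)
  qed
  have "integrable lborel (\<lambda>y. std_normal_density y * exp (c * y\<^sup>2))"
    unfolding eq using integrable_normal_density[OF \<sigma>(1), of 0] by simp
  from has_bochner_integral_gaussI[OF has_bochner_integral_integrable[OF this]]
  show ?thesis by (auto intro: integrable.intros)
qed

text \<open>Completing the square in \<open>y\<close>. The factor \<open>exp (- x\<^sup>2 / 4)\<close> is the source of the weight
  \<open>exp (x\<^sup>2 / 4)\<close> in the pointwise bound on the derivatives.\<close>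

lemma gauss_heat_kernel:
  "has_bochner_integral gauss (\<lambda>y. exp (- (x - y)\<^sup>2 / 2)) (exp (- x\<^sup>2 / 4) / sqrt 2)"
proof (rule has_bochner_integral_gaussI)
  define \<sigma> :: real where "\<sigma> = 1 / sqrt 2"
  have \<sigma>: "\<sigma> > 0" "\<sigma>\<^sup>2 = 1 / 2" by (auto simp: \<sigma>_def power_divide)
  have eq: "std_normal_density y * exp (- (x - y)\<^sup>2 / 2)
      = (exp (- x\<^sup>2 / 4) / sqrt 2) * normal_density (x / 2) \<sigma> y" for y
  proof -
    have "- y\<^sup>2 / 2 + - (x - y)\<^sup>2 / 2 = - x\<^sup>2 / 4 + - (y - x / 2)\<^sup>2 / (2 * \<sigma>\<^sup>2)"
      unfolding \<sigma>(2) by (simp add: field_simps power2_eq_square)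
    then have "exp (- y\<^sup>2 / 2) * exp (- (x - y)\<^sup>2 / 2) = exp (- x\<^sup>2 / 4) * exp (- (y - x / 2)\<^sup>2 / (2 * \<sigma>\<^sup>2))"
      by (simp only: mult_exp_exp)
    moreover have "sqrt 2 * sqrt (2 * pi * \<sigma>\<^sup>2) = sqrt (2 * pi)"
      unfolding \<sigma>(2) by (simp add: real_sqrt_mult)
    ultimately show ?thesis
      by (simp add: normal_density_def field_simps)
  qed
  have "has_bochner_integral lborel (normal_density (x / 2) \<sigma>) 1"
    using integral_normal_density[OF \<sigma>(1)] integrable_normal_density[OF \<sigma>(1)]
    by (simp add: has_bochner_integral_iff)
  from has_bochner_integral_mult_right[of "exp (- x\<^sup>2 / 4) / sqrt 2", OF this]
  show "has_bochner_integral lborel (\<lambda>y. std_normal_density y * exp (- (x - y)\<^sup>2 / 2)) (exp (- x\<^sup>2 / 4) / sqrt 2)"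
    unfolding eq by simp
qed simp

lemma power_over_fact_le_exp: "(t::real) \<ge> 0 \<Longrightarrow> t ^ l / fact l \<le> exp t"
  using sum_le_suminf[OF summable_exp[of t], of "{l}"] by (simp add: exp_def divide_inverse mult.commute)

lemma sum_power_over_fact_le_exp: "(t::real) \<ge> 0 \<Longrightarrow> (\<Sum>k<n. t ^ k / fact k) \<le> exp t"
  using sum_le_suminf[OF summable_exp[of t], of "{..<n}"]
  by (simp add: exp_def divide_inverse mult.commute)

text \<open>Each Taylor monomial \<open>(s \<bar>y - x\<bar>)\<^sup>l / l!\<close> is below \<open>exp (s \<bar>y -
  x\<bar>)\<close>, whose mean is at most \<open>2 exp (s\<^sup>2 / 2 + s \<bar>x\<bar>)\<close>. The parameter \<open>s\<close>
  is left free, to be chosen depending on \<open>l\<close>.\<close>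

lemma abs_mean_taylor_le:
  assumes "s \<ge> 0"
  shows "\<bar>mean_taylor l x\<bar> * s ^ l \<le> 2 * exp (s\<^sup>2 / 2 + s * \<bar>x\<bar>)"
proof -
  have pt: "\<bar>(y - x) ^ l / fact l\<bar> * s ^ l \<le> exp (s * \<bar>x\<bar>) * (exp (s * y) + exp (- s * y))" for y
  proof -
    have "\<bar>(y - x) ^ l / fact l\<bar> * s ^ l = (s * \<bar>y - x\<bar>) ^ l / fact l"
      by (simp add: power_abs power_mult_distrib abs_divide)
    also have "\<dots> \<le> exp (s * \<bar>y - x\<bar>)"
      using assms by (intro power_over_fact_le_exp) simp
    also have "\<dots> \<le> exp (s * \<bar>x\<bar> + s * \<bar>y\<bar>)"
      using assms by (simp flip: distrib_left) (intro mult_left_mono, auto)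
    also have "\<dots> = exp (s * \<bar>x\<bar>) * exp (s * \<bar>y\<bar>)" by (rule exp_add)
    also have "\<dots> \<le> exp (s * \<bar>x\<bar>) * (exp (s * y) + exp (- s * y))"
      by (intro mult_left_mono) (auto simp: abs_real_def)
    finally show ?thesis .
  qed
  have i: "integrable gauss (\<lambda>y. \<bar>(y - x) ^ l / fact l\<bar>)"
    using integrable_gauss_shift_power[of x l] by (intro integrable_abs) simp
  have h: "has_bochner_integral gauss (\<lambda>y. exp (s * \<bar>x\<bar>) * (exp (s * y) + exp (- s * y)))
      (exp (s * \<bar>x\<bar>) * (exp (s\<^sup>2 / 2) + exp ((-s)\<^sup>2 / 2)))"
    by (intro has_bochner_integral_mult_right has_bochner_integral_add gauss_exp_linear)
  have "\<bar>mean_taylor l x\<bar> * s ^ l \<le> (\<integral>y. \<bar>(y - x) ^ l / fact l\<bar> \<partial>gauss) * s ^ l"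
    unfolding mean_taylor_def using assms by (intro mult_right_mono integral_abs_bound) auto
  also have "\<dots> = (\<integral>y. \<bar>(y - x) ^ l / fact l\<bar> * s ^ l \<partial>gauss)"
    using i by simp
  also have "\<dots> \<le> (\<integral>y. exp (s * \<bar>x\<bar>) * (exp (s * y) + exp (- s * y)) \<partial>gauss)"
    using integrable_mult_left[of "s ^ l", OF i] integrable.intros[OF h] pt by (intro integral_mono)
  also have "\<dots> = 2 * exp (s\<^sup>2 / 2 + s * \<bar>x\<bar>)"
    using has_bochner_integral_integral_eq[OF h] by (simp add: exp_add)
  finally show ?thesis .
qed

lemma fact_le_power_exp: "fact l \<le> real (Suc l) ^ Suc l * exp (- real l)"
proof (induction l)
  case (Suc l)
  have "exp 1 * real (Suc l) ^ Suc (Suc l) \<le> real (Suc (Suc l)) ^ Suc (Suc l)"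
  proof -
    define n where "n = real (Suc l)"
    have n: "n \<ge> 1" by (simp add: n_def)
    have "(n / (n + 1)) ^ Suc (Suc l) \<le> exp (- 1 / (n + 1)) ^ Suc (Suc l)"
      using exp_ge_add_one_self[of "- 1 / (n + 1)"] n by (intro power_mono) (auto simp: field_simps)
    also have "\<dots> = exp (real (Suc (Suc l)) * (- 1 / (n + 1)))"
      by (rule exp_of_nat_mult[symmetric])
    also have "real (Suc (Suc l)) * (- 1 / (n + 1)) = - 1"
      by (simp add: n_def)
    finally have "n ^ Suc (Suc l) / (n + 1) ^ Suc (Suc l) \<le> inverse (exp 1)"
      by (simp only: power_divide exp_minus)
    then have "n ^ Suc (Suc l) * exp 1 \<le> (n + 1) ^ Suc (Suc l)"
      using n by (simp add: pos_divide_le_eq inverse_eq_divide pos_le_divide_eq del: power_Suc)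
    then show ?thesis by (simp add: n_def mult.commute add.commute del: power_Suc)
  qed
  have "fact (Suc l) = real (Suc l) * fact l" by simp
  also have "\<dots> \<le> real (Suc l) * (real (Suc l) ^ Suc l * exp (- real l))"
    using Suc by (intro mult_left_mono) auto
  also have "\<dots> = exp 1 * real (Suc l) ^ Suc (Suc l) * exp (- real (Suc l))"
    by (simp add: mult_exp_exp[symmetric] exp_diff exp_minus field_simps)
  also have "\<dots> \<le> real (Suc (Suc l)) ^ Suc (Suc l) * exp (- real (Suc l))"
    by (intro mult_right_mono \<open>exp 1 * _ \<le> _\<close>) auto
  finally show ?case .
qed simp

text \<open>Split \<open>2 s \<bar>x\<bar> \<le> s\<^sup>2 / \<beta> + \<beta> x\<^sup>2\<close> in the exponent of the bound on
  \<open>\<bar>mean_taylor l x\<bar>\<close>; then \<open>s\<^sup>2 = (l + 1) / (1 + 1 / \<beta>)\<close> is almost optimal. The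
  rate \<open>1 + 1 / \<beta>\<close> matters: Jensen's inequality, applied to the square of the mean that defines
  \<open>mean_taylor\<close>, would give only \<open>2 + 1 / \<beta>\<close>, and the growth bound for the derivatives would then
  no longer suffice.\<close>

lemma fact_mult_mean_taylor_square_le:
  assumes "\<beta> > 0"
  shows "fact l * (mean_taylor l x)\<^sup>2 \<le> 4 * exp 1 * real (Suc l) * (1 + 1 / \<beta>) ^ l * exp (\<beta> * x\<^sup>2)"
proof -
  define \<kappa> where "\<kappa> = 1 + 1 / \<beta>"
  have \<kappa>: "\<kappa> > 0" using assms by (simp add: \<kappa>_def add_pos_pos)
  define s where "s = sqrt (real (Suc l) / \<kappa>)"
  have s: "s \<ge> 0" "s\<^sup>2 = real (Suc l) / \<kappa>" using \<kappa> by (auto simp: s_def)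
  have "0 \<le> (s / sqrt \<beta> - sqrt \<beta> * \<bar>x\<bar>)\<^sup>2" by simp
  also have "\<dots> = s\<^sup>2 / \<beta> + \<beta> * x\<^sup>2 - 2 * s * \<bar>x\<bar>"
    using assms by (simp add: power2_diff power_divide power_mult_distrib)
  finally have "s\<^sup>2 + 2 * s * \<bar>x\<bar> \<le> \<kappa> * s\<^sup>2 + \<beta> * x\<^sup>2"
    by (simp add: \<kappa>_def algebra_simps)
  also have "\<kappa> * s\<^sup>2 = real (Suc l)" using \<kappa> s(2) by simp
  finally have e: "s\<^sup>2 + 2 * s * \<bar>x\<bar> \<le> real (Suc l) + \<beta> * x\<^sup>2" .
  have "(mean_taylor l x)\<^sup>2 * (s\<^sup>2) ^ l = (\<bar>mean_taylor l x\<bar> * s ^ l)\<^sup>2"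
    by (simp add: power_mult_distrib power_mult[symmetric] mult.commute)
  also have "\<dots> \<le> (2 * exp (s\<^sup>2 / 2 + s * \<bar>x\<bar>))\<^sup>2"
    using s(1) by (intro power_mono abs_mean_taylor_le) auto
  also have "\<dots> = 4 * exp (s\<^sup>2 + 2 * s * \<bar>x\<bar>)"
    by (simp add: power_mult_distrib exp_double[symmetric] algebra_simps)
  also have "\<dots> \<le> 4 * exp (real (Suc l) + \<beta> * x\<^sup>2)" using e by simp
  finally have "(mean_taylor l x)\<^sup>2 \<le> 4 * exp (real (Suc l) + \<beta> * x\<^sup>2) / (s\<^sup>2) ^ l"
    using \<kappa> by (subst pos_le_divide_eq) (auto simp: s(2))
  also have "\<dots> = 4 * exp (real (Suc l)) * exp (\<beta> * x\<^sup>2) * \<kappa> ^ l / real (Suc l) ^ l"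
    unfolding s(2) exp_add power_divide by simp
  finally have "fact l * (mean_taylor l x)\<^sup>2
      \<le> (real (Suc l) ^ Suc l * exp (- real l)) * (4 * exp (real (Suc l)) * exp (\<beta> * x\<^sup>2) * \<kappa> ^ l / real (Suc l) ^ l)"
    by (intro mult_mono fact_le_power_exp) auto
  also have "\<dots> = 4 * (exp (- real l) * exp (real (Suc l))) * real (Suc l) * \<kappa> ^ l * exp (\<beta> * x\<^sup>2)"
    by (simp del: of_nat_Suc)
  also have "exp (- real l) * exp (real (Suc l)) = exp 1" by (simp add: mult_exp_exp)
  finally show ?thesis by (simp add: \<kappa>_def)
qed

section \<open>Functions with Gaussian-bounded derivatives\<close>

text \<open>The integral form of the remainder is \<open>\<integral> (b - x)\<^sup>q / q! \<phi>\<^sub>q\<^sub>+\<^sub>1(x)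
  dx\<close>, and \<open>\<bar>\<phi>\<^sub>q\<^sub>+\<^sub>1\<bar> \<le> (c \<phi>\<^sub>q\<^sub>+\<^sub>1\<^sup>2 + 1 / c) /
  2\<close> with \<open>c\<close> the inverse of the expected size of \<open>\<phi>\<^sub>q\<^sub>+\<^sub>1\<close>; so a bound of
  the integrals of \<open>\<phi>\<^sub>n\<^sup>2\<close> by \<open>n! / \<rho>\<^sup>n\<close> leaves a remainder of order
  \<open>1 / sqrt (q!)\<close>, up to geometric factors.\<close>

lemma taylor_sums_right_of_L2_bound:
  fixes \<phi> :: "nat \<Rightarrow> real \<Rightarrow> real"
  assumes deriv: "\<And>n x. (\<phi> n has_real_derivative \<phi> (Suc n) x) (at x)"
    and "0 < \<rho>" "a \<le> b"
    and L2: "\<And>n. integral {a..b} (\<lambda>x. (\<phi> n x)\<^sup>2) \<le> C * fact n / \<rho> ^ n"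
  shows "(\<lambda>n. \<phi> n a * (b - a) ^ n / fact n) sums \<phi> 0 b"
proof -
  have cont: "continuous_on S (\<phi> n)" for n S
    using deriv by (intro DERIV_continuous_on) (blast intro: DERIV_subset)
  define R where "R p = \<phi> 0 b - (\<Sum>n<p. \<phi> n a * (b - a) ^ n / fact n)" for p
  define t where "t = 2 * ((b - a)\<^sup>2 / \<rho>)"
  have bound: "\<bar>R (Suc q)\<bar> \<le> sqrt (t ^ q / fact q / \<rho>) * ((C + (b - a)) / 2)" for q
  proof -
    \<comment> \<open>the inverse of the expected size of \<open>\<phi>\<^sub>q\<^sub>+\<^sub>1\<close>\<close>
    define c where "c = sqrt (\<rho> ^ Suc q / fact (Suc q))"
    have c: "c > 0" "c\<^sup>2 = \<rho> ^ Suc q / fact (Suc q)"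
      using assms(2) by (auto simp: c_def del: fact_Suc)
    define w where "w = (b - a) ^ q / fact q"
    have w: "w \<ge> 0" using assms(3) by (simp add: w_def)
    have vec: "(\<phi> m has_vector_derivative \<phi> (Suc m) x) (at x within {a..b})" for m x
      using deriv[of m x] by (auto simp: has_real_derivative_iff_has_vector_derivative
          intro: has_vector_derivative_at_within)
    have h: "((\<lambda>x. ((b - x) ^ q / fact q) * \<phi> (Suc q) x) has_integral R (Suc q)) {a..b}"
      using Taylor_has_integral[of "Suc q" \<phi> "\<phi> 0" a b] vec assms(3)
      by (simp add: R_def mult.commute)
    have pt: "\<bar>((b - x) ^ q / fact q) * \<phi> (Suc q) x\<bar> \<le> w * ((c * (\<phi> (Suc q) x)\<^sup>2 + 1 / c) / 2)"
      if "x \<in> {a..b}" for x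
    proof -
      have "0 \<le> (sqrt c * \<bar>\<phi> (Suc q) x\<bar> - 1 / sqrt c)\<^sup>2" by simp
      also have "\<dots> = c * (\<phi> (Suc q) x)\<^sup>2 + 1 / c - 2 * \<bar>\<phi> (Suc q) x\<bar>"
        using c(1) by (simp add: power2_diff power_divide power_mult_distrib)
      finally have "\<bar>\<phi> (Suc q) x\<bar> \<le> (c * (\<phi> (Suc q) x)\<^sup>2 + 1 / c) / 2" by simp
      moreover have "\<bar>(b - x) ^ q / fact q\<bar> \<le> w"
        using that unfolding w_def abs_divide power_abs by (simp add: divide_right_mono power_mono)
      ultimately show ?thesis unfolding abs_mult by (intro mult_mono w) auto
    qed
    have i: "(\<lambda>x. (\<phi> (Suc q) x)\<^sup>2) integrable_on {a..b}"
      by (intro integrable_continuous_interval continuous_intros cont)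
    have i2: "((\<lambda>x. w * ((c * (\<phi> (Suc q) x)\<^sup>2 + 1 / c) / 2)) has_integral
        w * ((c * integral {a..b} (\<lambda>x. (\<phi> (Suc q) x)\<^sup>2) + (b - a) * (1 / c)) / 2)) {a..b}"
      using has_integral_const_real[of "1 / c" a b] assms(3)
      by (intro has_integral_mult_right has_integral_divide has_integral_add integrable_integral i)
         simp
    have "\<bar>R (Suc q)\<bar> \<le> w * ((c * integral {a..b} (\<lambda>x. (\<phi> (Suc q) x)\<^sup>2) + (b - a) * (1 / c)) / 2)"
      using integral_norm_bound_integral[of _ "{a..b}"] h i2 pt
      by (metis (no_types, lifting) has_integral_iff real_norm_def)
    also have "\<dots> \<le> w * ((c * (C * fact (Suc q) / \<rho> ^ Suc q) + (b - a) * (1 / c)) / 2)"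
      using w c L2[of "Suc q"] by (intro mult_left_mono divide_right_mono add_right_mono) auto
    also have "c * (C * fact (Suc q) / \<rho> ^ Suc q) = C / c"
    proof -
      have "fact (Suc q) / \<rho> ^ Suc q = 1 / c\<^sup>2" unfolding c(2) by (simp del: fact_Suc power_Suc)
      then have "c * (C * fact (Suc q) / \<rho> ^ Suc q) = c * (C * (1 / c\<^sup>2))"
        by (metis times_divide_eq_right)
      then show ?thesis using c(1) by (simp add: power2_eq_square)
    qed
    also have "w * ((C / c + (b - a) * (1 / c)) / 2) = (w / c) * ((C + (b - a)) / 2)"
      using c(1) by (simp add: field_simps)
    also have "\<dots> \<le> sqrt (t ^ q / fact q / \<rho>) * ((C + (b - a)) / 2)"
    proof (intro mult_right_mono)
      have "(w / c)\<^sup>2 = ((b - a)\<^sup>2) ^ q / (fact q)\<^sup>2 * (fact (Suc q) / \<rho> ^ Suc q)"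
        unfolding power_divide c(2) w_def by (simp add: power_mult[symmetric] mult.commute)
      also have "\<dots> = real (Suc q) * (((b - a)\<^sup>2 / \<rho>) ^ q / fact q / \<rho>)"
        by (simp add: power_divide power2_eq_square[of "fact q"] mult_ac del: of_nat_Suc)
      also have "\<dots> \<le> 2 ^ q * (((b - a)\<^sup>2 / \<rho>) ^ q / fact q / \<rho>)"
      proof (intro mult_right_mono)
        show "real (Suc q) \<le> 2 ^ q" using less_exp[of q] by (metis Suc_leI of_nat_le_iff of_nat_numeral of_nat_power)
      qed (use assms(2) in auto)
      also have "\<dots> = t ^ q / fact q / \<rho>" unfolding t_def power_mult_distrib by simp
      finally show "w / c \<le> sqrt (t ^ q / fact q / \<rho>)" by (rule real_le_rsqrt)
      have "0 \<le> integral {a..b} (\<lambda>x. (\<phi> 0 x)\<^sup>2)" by (intro integral_nonneg integrable_continuous_interval continuous_intros cont) auto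
      then have "C \<ge> 0" using L2[of 0] by simp
      then show "(C + (b - a)) / 2 \<ge> 0" using assms(3) by simp
    qed
    finally show ?thesis .
  qed
  have "(\<lambda>q. t ^ q / fact q) \<longlonglongrightarrow> 0"
    using summable_LIMSEQ_zero[OF summable_exp[of t]] by (simp add: divide_inverse mult.commute)
  then have "(\<lambda>q. sqrt (t ^ q / fact q / \<rho>) * ((C + (b - a)) / 2)) \<longlonglongrightarrow> sqrt (0 / \<rho>) * ((C + (b - a)) / 2)"
    using assms(2) by (intro tendsto_intros) auto
  then have lim: "(\<lambda>q. sqrt (t ^ q / fact q / \<rho>) * ((C + (b - a)) / 2)) \<longlonglongrightarrow> 0"
    by (simp only: div_0 real_sqrt_zero mult_zero_left)
  have "(\<lambda>q. R (Suc q)) \<longlonglongrightarrow> 0"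
    by (rule Lim_null_comparison[OF _ lim]) (intro always_eventually allI, simp only: real_norm_def bound)
  then have "R \<longlonglongrightarrow> 0" by (simp add: filterlim_sequentially_Suc)
  then have "(\<lambda>p. \<phi> 0 b - R p) \<longlonglongrightarrow> \<phi> 0 b - 0" by (intro tendsto_intros)
  then show ?thesis by (simp add: sums_def R_def)
qed

text \<open>The case \<open>b < a\<close> follows by reflection.\<close>

lemma taylor_sums_of_L2_bound:
  fixes \<phi> :: "nat \<Rightarrow> real \<Rightarrow> real"
  assumes deriv: "\<And>n x. (\<phi> n has_real_derivative \<phi> (Suc n) x) (at x)"
    and "0 < \<rho>"
    and L2: "\<And>n. integral {min a b..max a b} (\<lambda>x. (\<phi> n x)\<^sup>2) \<le> C * fact n / \<rho> ^ n"
  shows "(\<lambda>n. \<phi> n a * (b - a) ^ n / fact n) sums \<phi> 0 b"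
proof (cases "a \<le> b")
  case True
  then show ?thesis using assms by (intro taylor_sums_right_of_L2_bound[of \<phi> \<rho> a b C]) (auto simp: min_def max_def)
next
  case False
  have "(\<lambda>n. ((-1) ^ n * \<phi> n (- (- a))) * (- b - (- a)) ^ n / fact n) sums ((-1) ^ 0 * \<phi> 0 (- (- b)))"
  proof (rule taylor_sums_right_of_L2_bound[of "\<lambda>n x. (-1) ^ n * \<phi> n (- x)" \<rho> _ _ C])
    show "((\<lambda>x. (-1) ^ n * \<phi> n (- x)) has_real_derivative (-1) ^ Suc n * \<phi> (Suc n) (- x)) (at x)" for n x
      by (rule derivative_eq_intros DERIV_chain2[OF deriv] refl | simp)+
    show "integral {- a..- b} (\<lambda>x. ((-1) ^ n * \<phi> n (- x))\<^sup>2) \<le> C * fact n / \<rho> ^ n" for n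
    proof -
      have "integral {- a..- b} (\<lambda>x. (\<phi> n (- x))\<^sup>2) = integral {b..a} (\<lambda>x. (\<phi> n x)\<^sup>2)"
        by (rule Henstock_Kurzweil_Integration.integral_reflect_real)
      then show ?thesis
        using L2[of n] False
        by (simp add: power_mult_distrib power_mult[symmetric] mult.commute[of n] min_def max_def)
    qed
  qed (use False assms in auto)
  moreover have "((-1) ^ n * \<phi> n a) * (a - b) ^ n = \<phi> n a * (b - a) ^ n" for n
    by (simp add: mult.commute mult.left_commute flip: power_mult_distrib)
  ultimately show ?thesis by simp
qed

text \<open>On a bounded interval the normal density is bounded below, so Gaussian \<open>L\<^sup>2\<close> bounds give Lebesgue
  \<open>L\<^sup>2\<close> bounds.\<close>

lemma integral_le_gauss_integral:
  assumes [measurable]: "f \<in> borel_measurable borel" and "continuous_on {a..b} f" "integrable gauss f" "\<And>x. f x \<ge> 0"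
  shows "integral {a..b} f \<le> (\<integral>x. f x \<partial>gauss) / std_normal_density (max \<bar>a\<bar> \<bar>b\<bar>)"
proof -
  define d where "d = std_normal_density (max \<bar>a\<bar> \<bar>b\<bar>)"
  have d: "d > 0" by (simp add: d_def normal_density_pos)
  have d_le: "d \<le> std_normal_density x" if "x \<in> {a..b}" for x
  proof -
    have "x\<^sup>2 \<le> (max \<bar>a\<bar> \<bar>b\<bar>)\<^sup>2" using that by (intro abs_le_square_iff[THEN iffD1]) auto
    then show ?thesis by (simp add: d_def normal_density_def divide_right_mono)
  qed
  have s: "set_integrable lborel {a..b} f" by (rule borel_integrable_atLeastAtMost') fact
  have i: "integrable lborel (\<lambda>x. std_normal_density x * f x)"
    using assms(3) unfolding gauss_def by (subst (asm) integrable_density) auto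
  have "d * integral {a..b} f = d * (LINT x:{a..b}|lborel. f x)"
    by (simp add: set_borel_integral_eq_integral(2)[OF s])
  also have "\<dots> = (\<integral>x. d * (indicator {a..b} x * f x) \<partial>lborel)"
    by (simp add: set_lebesgue_integral_def)
  also have "\<dots> \<le> (\<integral>x. std_normal_density x * f x \<partial>lborel)"
    using s i d_le assms(4) d
    by (intro integral_mono) (auto simp: set_integrable_def indicator_def intro!: mult_right_mono)
  also have "\<dots> = (\<integral>x. f x \<partial>gauss)"
    unfolding gauss_def by (subst integral_density) auto
  finally show ?thesis using d unfolding d_def[symmetric] by (simp add: field_simps)
qed

text \<open>A sequence of successive derivatives with finite energy \<open>\<Sum>\<^sub>n (2 + \<mu>)\<^sup>n / n!
  \<parallel>\<phi>\<^sub>n\<parallel>\<^sup>2 \<le> K\<close> in the Gaussian \<open>L\<^sup>2\<close> norm. Of the radius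
  \<open>2 + \<mu>\<close>, the part \<open>2\<close> pays for a pointwise bound and the part \<open>\<mu>\<close> for the decay
  of the derivatives.\<close>

locale gauss_analytic =
  fixes \<phi> :: "nat \<Rightarrow> real \<Rightarrow> real" and \<mu> K :: real
  assumes deriv: "\<And>n x. (\<phi> n has_real_derivative \<phi> (Suc n) x) (at x)"
    and mu_pos: "\<mu> > 0" and K_nonneg: "K \<ge> 0"
    and energy: "(\<integral>\<^sup>+x. (\<Sum>n. ennreal ((2 + \<mu>) ^ n / fact n * (\<phi> n x)\<^sup>2)) \<partial>gauss) \<le> ennreal K"
begin

lemma continuous_on_phi: "continuous_on S (\<phi> n)"
  using deriv by (intro DERIV_continuous_on) (blast intro: DERIV_subset)

lemma measurable_phi [measurable]: "\<phi> n \<in> borel_measurable borel"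
  by (intro borel_measurable_continuous_onI continuous_on_phi)

lemma square_integral_phi:
  shows "integrable gauss (\<lambda>x. (\<phi> n x)\<^sup>2)" "(\<integral>x. (\<phi> n x)\<^sup>2 \<partial>gauss) \<le> K * fact n / (2 + \<mu>) ^ n"
proof -
  define c where "c = (2 + \<mu>) ^ n / fact n"
  have c: "c > 0" using mu_pos by (simp add: c_def)
  have "(\<integral>\<^sup>+x. ennreal (c * (\<phi> n x)\<^sup>2) \<partial>gauss) \<le> (\<integral>\<^sup>+x. (\<Sum>n. ennreal ((2 + \<mu>) ^ n / fact n * (\<phi> n x)\<^sup>2)) \<partial>gauss)"
    unfolding c_def using sum_le_suminf[OF summableI, of "{n}" "\<lambda>n. ennreal ((2 + \<mu>) ^ n / fact n * (\<phi> n _)\<^sup>2)"]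
    by (intro nn_integral_mono) simp
  also note energy
  finally have le: "(\<integral>\<^sup>+x. ennreal (c * (\<phi> n x)\<^sup>2) \<partial>gauss) \<le> ennreal K" .
  then have i: "integrable gauss (\<lambda>x. c * (\<phi> n x)\<^sup>2)"
    using c by (intro integrableI_bounded) (auto simp: less_top[symmetric] top_unique)
  then show i2: "integrable gauss (\<lambda>x. (\<phi> n x)\<^sup>2)" using c by simp
  have "c * (\<integral>x. (\<phi> n x)\<^sup>2 \<partial>gauss) \<le> K"
    using le c i i2 K_nonneg by (subst (asm) nn_integral_eq_integral) auto
  then show "(\<integral>x. (\<phi> n x)\<^sup>2 \<partial>gauss) \<le> K * fact n / (2 + \<mu>) ^ n"
    using mu_pos by (simp add: c_def field_simps)
qed

text \<open>\<open>\<phi>\<^sub>l\<close> is entire. Half of the radius \<open>2 + \<mu>\<close> is given away to bound \<open>(l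
  + k)!\<close> by \<open>2\<^sup>l\<^sup>+\<^sup>k l! k!\<close>; any positive radius is good enough here.\<close>

lemma taylor_sums: "(\<lambda>k. \<phi> (l + k) X * (x - X) ^ k / fact k) sums \<phi> l x"
proof -
  define d where "d = std_normal_density (max \<bar>min X x\<bar> \<bar>max X x\<bar>)"
  have d: "d > 0" by (simp add: d_def normal_density_pos)
  define C where "C = K / d * fact l * (2 / (2 + \<mu>)) ^ l"
  have "(\<lambda>k. \<phi> (l + k) X * (x - X) ^ k / fact k) sums \<phi> (l + 0) x"
  proof (rule taylor_sums_of_L2_bound[of "\<lambda>k. \<phi> (l + k)" "(2 + \<mu>) / 2" _ _ C])
    fix k
    have "integral {min X x..max X x} (\<lambda>x. (\<phi> (l + k) x)\<^sup>2) \<le> (\<integral>x. (\<phi> (l + k) x)\<^sup>2 \<partial>gauss) / d"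
      unfolding d_def using square_integral_phi(1)
      by (intro integral_le_gauss_integral continuous_intros continuous_on_phi) auto
    also have "\<dots> \<le> K * fact (l + k) / (2 + \<mu>) ^ (l + k) / d"
      using square_integral_phi(2)[of "l + k"] d by (intro divide_right_mono) auto
    also have "\<dots> \<le> K * (2 ^ (l + k) * fact l * fact k) / (2 + \<mu>) ^ (l + k) / d"
    proof -
      have "real (fact (l + k)) = real ((l + k) choose l) * fact l * fact k"
        by (simp add: binomial_fact)
      also have "\<dots> \<le> 2 ^ (l + k) * fact l * fact k"
        using of_nat_mono[OF binomial_le_pow2[of "l + k" l], where 'a = real] by (intro mult_right_mono) simp_all
      finally show ?thesis using K_nonneg mu_pos d
        by (intro divide_right_mono mult_left_mono) auto
    qed
    also have "\<dots> = C * fact k / ((2 + \<mu>) / 2) ^ k"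
      using mu_pos by (simp add: C_def power_add power_divide field_simps)
    finally show "integral {min X x..max X x} (\<lambda>x. (\<phi> (l + k) x)\<^sup>2) \<le> C * fact k / ((2 + \<mu>) / 2) ^ k" .
  qed (use deriv mu_pos in auto)
  then show ?thesis by simp
qed

text \<open>Expand \<open>\<phi>\<^sub>l(x)\<close> around \<open>X\<close> and apply the Cauchy-Schwarz inequality with weights
  \<open>2\<^sup>k / k!\<close>: the second factor sums to \<open>exp ((x - X)\<^sup>2 / 2)\<close>. The weights of the first
  factor are absorbed by \<open>binomial(l + k, k) 2\<^sup>k \<mu>\<^sup>l \<le> (2 +
  \<mu>)\<^sup>l\<^sup>+\<^sup>k\<close>.\<close>

lemma phi_square_le_energy_density:
  "ennreal ((\<phi> l x)\<^sup>2 * exp (- (x - X)\<^sup>2 / 2) * (\<mu> ^ l / fact l))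
    \<le> (\<Sum>n. ennreal ((2 + \<mu>) ^ n / fact n * (\<phi> n X)\<^sup>2))"
proof (rule LIMSEQ_le_const2)
  show "(\<lambda>n. ennreal ((\<Sum>k<n. \<phi> (l + k) X * (x - X) ^ k / fact k)\<^sup>2 * exp (- (x - X)\<^sup>2 / 2) * (\<mu> ^ l / fact l)))
      \<longlonglongrightarrow> ennreal ((\<phi> l x)\<^sup>2 * exp (- (x - X)\<^sup>2 / 2) * (\<mu> ^ l / fact l))"
    using taylor_sums[of l X x] unfolding sums_def by (intro tendsto_intros)
next
  have bound: "ennreal ((\<Sum>k<n. \<phi> (l + k) X * (x - X) ^ k / fact k)\<^sup>2 * exp (- (x - X)\<^sup>2 / 2) * (\<mu> ^ l / fact l))
    \<le> (\<Sum>n. ennreal ((2 + \<mu>) ^ n / fact n * (\<phi> n X)\<^sup>2))" for n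
  proof -
    define t where "t = (x - X)\<^sup>2 / 2"
    have "(\<Sum>k<n. \<phi> (l + k) X * (x - X) ^ k / fact k)\<^sup>2
        = (\<Sum>k<n. (sqrt (2 ^ k / fact k) * \<phi> (l + k) X) * ((x - X) ^ k / sqrt (2 ^ k * fact k)))\<^sup>2"
      by (intro arg_cong[where f = "\<lambda>z. z\<^sup>2"] sum.cong) (auto simp: real_sqrt_divide real_sqrt_mult)
    also have "\<dots> \<le> (\<Sum>k<n. (sqrt (2 ^ k / fact k) * \<phi> (l + k) X)\<^sup>2) * (\<Sum>k<n. ((x - X) ^ k / sqrt (2 ^ k * fact k))\<^sup>2)"
      by (rule Cauchy_Schwarz_ineq_sum)
    also have "(\<Sum>k<n. ((x - X) ^ k / sqrt (2 ^ k * fact k))\<^sup>2) = (\<Sum>k<n. t ^ k / fact k)"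
    proof (intro sum.cong refl)
      fix k
      have "((x - X) ^ k)\<^sup>2 = ((x - X)\<^sup>2) ^ k" by (simp only: power_mult[symmetric] mult.commute)
      then show "((x - X) ^ k / sqrt (2 ^ k * fact k))\<^sup>2 = t ^ k / fact k"
        by (simp add: t_def power_divide)
    qed
    also have "(\<Sum>k<n. (sqrt (2 ^ k / fact k) * \<phi> (l + k) X)\<^sup>2) * (\<Sum>k<n. t ^ k / fact k)
        \<le> (\<Sum>k<n. (sqrt (2 ^ k / fact k) * \<phi> (l + k) X)\<^sup>2) * exp t"
      by (intro mult_left_mono sum_nonneg sum_power_over_fact_le_exp) (auto simp: t_def)
    finally have "(\<Sum>k<n. \<phi> (l + k) X * (x - X) ^ k / fact k)\<^sup>2 * exp (- t)
        \<le> (\<Sum>k<n. (sqrt (2 ^ k / fact k) * \<phi> (l + k) X)\<^sup>2) * exp t * exp (- t)"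
      by (intro mult_right_mono) auto
    also have "\<dots> = (\<Sum>k<n. 2 ^ k / fact k * (\<phi> (l + k) X)\<^sup>2)"
      by (simp add: mult.assoc mult_exp_exp power_mult_distrib)
    finally have "(\<Sum>k<n. \<phi> (l + k) X * (x - X) ^ k / fact k)\<^sup>2 * exp (- t) * (\<mu> ^ l / fact l)
        \<le> (\<Sum>k<n. 2 ^ k / fact k * (\<phi> (l + k) X)\<^sup>2) * (\<mu> ^ l / fact l)"
      using mu_pos by (intro mult_right_mono) auto
    also have "\<dots> \<le> (\<Sum>k<n. (2 + \<mu>) ^ (l + k) / fact (l + k) * (\<phi> (l + k) X)\<^sup>2)"
      unfolding sum_distrib_right
    proof (intro sum_mono)
      fix k
      have "real ((l + k) choose k) * 2 ^ k * \<mu> ^ l \<le> (\<Sum>j\<le>l + k. real ((l + k) choose j) * 2 ^ j * \<mu> ^ (l + k - j))"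
        using mu_pos member_le_sum[of k "{..l + k}" "\<lambda>j. real ((l + k) choose j) * 2 ^ j * \<mu> ^ (l + k - j)"] by auto
      also have "\<dots> = (2 + \<mu>) ^ (l + k)" by (rule binomial_ring[symmetric])
      finally have "2 ^ k * \<mu> ^ l / (fact k * fact l) \<le> (2 + \<mu>) ^ (l + k) / fact (l + k)"
        by (simp add: binomial_fact field_simps)
      from mult_right_mono[OF this, of "(\<phi> (l + k) X)\<^sup>2"]
      show "2 ^ k / fact k * (\<phi> (l + k) X)\<^sup>2 * (\<mu> ^ l / fact l) \<le> (2 + \<mu>) ^ (l + k) / fact (l + k) * (\<phi> (l + k) X)\<^sup>2"
        by (simp add: mult.commute mult.left_commute)
    qed
    finally have "ennreal ((\<Sum>k<n. \<phi> (l + k) X * (x - X) ^ k / fact k)\<^sup>2 * exp (- t) * (\<mu> ^ l / fact l))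
        \<le> (\<Sum>k<n. ennreal ((2 + \<mu>) ^ (l + k) / fact (l + k) * (\<phi> (l + k) X)\<^sup>2))"
      using mu_pos by (subst sum_ennreal) (auto intro: ennreal_leI)
    also have "\<dots> = (\<Sum>n\<in>(\<lambda>k. l + k) ` {..<n}. ennreal ((2 + \<mu>) ^ n / fact n * (\<phi> n X)\<^sup>2))"
      by (subst sum.reindex) auto
    also have "\<dots> \<le> (\<Sum>n. ennreal ((2 + \<mu>) ^ n / fact n * (\<phi> n X)\<^sup>2))"
      by (intro sum_le_suminf summableI) auto
    finally show ?thesis by (simp add: t_def)
  qed
  then show "\<exists>N. \<forall>n\<ge>N. ennreal ((\<Sum>k<n. \<phi> (l + k) X * (x - X) ^ k / fact k)\<^sup>2 * exp (- (x - X)\<^sup>2 / 2) * (\<mu> ^ l / fact l))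
    \<le> (\<Sum>n. ennreal ((2 + \<mu>) ^ n / fact n * (\<phi> n X)\<^sup>2))" by blast
qed

text \<open>The preceding inequality holds for every \<open>X\<close>; it is integrated over a standard normal
  \<open>X\<close>.\<close>

lemma phi_square_le: "(\<phi> l x)\<^sup>2 \<le> sqrt 2 * exp (x\<^sup>2 / 4) * fact l / \<mu> ^ l * K"
proof -
  define c where "c = (\<phi> l x)\<^sup>2 * (\<mu> ^ l / fact l)"
  have c: "c \<ge> 0" using mu_pos by (simp add: c_def)
  have "ennreal (c * (exp (- x\<^sup>2 / 4) / sqrt 2)) = (\<integral>\<^sup>+X. ennreal (c * exp (- (x - X)\<^sup>2 / 2)) \<partial>gauss)"
    using has_bochner_integral_mult_right[of c, OF gauss_heat_kernel[of x]] c
    by (subst nn_integral_eq_integral) (auto simp: has_bochner_integral_iff)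
  also have "\<dots> \<le> (\<integral>\<^sup>+X. (\<Sum>n. ennreal ((2 + \<mu>) ^ n / fact n * (\<phi> n X)\<^sup>2)) \<partial>gauss)"
    using phi_square_le_energy_density[of l x] by (intro nn_integral_mono) (simp add: c_def mult.assoc mult.commute)
  also note energy
  finally have "c * (exp (- x\<^sup>2 / 4) / sqrt 2) \<le> K" using K_nonneg c by simp
  from mult_right_mono[OF this, of "sqrt 2 * exp (x\<^sup>2 / 4) * fact l / \<mu> ^ l"]
  show ?thesis using mu_pos by (simp add: c_def mult_exp_exp field_simps)
qed

end

section \<open>The expansion in one Gaussian variable\<close>

text \<open>The value of \<open>4 e sqrt 2 (\<Sum>\<^sub>l (l + 1) z\<^sup>l)\<^sup>2\<close> at \<open>z = sqrt ((1 + 1 /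
  \<beta>) / \<mu>)\<close>.\<close>

definition majorant_const :: "real \<Rightarrow> real \<Rightarrow> real" where
  "majorant_const \<beta> \<mu> = 4 * exp 1 * sqrt 2 / (1 - sqrt ((1 + 1 / \<beta>) / \<mu>)) ^ 4"

context gauss_analytic
begin

lemma term_square_le:
  assumes "\<beta> > 0"
  shows "(mean_taylor l x * \<phi> l x)\<^sup>2
    \<le> 4 * exp 1 * sqrt 2 * K * exp ((\<beta> + 1 / 4) * x\<^sup>2) * (real (Suc l) * ((1 + 1 / \<beta>) / \<mu>) ^ l)"
proof -
  have "fact l * (mean_taylor l x)\<^sup>2 * (\<phi> l x)\<^sup>2
      \<le> (4 * exp 1 * real (Suc l) * (1 + 1 / \<beta>) ^ l * exp (\<beta> * x\<^sup>2)) * (sqrt 2 * exp (x\<^sup>2 / 4) * fact l / \<mu> ^ l * K)"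
    using assms by (intro mult_mono fact_mult_mean_taylor_square_le phi_square_le) auto
  also have "\<dots> = fact l * (4 * exp 1 * sqrt 2 * K * (exp (\<beta> * x\<^sup>2) * exp (x\<^sup>2 / 4)) * (real (Suc l) * ((1 + 1 / \<beta>) / \<mu>) ^ l))"
    by (simp only: power_divide times_divide_eq_left times_divide_eq_right mult_ac)
  also have "exp (\<beta> * x\<^sup>2) * exp (x\<^sup>2 / 4) = exp ((\<beta> + 1 / 4) * x\<^sup>2)"
    unfolding mult_exp_exp by (simp add: distrib_right)
  finally show ?thesis by (simp add: power_mult_distrib mult.assoc del: of_nat_Suc)
qed

text \<open>The bounds on the coefficients and on the derivatives are multiplied; the factorials cancel and a geometric series
  remains. The majorant is the same for all \<open>N\<close> and is integrable for the normal law when \<open>\<beta> < 1 /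
  4\<close>.\<close>

lemma partial_sum_square_le:
  assumes "\<beta> > 0" "1 + 1 / \<beta> < \<mu>"
  shows "(\<Sum>l<N. mean_taylor l x * \<phi> l x)\<^sup>2 \<le> majorant_const \<beta> \<mu> * K * exp ((\<beta> + 1 / 4) * x\<^sup>2)"
proof -
  define q where "q = (1 + 1 / \<beta>) / \<mu>"
  define B where "B = 4 * exp 1 * sqrt 2 * K * exp ((\<beta> + 1 / 4) * x\<^sup>2)"
  have q: "0 < q" "q < 1" using assms mu_pos by (auto simp: q_def add_pos_pos)
  have B: "B \<ge> 0" using K_nonneg by (simp add: B_def)
  define z where "z = sqrt q"
  have z: "0 \<le> z" "z < 1" using q by (auto simp: z_def)
  have "\<bar>mean_taylor l x * \<phi> l x\<bar> \<le> sqrt B * (real (Suc l) * z ^ l)" for l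
  proof -
    have "\<bar>mean_taylor l x * \<phi> l x\<bar> \<le> sqrt (B * (real (Suc l) * q ^ l))"
      using term_square_le[OF assms(1), of l x] unfolding B_def[symmetric] q_def[symmetric]
      by (intro real_le_rsqrt) simp
    also have "\<dots> = sqrt B * (sqrt (real (Suc l)) * z ^ l)"
      by (simp add: real_sqrt_mult real_sqrt_power z_def)
    also have "\<dots> \<le> sqrt B * (real (Suc l) * z ^ l)"
    proof (intro mult_left_mono mult_right_mono)
      show "sqrt (real (Suc l)) \<le> real (Suc l)" by (intro real_le_lsqrt) (auto simp: power2_eq_square)
    qed (use z B in auto)
    finally show ?thesis .
  qed
  then have "\<bar>\<Sum>l<N. mean_taylor l x * \<phi> l x\<bar> \<le> (\<Sum>l<N. sqrt B * (real (Suc l) * z ^ l))"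
    by (intro order_trans[OF sum_abs] sum_mono) auto
  also have "\<dots> = sqrt B * (\<Sum>l<N. real (Suc l) * z ^ l)"
    by (simp only: sum_distrib_left)
  also have "\<dots> \<le> sqrt B * (1 / (1 - z)\<^sup>2)"
  proof (intro mult_left_mono)
    have "(\<lambda>l. real (Suc l) * z ^ l) sums (1 / (1 - z)\<^sup>2)"
      using geometric_deriv_sums[of z] z by simp
    then show "(\<Sum>l<N. real (Suc l) * z ^ l) \<le> 1 / (1 - z)\<^sup>2"
      using z sum_le_suminf[of "\<lambda>l. real (Suc l) * z ^ l" "{..<N}"] by (auto simp: sums_iff)
  qed (use B in auto)
  finally have "\<bar>\<Sum>l<N. mean_taylor l x * \<phi> l x\<bar>\<^sup>2 \<le> (sqrt B * (1 / (1 - z)\<^sup>2))\<^sup>2"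
    by (intro power_mono) auto
  also have "\<dots> = B / (1 - z) ^ 4"
    using B by (simp add: power_mult_distrib power_divide flip: power_mult)
  also have "\<dots> = majorant_const \<beta> \<mu> * K * exp ((\<beta> + 1 / 4) * x\<^sup>2)"
    by (simp add: B_def majorant_const_def z_def q_def)
  finally show ?thesis by simp
qed

text \<open>The partial sum is the mean over \<open>y\<close> of the Taylor polynomial at \<open>x\<close> evaluated at
  \<open>y\<close>, which converges to \<open>\<phi>\<^sub>0(y)\<close>. The Taylor polynomials are dominated by splitting each
  term by \<open>\<bar>u v\<bar> \<le> u\<^sup>2 + v\<^sup>2\<close> into \<open>4\<^sup>l \<phi>\<^sub>l(x)\<^sup>2 / l!\<close>,
  summable since \<open>\<mu> > 4\<close>, and \<open>((y - x)\<^sup>2 / 4)\<^sup>l / l!\<close>, which sums to a function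
  integrable for the normal law.\<close>

lemma partial_sum_tendsto:
  assumes "\<mu> > 4"
  shows "(\<lambda>N. \<Sum>l<N. mean_taylor l x * \<phi> l x) \<longlonglongrightarrow> (\<integral>y. \<phi> 0 y \<partial>gauss)"
proof -
  define B where "B = sqrt 2 * exp (x\<^sup>2 / 4) * K"
  have B: "B \<ge> 0" using K_nonneg by (simp add: B_def)
  define C where "C = B * (1 / (1 - 4 / \<mu>))"
  have abs_bound: "\<bar>\<Sum>l<N. \<phi> l x * ((y - x) ^ l / fact l)\<bar> \<le> C + exp (3 / 4 * x\<^sup>2) * exp (3 / 8 * y\<^sup>2)" for N y
  proof -
    define t where "t = (y - x)\<^sup>2 / 4"
    have "\<bar>\<phi> l x * ((y - x) ^ l / fact l)\<bar> \<le> B * (4 / \<mu>) ^ l + t ^ l / fact l" for l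
    proof -
      have "0 \<le> (2 ^ l * \<bar>\<phi> l x\<bar> - \<bar>(y - x) ^ l\<bar> / 2 ^ l)\<^sup>2" by simp
      also have "\<dots> = 4 ^ l * (\<phi> l x)\<^sup>2 + t ^ l - 2 * \<bar>\<phi> l x * (y - x) ^ l\<bar>"
      proof -
        have "(2 ^ l)\<^sup>2 = (4::real) ^ l" "((y - x) ^ l)\<^sup>2 = ((y - x)\<^sup>2) ^ l"
          by (simp_all only: power_mult[symmetric] mult.commute[of l]) (simp add: power_mult)
        then show ?thesis
          by (simp add: power2_diff power_mult_distrib power_divide abs_mult t_def)
      qed
      also have "\<dots> \<le> 4 ^ l * (\<phi> l x)\<^sup>2 + t ^ l - \<bar>\<phi> l x * (y - x) ^ l\<bar>" by simp
      finally have "\<bar>\<phi> l x * (y - x) ^ l\<bar> \<le> 4 ^ l * (\<phi> l x)\<^sup>2 + t ^ l" by simp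
      also have "\<dots> \<le> 4 ^ l * (B * fact l / \<mu> ^ l) + t ^ l"
        using phi_square_le[of l x] by (intro add_right_mono mult_left_mono) (auto simp: B_def mult_ac)
      finally have "\<bar>\<phi> l x * (y - x) ^ l\<bar> / fact l \<le> (4 ^ l * (B * fact l / \<mu> ^ l) + t ^ l) / fact l"
        by (intro divide_right_mono) auto
      then show ?thesis by (simp add: power_divide add_divide_distrib abs_divide abs_mult mult_ac)
    qed
    then have "\<bar>\<Sum>l<N. \<phi> l x * ((y - x) ^ l / fact l)\<bar> \<le> (\<Sum>l<N. B * (4 / \<mu>) ^ l + t ^ l / fact l)"
      by (intro order_trans[OF sum_abs] sum_mono) auto
    also have "\<dots> = B * (\<Sum>l<N. (4 / \<mu>) ^ l) + (\<Sum>l<N. t ^ l / fact l)"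
      by (simp add: sum.distrib sum_distrib_left)
    also have "\<dots> \<le> C + exp t"
    proof (intro add_mono sum_power_over_fact_le_exp)
      have "(\<lambda>l. (4 / \<mu>) ^ l) sums (1 / (1 - 4 / \<mu>))" using assms by (intro geometric_sums) auto
      then have "(\<Sum>l<N. (4 / \<mu>) ^ l) \<le> 1 / (1 - 4 / \<mu>)"
        using assms sum_le_suminf[of "\<lambda>l. (4 / \<mu>) ^ l" "{..<N}"] by (auto simp: sums_iff)
      then show "B * (\<Sum>l<N. (4 / \<mu>) ^ l) \<le> C" unfolding C_def using B by (rule mult_left_mono)
    qed (simp add: t_def)
    \<comment> \<open>\<open>(y - x)\<^sup>2 \<le> (3 / 2) y\<^sup>2 + 3 x\<^sup>2\<close>; with the symmetric splitting into
      \<open>2 y\<^sup>2 + 2 x\<^sup>2\<close> the factor of \<open>y\<^sup>2\<close> would be \<open>1 / 2\<close>, and its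
      exponential would not be integrable\<close>
    also have "exp t \<le> exp (3 / 4 * x\<^sup>2 + 3 / 8 * y\<^sup>2)"
      using zero_le_power2[of "y + 2 * x"] by (simp add: t_def power2_eq_square algebra_simps)
    finally show ?thesis by (simp add: exp_add)
  qed
  have "(\<lambda>N. \<integral>y. (\<Sum>l<N. \<phi> l x * ((y - x) ^ l / fact l)) \<partial>gauss) \<longlonglongrightarrow> (\<integral>y. \<phi> 0 y \<partial>gauss)"
  proof (rule integral_dominated_convergence[where w = "\<lambda>y. C + exp (3 / 4 * x\<^sup>2) * exp (3 / 8 * y\<^sup>2)"])
    show "AE y in gauss. (\<lambda>N. \<Sum>l<N. \<phi> l x * ((y - x) ^ l / fact l)) \<longlonglongrightarrow> \<phi> 0 y"
      using taylor_sums[of 0 x] by (auto simp: sums_def)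
    show "integrable gauss (\<lambda>y. C + exp (3 / 4 * x\<^sup>2) * exp (3 / 8 * y\<^sup>2))"
      by (intro Bochner_Integration.integrable_add integrable_mult_right gauss_exp_square_integrable) auto
  qed (use abs_bound in auto)
  also have "(\<lambda>N. \<integral>y. (\<Sum>l<N. \<phi> l x * ((y - x) ^ l / fact l)) \<partial>gauss) = (\<lambda>N. \<Sum>l<N. mean_taylor l x * \<phi> l x)"
    using integrable_gauss_shift_power
    by (subst Bochner_Integration.integral_sum) (auto simp: mean_taylor_def mult.commute)
  finally show ?thesis .
qed

end

section \<open>Growth of the derivatives\<close>

text \<open>The weight of the derivative of order \<open>3 n\<close> in the hypothesis of the theorem at \<open>L = 2 n\<close>,
  multiplied by \<open>(3 n)!\<close>.\<close>

definition growth_weight :: "nat \<Rightarrow> real" where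
  "growth_weight n = real ((2 * n) choose n) ^ 4 * fact n * fact (3 * n) / (fact (2 * n))\<^sup>2"

lemma growth_weight_eq: "growth_weight n = (fact (2 * n))\<^sup>2 * fact (3 * n) / fact n ^ 7"
proof -
  have "real ((2 * n) choose n) = fact (2 * n) / (fact n)\<^sup>2"
    by (simp add: binomial_fact power2_eq_square)
  then show ?thesis
    by (simp add: growth_weight_def power_divide power2_eq_square) (simp add: power_def numeral_eq_Suc)
qed

lemma growth_weight_Suc:
  "growth_weight (Suc n) * real (Suc n) ^ 4 = growth_weight n * (12 * (2 * real n + 1)\<^sup>2 * (3 * real n + 2) * (3 * real n + 1))"
proof -
  define s where "s = real (Suc n)"
  have s: "s > 0" "s = real n + 1" by (auto simp: s_def)
  have 2: "fact (2 * Suc n) = 2 * s * (2 * real n + 1) * fact (2 * n)"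
    by (simp add: s(2) algebra_simps)
  have 3: "fact (3 * Suc n) = 3 * s * (3 * real n + 2) * (3 * real n + 1) * fact (3 * n)"
    by (simp add: s(2) numeral_3_eq_3 algebra_simps)
  have 1: "fact (Suc n) = s * fact n" by (simp add: s(2))
  have "growth_weight (Suc n) * s ^ 4
      = (2 * s * (2 * real n + 1) * fact (2 * n))\<^sup>2 * (3 * s * (3 * real n + 2) * (3 * real n + 1) * fact (3 * n)) * s ^ 4 / (s * fact n) ^ 7"
    unfolding growth_weight_eq 1 2 3 by simp
  also have "\<dots> = (fact (2 * n))\<^sup>2 * fact (3 * n) / fact n ^ 7 * (12 * (2 * real n + 1)\<^sup>2 * (3 * real n + 2) * (3 * real n + 1)) * (s ^ 7 / s ^ 7)"
    by (simp add: power_mult_distrib power2_eq_square) (simp add: numeral_eq_Suc mult_ac)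
  finally show ?thesis using s(1) unfolding growth_weight_eq[symmetric] s_def by simp
qed

text \<open>The quotient of successive weights tends to \<open>432\<close>. The value \<open>406\<close> is chosen as an integer
  above \<open>(37 / 5)\<^sup>3 = 405.224\<close>, and the quotient exceeds it from \<open>n = 40\<close> on.\<close>

lemma growth_weight_lower_bound:
  assumes "n \<ge> 40"
  shows "growth_weight n \<ge> growth_weight 40 / 406 ^ 40 * 406 ^ n"
  using assms
proof (induction n rule: dec_induct)
  case (step n)
  define x where "x = real n"
  have x: "x \<ge> 40" using step(1) by (simp add: x_def)
  have "406 * (x + 1) ^ 4 \<le> 12 * (2 * x + 1)\<^sup>2 * (3 * x + 2) * (3 * x + 1)"
  proof -
    \<comment> \<open>the difference of the two sides is this product plus a positive constant\<close>
    have "0 \<le> (x - 40) * (26 * x ^ 3 + 280 * x\<^sup>2 + 9400 * x + 374580)"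
      using x by (intro mult_nonneg_nonneg add_nonneg_nonneg) auto
    then show ?thesis by (simp add: algebra_simps power2_eq_square power3_eq_cube numeral_eq_Suc)
  qed
  moreover have "growth_weight n \<ge> 0" by (simp add: growth_weight_def)
  ultimately have "growth_weight n * (406 * (x + 1) ^ 4) \<le> growth_weight (Suc n) * (x + 1) ^ 4"
    using growth_weight_Suc[of n] by (simp add: x_def mult_left_mono add.commute)
  then have "growth_weight n * 406 \<le> growth_weight (Suc n)"
    using x by (simp add: mult.assoc[symmetric])
  then show ?case using step.IH by simp
qed simp

text \<open>All summands being nonnegative, a single one is eventually at most \<open>1\<close>. For order \<open>k = 3 n +
  r\<close> with \<open>r < 3\<close> the summand with \<open>L\<close> about \<open>2 n\<close> and \<open>i\<close> about
  \<open>n\<close> is used; for \<open>r > 0\<close> its weight is compared with the one for \<open>r = 0\<close>, at the price of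
  a factor \<open>3 / 4\<close>.\<close>

lemma growth_of_weighted_sums:
  fixes b :: "nat \<Rightarrow> real"
  assumes nonneg: "\<And>k. b k \<ge> 0"
    and lim: "(\<lambda>L. \<Sum>i\<le>L. b (2 * L - i) * real (L choose i) ^ 4 * (fact i / (fact L)\<^sup>2)) \<longlonglongrightarrow> 0"
  shows "\<exists>C\<ge>0. \<forall>\<^sub>F k in sequentially. b k \<le> C * fact k / (37 / 5) ^ k"
proof -
  from order_tendstoD(2)[OF lim, of 1] obtain L0 where
    L0: "\<And>L. L \<ge> L0 \<Longrightarrow> (\<Sum>i\<le>L. b (2 * L - i) * real (L choose i) ^ 4 * (fact i / (fact L)\<^sup>2)) < 1"
    by (auto simp: eventually_sequentially)
  have term_le: "b (2 * L - i) * (real (L choose i) ^ 4 * (fact i / (fact L)\<^sup>2)) \<le> 1" if "L \<ge> L0" "i \<le> L" for L i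
  proof -
    have "b (2 * L - i) * real (L choose i) ^ 4 * (fact i / (fact L)\<^sup>2)
        \<le> (\<Sum>i\<le>L. b (2 * L - i) * real (L choose i) ^ 4 * (fact i / (fact L)\<^sup>2))"
      using nonneg that by (intro member_le_sum) auto
    then show ?thesis using L0[OF that(1)] unfolding mult.assoc by linarith
  qed
  define c where "c = growth_weight 40 / 406 ^ 40"
  have c: "c > 0" by (simp add: c_def growth_weight_eq)
  have main: "b (3 * n + r) * (3 / 4 * growth_weight n) \<le> fact (3 * n + r)" if "n \<ge> L0" "r < 3" for n r
  proof -
    \<comment> \<open>chosen such that \<open>2 L - i = 3 n + r\<close>\<close>
    define L where "L = (if r = 0 then 2 * n else 2 * n + 1)"
    define i where "i = (if r = 1 then n + 1 else n)"
    have Li: "2 * L - i = 3 * n + r" "L0 \<le> L" "i \<le> L"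
      using that by (auto simp: L_def i_def)
    have ch: "(2 * n) choose n \<le> L choose i"
      by (auto simp: L_def i_def intro: binomial_right_mono)
    have "3 / 4 * growth_weight n = 3 / 4 * (real ((2 * n) choose n) ^ 4 * (fact n * fact (3 * n) / (fact (2 * n))\<^sup>2))"
      by (simp add: growth_weight_def)
    also have "\<dots> = real ((2 * n) choose n) ^ 4 * (3 / 4 * (fact n * fact (3 * n) / (fact (2 * n))\<^sup>2))"
      by simp
    also have "\<dots> \<le> real (L choose i) ^ 4 * (fact i * fact (3 * n + r) / (fact L)\<^sup>2)"
    proof (intro mult_mono power_mono)
      define A where "A = fact n * fact (3 * n) / (fact (2 * n) :: real)\<^sup>2"
      have A: "A \<ge> 0" by (simp add: A_def)
      from that(2) consider "r = 0" | "r = 1" | "r = 2" by linarith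
      then show "3 / 4 * (fact n * fact (3 * n) / (fact (2 * n) :: real)\<^sup>2) \<le> fact i * fact (3 * n + r) / (fact L)\<^sup>2"
      proof cases
        case 1
        have "3 / 4 * A \<le> A" using A by simp
        then show ?thesis using 1 by (simp add: i_def L_def A_def)
      next
        case 2
        then have "fact i * fact (3 * n + r) / (fact L)\<^sup>2 = A * ((real n + 1) * (3 * real n + 1) / (2 * real n + 1)\<^sup>2)"
          by (simp add: i_def L_def A_def power_mult_distrib) (simp add: mult_ac add.commute)
        moreover have "3 / 4 \<le> (real n + 1) * (3 * real n + 1) / (2 * real n + 1)\<^sup>2"
          by (simp add: pos_le_divide_eq add_pos_nonneg) (simp add: power2_eq_square algebra_simps)
        ultimately show ?thesis
          unfolding A_def[symmetric] by (metis mult_left_mono[OF _ A] mult.commute)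
      next
        case 3
        then have "fact i * fact (3 * n + r) / (fact L)\<^sup>2 = A * ((3 * real n + 2) * (3 * real n + 1) / (2 * real n + 1)\<^sup>2)"
          by (simp add: i_def L_def A_def power_mult_distrib) (simp add: mult_ac add.commute)
        moreover have "3 / 4 \<le> (3 * real n + 2) * (3 * real n + 1) / (2 * real n + 1)\<^sup>2"
          by (simp add: pos_le_divide_eq add_pos_nonneg) (simp add: power2_eq_square algebra_simps)
        ultimately show ?thesis
          unfolding A_def[symmetric] by (metis mult_left_mono[OF _ A] mult.commute)
      qed
    qed (use ch in auto)
    finally have "b (3 * n + r) * (3 / 4 * growth_weight n)
        \<le> b (3 * n + r) * (real (L choose i) ^ 4 * (fact i * fact (3 * n + r) / (fact L)\<^sup>2))"
      by (rule mult_left_mono[OF _ nonneg])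
    also have "\<dots> = (b (2 * L - i) * (real (L choose i) ^ 4 * (fact i / (fact L)\<^sup>2))) * fact (3 * n + r)"
      unfolding Li(1) by simp
    also have "\<dots> \<le> 1 * fact (3 * n + r)"
      by (intro mult_right_mono term_le Li) auto
    finally show ?thesis by simp
  qed
  define C where "C = 4 / 3 * (37 / 5)\<^sup>2 / c"
  have "b k \<le> C * fact k / (37 / 5) ^ k" if k: "k \<ge> 3 * (L0 + 40)" for k
  proof -
    define n where "n = k div 3"
    define r where "r = k mod 3"
    have kr: "k = 3 * n + r" "r < 3" "n \<ge> L0" "n \<ge> 40" using k by (auto simp: n_def r_def)
    have "(37 / 5 :: real) ^ k = ((37 / 5) ^ 3) ^ n * (37 / 5) ^ r"
      by (simp add: kr(1) power_add power_mult)
    also have "\<dots> \<le> 406 ^ n * (37 / 5)\<^sup>2"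
      using kr(2) by (intro mult_mono power_mono power_increasing) (auto simp: power3_eq_cube)
    finally have "b k * (37 / 5) ^ k \<le> b k * (406 ^ n * (37 / 5)\<^sup>2)"
      by (rule mult_left_mono[OF _ nonneg])
    also have "\<dots> = (b k * (3 / 4 * (c * 406 ^ n))) * C"
      using c by (simp add: C_def)
    also have "\<dots> \<le> (b k * (3 / 4 * growth_weight n)) * C"
      using growth_weight_lower_bound[OF kr(4)] c nonneg
      by (intro mult_right_mono mult_left_mono) (auto simp: C_def c_def)
    also have "\<dots> \<le> fact k * C"
      using main[OF kr(3,2)] c by (intro mult_right_mono) (auto simp: kr(1) C_def)
    finally show ?thesis by (simp add: pos_le_divide_eq mult.commute)
  qed
  moreover have "C \<ge> 0" using c by (simp add: C_def)
  ultimately show ?thesis by (auto simp: eventually_sequentially)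
qed

lemma summable_energy:
  fixes b :: "nat \<Rightarrow> real"
  assumes nonneg: "\<And>k. b k \<ge> 0"
    and lim: "(\<lambda>L. \<Sum>i\<le>L. b (2 * L - i) * real (L choose i) ^ 4 * (fact i / (fact L)\<^sup>2)) \<longlonglongrightarrow> 0"
  shows "summable (\<lambda>k. (73 / 10) ^ k / fact k * b k)"
proof -
  from growth_of_weighted_sums[OF assms] obtain C where
    C: "\<forall>\<^sub>F k in sequentially. b k \<le> C * fact k / (37 / 5) ^ k" by blast
  show ?thesis
  proof (rule summable_comparison_test_ev)
    show "\<forall>\<^sub>F k in sequentially. norm ((73 / 10) ^ k / fact k * b k) \<le> C * (73 / 74) ^ k"
      using C
    proof eventually_elim
      case (elim k)
      have "(73 / 10) ^ k / fact k * b k \<le> (73 / 10) ^ k / fact k * (C * fact k / (37 / 5) ^ k)"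
        using elim by (intro mult_left_mono) auto
      also have "\<dots> = C * ((73 / 10) ^ k / (37 / 5) ^ k)" by simp
      also have "\<dots> = C * (73 / 74) ^ k" by (simp flip: power_divide)
      finally show ?case using nonneg by simp
    qed
    show "summable (\<lambda>k. C * (73 / 74 :: real) ^ k)" by (intro summable_mult summable_geometric) simp
  qed
qed

section \<open>The expansion with parameters\<close>

lemma mean_taylor_measurable [measurable]: "mean_taylor l \<in> borel_measurable borel"
proof -
  have "mean_taylor l = (\<lambda>x. fps_nth (gauss_moment_fps * fps_exp (- x)) l)"
    by (simp add: mean_taylor_fps fun_eq_iff)
  then show ?thesis by (simp add: fps_mult_nth)
qed

text \<open>The parameter \<open>b\<close> stands for the other increments. By Fubini's theorem, the energy of the section at
  \<open>b\<close> is finite for almost every \<open>b\<close> and is integrable in \<open>b\<close>. So the one-dimensional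
  bounds, whose constants depend on the section through its energy only, add up to an integrable majorant.\<close>

lemma L2_expansion_product:
  fixes f :: "nat \<Rightarrow> 'b \<Rightarrow> real \<Rightarrow> real"
  assumes Q: "prob_space Q"
    and \<beta>: "0 < \<beta>" "\<beta> < 1 / 4" "1 + 1 / \<beta> < \<mu>"
    and meas [measurable]: "\<And>n. case_prod (f n) \<in> borel_measurable (Q \<Otimes>\<^sub>M gauss)"
    and deriv: "\<And>n b y. b \<in> space Q \<Longrightarrow> (f n b has_real_derivative f (Suc n) b y) (at y)"
    and int: "\<And>n. integrable (Q \<Otimes>\<^sub>M gauss) (\<lambda>(b, y). (f n b y)\<^sup>2)"
    and summ: "summable (\<lambda>n. (2 + \<mu>) ^ n / fact n * (\<integral>(b, y). (f n b y)\<^sup>2 \<partial>(Q \<Otimes>\<^sub>M gauss)))"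
  defines "S \<equiv> \<lambda>N (b, y). \<Sum>l<N. mean_taylor l y * f l b y"
    and "\<psi> \<equiv> \<lambda>(b, y::real). \<integral>z. f 0 b z \<partial>gauss"
  shows "\<And>N. integrable (Q \<Otimes>\<^sub>M gauss) (\<lambda>p. (S N p)\<^sup>2)"
    and "integrable (Q \<Otimes>\<^sub>M gauss) (\<lambda>p. (\<psi> p)\<^sup>2)"
    and "(\<lambda>N. \<integral>p. (S N p - \<psi> p)\<^sup>2 \<partial>(Q \<Otimes>\<^sub>M gauss)) \<longlonglongrightarrow> 0"
proof -
  interpret Q: prob_space Q by (rule Q)
  interpret QG: pair_sigma_finite Q gauss ..
  have "4 < 1 / \<beta>" using \<beta> by (simp add: field_simps)
  then have \<mu>: "\<mu> > 4" using \<beta>(3) by simp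
  have [measurable]: "S N \<in> borel_measurable (Q \<Otimes>\<^sub>M gauss)" for N
    unfolding S_def by measurable
  have [measurable]: "\<psi> \<in> borel_measurable (Q \<Otimes>\<^sub>M gauss)"
    unfolding \<psi>_def by measurable
  define k where "k b = (\<integral>\<^sup>+y. (\<Sum>n. ennreal ((2 + \<mu>) ^ n / fact n * (f n b y)\<^sup>2)) \<partial>gauss)" for b
  have k_meas [measurable]: "k \<in> borel_measurable Q" unfolding k_def by measurable
  have "(\<integral>\<^sup>+b. k b \<partial>Q) = (\<integral>\<^sup>+(b, y). (\<Sum>n. ennreal ((2 + \<mu>) ^ n / fact n * (f n b y)\<^sup>2)) \<partial>(Q \<Otimes>\<^sub>M gauss))"
    unfolding k_def by (subst gauss.nn_integral_fst[symmetric]) (auto simp: case_prod_beta)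
  also have "\<dots> = (\<Sum>n. \<integral>\<^sup>+(b, y). ennreal ((2 + \<mu>) ^ n / fact n * (f n b y)\<^sup>2) \<partial>(Q \<Otimes>\<^sub>M gauss))"
    unfolding case_prod_beta by (rule nn_integral_suminf) measurable
  also have "\<dots> = (\<Sum>n. ennreal ((2 + \<mu>) ^ n / fact n * (\<integral>(b, y). (f n b y)\<^sup>2 \<partial>(Q \<Otimes>\<^sub>M gauss))))"
  proof (rule suminf_cong)
    fix n
    have "(\<integral>\<^sup>+p. ennreal ((2 + \<mu>) ^ n / fact n * (f n (fst p) (snd p))\<^sup>2) \<partial>(Q \<Otimes>\<^sub>M gauss))
        = ennreal (\<integral>p. (2 + \<mu>) ^ n / fact n * (f n (fst p) (snd p))\<^sup>2 \<partial>(Q \<Otimes>\<^sub>M gauss))"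
      using int[of n] \<mu> by (intro nn_integral_eq_integral integrable_mult_right) (simp_all add: case_prod_beta')
    then show "(\<integral>\<^sup>+(b, y). ennreal ((2 + \<mu>) ^ n / fact n * (f n b y)\<^sup>2) \<partial>(Q \<Otimes>\<^sub>M gauss))
        = ennreal ((2 + \<mu>) ^ n / fact n * (\<integral>(b, y). (f n b y)\<^sup>2 \<partial>(Q \<Otimes>\<^sub>M gauss)))"
      by (simp add: case_prod_beta')
  qed
  also have "\<dots> < top"
    using summ \<mu> by (subst suminf_ennreal2) (auto intro!: mult_nonneg_nonneg divide_nonneg_nonneg Bochner_Integration.integral_nonneg)
  finally have k_fin: "(\<integral>\<^sup>+b. k b \<partial>Q) < top" .

  define \<alpha> where "\<alpha> = \<beta> + 1 / 4"
  have "integrable gauss (\<lambda>y. exp (\<alpha> * y\<^sup>2))"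
    using \<beta> by (intro gauss_exp_square_integrable) (simp add: \<alpha>_def)
  then have e_fin: "(\<integral>\<^sup>+y. ennreal (exp (\<alpha> * y\<^sup>2)) \<partial>gauss) < top"
    by (simp add: nn_integral_eq_integral)
  define w where "w p = majorant_const \<beta> \<mu> * enn2real (k (fst p)) * exp (\<alpha> * (snd p)\<^sup>2)" for p :: "'b \<times> real"
  have dc: "majorant_const \<beta> \<mu> \<ge> 0" by (simp add: majorant_const_def)
  have [measurable]: "w \<in> borel_measurable (Q \<Otimes>\<^sub>M gauss)" unfolding w_def by measurable
  have w_nonneg: "w p \<ge> 0" for p using dc by (simp add: w_def)
  have w_int: "integrable (Q \<Otimes>\<^sub>M gauss) w"
  proof (rule integrableI_nonneg)
    have "(\<integral>\<^sup>+p. ennreal (w p) \<partial>(Q \<Otimes>\<^sub>M gauss))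
        = (\<integral>\<^sup>+b. \<integral>\<^sup>+y. ennreal (majorant_const \<beta> \<mu>) * ennreal (enn2real (k b)) * ennreal (exp (\<alpha> * y\<^sup>2)) \<partial>gauss \<partial>Q)"
      using dc by (subst gauss.nn_integral_fst[symmetric]) (auto simp: w_def ennreal_mult)
    also have "\<dots> = ennreal (majorant_const \<beta> \<mu>) * (\<integral>\<^sup>+b. ennreal (enn2real (k b)) \<partial>Q) * (\<integral>\<^sup>+y. ennreal (exp (\<alpha> * y\<^sup>2)) \<partial>gauss)"
      by (simp add: nn_integral_cmult nn_integral_multc)
    also have "\<dots> < top"
    proof -
      have "(\<integral>\<^sup>+b. ennreal (enn2real (k b)) \<partial>Q) \<le> (\<integral>\<^sup>+b. k b \<partial>Q)"
        by (intro nn_integral_mono) (simp add: ennreal_enn2real_if)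
      then have "(\<integral>\<^sup>+b. ennreal (enn2real (k b)) \<partial>Q) < top" using k_fin by (rule le_less_trans)
      then show ?thesis using e_fin by (simp add: ennreal_mult_less_top)
    qed
    finally show "(\<integral>\<^sup>+p. ennreal (w p) \<partial>(Q \<Otimes>\<^sub>M gauss)) < \<infinity>" by simp
  qed (use w_nonneg in auto)

  have "(\<integral>\<^sup>+p. k (fst p) \<partial>(Q \<Otimes>\<^sub>M gauss)) = (\<integral>\<^sup>+b. k b \<partial>Q)"
    using gauss.emeasure_space_1 by (subst gauss.nn_integral_fst[symmetric]) auto
  then have "AE p in Q \<Otimes>\<^sub>M gauss. k (fst p) \<noteq> \<infinity>"
    using k_fin by (intro nn_integral_noteq_infinite) auto
  with AE_space have good: "AE p in Q \<Otimes>\<^sub>M gauss. (\<forall>N. (S N p)\<^sup>2 \<le> w p) \<and> (\<lambda>N. S N p) \<longlonglongrightarrow> \<psi> p \<and> (\<psi> p)\<^sup>2 \<le> w p"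
  proof eventually_elim
    case (elim p)
    obtain b y where p: "p = (b, y)" by (cases p)
    have b: "b \<in> space Q" using elim by (simp add: p space_pair_measure)
    interpret gauss_analytic "\<lambda>n. f n b" \<mu> "enn2real (k b)"
    proof
      show "(\<integral>\<^sup>+x. (\<Sum>n. ennreal ((2 + \<mu>) ^ n / fact n * (f n b x)\<^sup>2)) \<partial>gauss) \<le> ennreal (enn2real (k b))"
        unfolding k_def[symmetric] using elim by (simp add: p less_top)
    qed (use deriv b \<mu> in auto)
    have le: "(S N p)\<^sup>2 \<le> w p" for N
      using partial_sum_square_le[OF \<beta>(1,3), of y N] by (simp add: S_def w_def p \<alpha>_def)
    have lim: "(\<lambda>N. S N p) \<longlonglongrightarrow> \<psi> p"
      using partial_sum_tendsto[OF \<mu>, of y] by (simp add: S_def \<psi>_def p)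
    have "(\<psi> p)\<^sup>2 \<le> w p"
      using le by (intro LIMSEQ_le_const2[OF tendsto_power[OF lim]]) auto
    with le lim show ?case by simp
  qed
  show "integrable (Q \<Otimes>\<^sub>M gauss) (\<lambda>p. (S N p)\<^sup>2)" for N
  proof (rule Bochner_Integration.integrable_bound[OF w_int])
    show "AE p in Q \<Otimes>\<^sub>M gauss. norm ((S N p)\<^sup>2) \<le> norm (w p)"
      using good by eventually_elim (auto simp: w_nonneg)
  qed measurable
  show "integrable (Q \<Otimes>\<^sub>M gauss) (\<lambda>p. (\<psi> p)\<^sup>2)"
  proof (rule Bochner_Integration.integrable_bound[OF w_int])
    show "AE p in Q \<Otimes>\<^sub>M gauss. norm ((\<psi> p)\<^sup>2) \<le> norm (w p)"
      using good by eventually_elim (auto simp: w_nonneg)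
  qed measurable
  have "(\<lambda>N. \<integral>p. (S N p - \<psi> p)\<^sup>2 \<partial>(Q \<Otimes>\<^sub>M gauss)) \<longlonglongrightarrow> (\<integral>p. 0 \<partial>(Q \<Otimes>\<^sub>M gauss))"
  proof (rule integral_dominated_convergence[where w = "\<lambda>p. 4 * w p"])
    show "AE p in Q \<Otimes>\<^sub>M gauss. (\<lambda>N. (S N p - \<psi> p)\<^sup>2) \<longlonglongrightarrow> 0"
      using good
    proof eventually_elim
      case (elim p)
      then have "(\<lambda>N. (S N p - \<psi> p)\<^sup>2) \<longlonglongrightarrow> (\<psi> p - \<psi> p)\<^sup>2" by (intro tendsto_intros) auto
      then show ?case by simp
    qed
    show "AE p in Q \<Otimes>\<^sub>M gauss. norm ((S N p - \<psi> p)\<^sup>2) \<le> 4 * w p" for N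
      using good
    proof eventually_elim
      case (elim p)
      have "(S N p - \<psi> p)\<^sup>2 \<le> 2 * (S N p)\<^sup>2 + 2 * (\<psi> p)\<^sup>2"
        using zero_le_power2[of "S N p + \<psi> p"] by (simp add: power2_eq_square algebra_simps)
      moreover have "(S N p)\<^sup>2 \<le> w p" "(\<psi> p)\<^sup>2 \<le> w p" using elim by auto
      ultimately show ?case by simp
    qed
  qed (use w_int in auto)
  then show "(\<lambda>N. \<integral>p. (S N p - \<psi> p)\<^sup>2 \<partial>(Q \<Otimes>\<^sub>M gauss)) \<longlonglongrightarrow> 0" by simp
qed

section \<open>Independence of future increments\<close>

locale brownian = prob_space P for P :: "'a measure" +
  fixes W :: "real \<Rightarrow> 'a \<Rightarrow> real"
  assumes bm: "brownian_motion P W"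
begin

lemma W_measurable [measurable]: "0 \<le> t \<Longrightarrow> W t \<in> borel_measurable P"
  and W_0: "AE \<omega> in P. W 0 \<omega> = 0"
  and W_continuous: "AE \<omega> in P. continuous_on {0..} (\<lambda>t. W t \<omega>)"
  using bm by (auto simp: brownian_motion_def)

lemma indep_increments:
  "0 \<le> t 0 \<Longrightarrow> strict_mono_on {..n} t \<Longrightarrow>
    indep_vars (\<lambda>_. borel) (\<lambda>i \<omega>. W (t (Suc i)) \<omega> - W (t i) \<omega>) {..<n}"
  using bm by (simp add: brownian_motion_def)

lemma increment_distributed:
  "0 \<le> s \<Longrightarrow> s < t \<Longrightarrow> distributed P lborel (\<lambda>\<omega>. W t \<omega> - W s \<omega>) (normal_density 0 (sqrt (t - s)))"
  using bm by (simp add: brownian_motion_def)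

lemma null_completed_sets_subset: "null_completed_sets P W u \<subseteq> sets P"
  unfolding null_completed_sets_def
  by (rule sets.sigma_sets_subset) (auto intro!: measurable_sets[OF W_measurable])

lemma space_augmented [simp]: "space (augmented P W t) = space P"
  by (simp add: augmented_def space_measure_of_conv)

lemma null_completed_sets_sigma: "sigma_sets (space P) (null_completed_sets P W u) = null_completed_sets P W u"
  unfolding null_completed_sets_def
proof (rule sigma_sets_sigma_sets_eq, rule Un_least)
  show "null_sets P \<subseteq> Pow (space P)" using sets.sets_into_space[of _ P] by blast
qed blast

lemma sets_augmented: "sets (augmented P W t) = (\<Inter>u\<in>{t<..}. null_completed_sets P W u)"
proof -
  have "(\<Inter>u\<in>{t<..}. null_completed_sets P W u) \<subseteq> Pow (space P)"
    using INT_lower[of "t + 1" "{t<..}" "null_completed_sets P W"] null_completed_sets_subset[of "t + 1"]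
      sets.space_closed[of P] by (meson greaterThan_iff less_add_one order_trans)
  then have "sets (augmented P W t) = sigma_sets (space P) (\<Inter>u\<in>{t<..}. null_completed_sets P W u)"
    unfolding augmented_def by (rule sets_measure_of)
  moreover have "sigma_sets (space P) (\<Inter>u\<in>{t<..}. null_completed_sets P W u) \<subseteq> null_completed_sets P W u" if "u > t" for u
    using sigma_sets_mono'[OF INT_lower[of u "{t<..}" "null_completed_sets P W"], of "space P"] that
    unfolding null_completed_sets_sigma by simp
  ultimately show ?thesis by (auto intro: sigma_sets.Basic)
qed

lemma subalgebra_augmented: "subalgebra P (augmented P W t)"
  unfolding subalgebra_def sets_augmented
  using null_completed_sets_subset[of "t + 1"] by auto

lemma W_measurable_augmented:
  assumes "0 \<le> r" "r \<le> t"
  shows "W r \<in> borel_measurable (augmented P W t)"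
proof (rule measurableI)
  fix B :: "real set" assume B: "B \<in> sets borel"
  have "W r -` B \<inter> space P \<in> null_completed_sets P W u" if "t < u" for u
  proof -
    have "r \<le> u" using that assms by simp
    then show ?thesis
      unfolding null_completed_sets_def using B assms(1) by (intro sigma_sets.Basic UnI1) blast
  qed
  then show "W r -` B \<inter> space (augmented P W t) \<in> sets (augmented P W t)"
    by (simp add: sets_augmented)
qed simp

text \<open>The events that agree up to a null set with an event depending on \<open>W\<close> at finitely many times up to
  \<open>u\<close> are stable under intersection, contain the null sets and generate the completed past of \<open>u\<close>. For
  such an event, list its times, together with \<open>0\<close> and \<open>u\<close>, in increasing order and append the future
  times \<open>s\<close>: along this grid the increments are independent, the event depends on those before \<open>u\<close> (as
  \<open>W 0 = 0\<close>), and \<open>Y\<close> on those after \<open>u\<close>.\<close>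

lemma null_completed_indep_future:
  assumes u: "0 \<le> u" and s: "s a = u" "strict_mono_on {a..b} s" "a \<le> b"
    and A: "A \<in> null_completed_sets P W u"
    and B: "B \<in> sets (PiM {a..<b} (\<lambda>_. borel))"
  defines "Y \<equiv> \<lambda>\<omega>. \<lambda>j\<in>{a..<b}. W (s (Suc j)) \<omega> - W (s j) \<omega>"
  shows "prob (A \<inter> (Y -` B \<inter> space P)) = prob A * prob (Y -` B \<inter> space P)"
proof -
  define \<C> where "\<C> = {A \<in> sets P. \<exists>J C. finite J \<and> J \<subseteq> {0..u} \<and> C \<in> sets (PiM J (\<lambda>_. borel)) \<and>
      (AE \<omega> in P. \<omega> \<in> A \<longleftrightarrow> (\<lambda>r\<in>J. W r \<omega>) \<in> C)}"
  define \<D> where "\<D> = {Y -` B \<inter> space P | B. B \<in> sets (PiM {a..<b} (\<lambda>_. borel :: real measure))}"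
  have s_ge: "s j \<ge> u" if "j \<in> {a..b}" for j
    using that s strict_mono_onD[OF s(2), of a j] by (cases "j = a") auto
  have Y_meas [measurable]: "Y \<in> measurable P (PiM {a..<b} (\<lambda>_. borel))"
    unfolding Y_def using s_ge u by (intro measurable_restrict borel_measurable_diff W_measurable) (force intro: order_trans)+
  have C_indep: "prob (A \<inter> D) = prob A * prob D" if "A \<in> \<C>" "D \<in> \<D>" for A D
  proof -
    from that(1) obtain J C where J: "finite J" "J \<subseteq> {0..u}" and C: "C \<in> sets (PiM J (\<lambda>_. borel))"
      and AE_A: "AE \<omega> in P. \<omega> \<in> A \<longleftrightarrow> (\<lambda>r\<in>J. W r \<omega>) \<in> C" and A: "A \<in> sets P"
      by (auto simp: \<C>_def)
    from that(2) obtain B where B: "B \<in> sets (PiM {a..<b} (\<lambda>_. borel))" "D = Y -` B \<inter> space P"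
      by (auto simp: \<D>_def)
    define K where "K = J \<union> {0, u}"
    have fin: "finite K" using J by (simp add: K_def)
    define xs where "xs = sorted_list_of_set K"
    define p where "p = length xs - 1"
    have "set xs = K" using fin by (simp add: xs_def)
    then have set_xs: "set xs = J \<union> {0, u}" by (simp only: K_def)
    have xs: "sorted xs" "distinct xs" "length xs = Suc p"
      using fin by (simp_all add: xs_def p_def) (auto simp: K_def card_gt_0_iff)
    have nth_less: "xs ! i < xs ! j" if "i < j" "j \<le> p" for i j
      using that xs strict_sorted_iff[of xs] by (auto simp: sorted_wrt_iff_nth_less)
    have in_nth: "\<exists>i\<le>p. xs ! i = r" if "r \<in> J \<union> {0, u}" for r
      using that xs(3) unfolding set_xs[symmetric] in_set_conv_nth by (auto simp: less_Suc_eq_le)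
    have nth_in: "xs ! i \<in> {0..u}" if "i \<le> p" for i
      using that xs(3) set_xs J u nth_mem[of i xs] by auto
    have nth_0: "xs ! 0 = 0" and nth_p: "xs ! p = u"
    proof -
      obtain i where "i \<le> p" "xs ! i = 0" using in_nth[of 0] by auto
      then show "xs ! 0 = 0" using nth_less[of 0 i] nth_in[of 0] by (cases "i = 0") auto
      obtain i where "i \<le> p" "xs ! i = u" using in_nth[of u] by auto
      then show "xs ! p = u" using nth_less[of i p] nth_in[of p] by (cases "i = p") auto
    qed
    \<comment> \<open>the past times, of which \<open>u\<close> is the last, followed by the future times\<close>
    define t where "t i = (if i \<le> p then xs ! i else s (a + i - p))" for i
    define X where "X = (\<lambda>i \<omega>. W (t (Suc i)) \<omega> - W (t i) \<omega>)"
    have t_mono: "strict_mono_on {..p + (b - a)} t"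
    proof (rule strict_mono_onI)
      fix i j assume ij: "i \<in> {..p + (b - a)}" "j \<in> {..p + (b - a)}" "i < j"
      consider "j \<le> p" | "i \<le> p" "j > p" | "i > p" by linarith
      then show "t i < t j"
      proof cases
        case 1
        then show ?thesis using ij nth_less by (simp add: t_def)
      next
        case 2
        have "s a < s (a + j - p)" using 2 ij s(3) by (intro strict_mono_onD[OF s(2)]) auto
        then show ?thesis using 2 nth_in[of i] by (simp add: t_def s(1))
      next
        case 3
        then show ?thesis using ij s(3) by (auto simp: t_def intro!: strict_mono_onD[OF s(2)])
      qed
    qed
    have t_p: "t (j - a + p) = s j" if "j \<in> {a..b}" for j
      using that nth_p s(1) by (cases "j = a") (auto simp: t_def)
    have "indep_vars (\<lambda>_. borel) X {..<p + (b - a)}"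
      unfolding X_def by (rule indep_increments[OF _ t_mono]) (simp add: t_def nth_0)
    then have ind: "indep_var (PiM {..<p} (\<lambda>_. borel)) (\<lambda>\<omega>. restrict (\<lambda>i. X i \<omega>) {..<p})
        (PiM {p..<p + (b - a)} (\<lambda>_. borel)) (\<lambda>\<omega>. restrict (\<lambda>i. X i \<omega>) {p..<p + (b - a)})"
      by (rule indep_var_restrict) auto
    from in_nth obtain idx where idx: "\<And>r. r \<in> J \<Longrightarrow> idx r \<le> p \<and> xs ! idx r = r"
      by (metis UnI1)
    \<comment> \<open>recovers \<open>W\<close> at the times in \<open>J\<close> from the increments before
      \<open>u\<close>\<close>
    define \<Psi> where "\<Psi> x = (\<lambda>r\<in>J. \<Sum>i<idx r. x i)" for x :: "nat \<Rightarrow> real"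
    define \<Phi> where "\<Phi> x = (\<lambda>j\<in>{a..<b}. x (j - a + p))" for x :: "nat \<Rightarrow> real"
    have \<Psi> [measurable]: "\<Psi> \<in> measurable (PiM {..<p} (\<lambda>_. borel)) (PiM J (\<lambda>_. borel))"
      unfolding \<Psi>_def
      by (intro measurable_restrict borel_measurable_sum measurable_component_singleton) (use idx in force)
    have \<Phi> [measurable]: "\<Phi> \<in> measurable (PiM {p..<p + (b - a)} (\<lambda>_. borel)) (PiM {a..<b} (\<lambda>_. borel))"
      unfolding \<Phi>_def by (intro measurable_restrict measurable_component_singleton) auto
    define U where "U \<omega> = \<Psi> (restrict (\<lambda>i. X i \<omega>) {..<p})" for \<omega>
    have rvs [measurable]: "(\<lambda>\<omega>. restrict (\<lambda>i. X i \<omega>) {..<p}) \<in> measurable P (PiM {..<p} (\<lambda>_. borel))"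
      "(\<lambda>\<omega>. restrict (\<lambda>i. X i \<omega>) {p..<p + (b - a)}) \<in> measurable P (PiM {p..<p + (b - a)} (\<lambda>_. borel))"
      using indep_var_rv1[OF ind] indep_var_rv2[OF ind] by auto
    have Y_eq: "Y \<omega> = \<Phi> (restrict (\<lambda>i. X i \<omega>) {p..<p + (b - a)})" for \<omega>
    proof -
      have "X (j - a + p) \<omega> = W (s (Suc j)) \<omega> - W (s j) \<omega>" if "j \<in> {a..<b}" for j
        using that t_p[of j] t_p[of "Suc j"] by (simp add: X_def Suc_diff_le)
      then show ?thesis
        by (auto simp: \<Phi>_def Y_def fun_eq_iff restrict_def)
    qed
    have [measurable]: "U \<in> measurable P (PiM J (\<lambda>_. borel))" unfolding U_def by measurable
    define C' where "C' = \<Psi> -` C \<inter> space (PiM {..<p} (\<lambda>_. borel :: real measure))"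
    define B' where "B' = \<Phi> -` B \<inter> space (PiM {p..<p + (b - a)} (\<lambda>_. borel :: real measure))"
    have C': "C' \<in> sets (PiM {..<p} (\<lambda>_. borel))" and B': "B' \<in> sets (PiM {p..<p + (b - a)} (\<lambda>_. borel))"
      unfolding C'_def B'_def using B(1) C by measurable
    have UY: "U -` C \<inter> space P = (\<lambda>\<omega>. restrict (\<lambda>i. X i \<omega>) {..<p}) -` C' \<inter> space P"
      "D = (\<lambda>\<omega>. restrict (\<lambda>i. X i \<omega>) {p..<p + (b - a)}) -` B' \<inter> space P"
      unfolding B(2) C'_def B'_def using measurable_space[OF rvs(1)] measurable_space[OF rvs(2)]
      by (auto simp: U_def Y_eq)
    have "AE \<omega> in P. \<omega> \<in> A \<longleftrightarrow> \<omega> \<in> U -` C \<inter> space P"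
      using AE_A W_0 AE_space
    proof eventually_elim
      case (elim \<omega>)
      have "(\<Sum>i<idx r. restrict (\<lambda>i. X i \<omega>) {..<p} i) = W r \<omega>" if r: "r \<in> J" for r
      proof -
        have "(\<Sum>i<idx r. restrict (\<lambda>i. X i \<omega>) {..<p} i) = (\<Sum>i<idx r. W (t (Suc i)) \<omega> - W (t i) \<omega>)"
          using idx[OF r] by (intro sum.cong) (auto simp: X_def)
        also have "\<dots> = W (t (idx r)) \<omega> - W (t 0) \<omega>"
          by (rule sum_lessThan_telescope)
        finally show ?thesis using idx[OF r] elim nth_0 by (simp add: t_def)
      qed
      then have "U \<omega> = (\<lambda>r\<in>J. W r \<omega>)" unfolding U_def \<Psi>_def by (intro restrict_ext) auto
      then show ?case using elim by simp
    qed
    then have "prob A = prob (U -` C \<inter> space P)"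
      "prob (A \<inter> D) = prob ((U -` C \<inter> space P) \<inter> D)"
      using A C B by (auto intro!: finite_measure_eq_AE)
    moreover have "prob ((U -` C \<inter> space P) \<inter> D) = prob (U -` C \<inter> space P) * prob D"
      unfolding UY indep_varD[OF ind C' B', symmetric] by (rule arg_cong[where f = prob]) auto
    ultimately show ?thesis by simp
  qed
  have C_stable: "Int_stable \<C>"
  proof (rule Int_stableI)
    fix A1 A2 assume "A1 \<in> \<C>" "A2 \<in> \<C>"
    then obtain J1 C1 J2 C2 where 1: "finite J1" "J1 \<subseteq> {0..u}" "C1 \<in> sets (PiM J1 (\<lambda>_. borel))"
        "AE \<omega> in P. \<omega> \<in> A1 \<longleftrightarrow> (\<lambda>r\<in>J1. W r \<omega>) \<in> C1" "A1 \<in> sets P"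
      and 2: "finite J2" "J2 \<subseteq> {0..u}" "C2 \<in> sets (PiM J2 (\<lambda>_. borel))"
        "AE \<omega> in P. \<omega> \<in> A2 \<longleftrightarrow> (\<lambda>r\<in>J2. W r \<omega>) \<in> C2" "A2 \<in> sets P"
      unfolding \<C>_def by blast
    define C where "C = {x \<in> space (PiM (J1 \<union> J2) (\<lambda>_. borel :: real measure)). restrict x J1 \<in> C1 \<and> restrict x J2 \<in> C2}"
    have "C \<in> sets (PiM (J1 \<union> J2) (\<lambda>_. borel))"
      unfolding C_def using 1(3) 2(3) measurable_restrict_subset[of J1 "J1 \<union> J2" "\<lambda>_. borel"]
        measurable_restrict_subset[of J2 "J1 \<union> J2" "\<lambda>_. borel"] by measurable
    moreover have "AE \<omega> in P. \<omega> \<in> A1 \<inter> A2 \<longleftrightarrow> (\<lambda>r\<in>J1 \<union> J2. W r \<omega>) \<in> C"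
    proof -
      have rs: "restrict (\<lambda>r\<in>J1 \<union> J2. W r \<omega>) J1 = (\<lambda>r\<in>J1. W r \<omega>)"
        "restrict (\<lambda>r\<in>J1 \<union> J2. W r \<omega>) J2 = (\<lambda>r\<in>J2. W r \<omega>)"
        "(\<lambda>r\<in>J1 \<union> J2. W r \<omega>) \<in> space (PiM (J1 \<union> J2) (\<lambda>_. borel))" for \<omega>
        by (simp_all only: restrict_restrict Un_Int_eq space_PiM) simp
      show ?thesis using 1(4) 2(4) by eventually_elim (simp only: C_def rs mem_Collect_eq Int_iff simp_thms)
    qed
    ultimately show "A1 \<inter> A2 \<in> \<C>"
      unfolding \<C>_def using 1 2 by (intro CollectI conjI exI[of _ "J1 \<union> J2"] exI[of _ C]) auto
  qed
  have D_stable: "Int_stable \<D>"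
  proof (rule Int_stableI)
    fix D1 D2 assume "D1 \<in> \<D>" "D2 \<in> \<D>"
    then obtain B1 B2 where "B1 \<in> sets (PiM {a..<b} (\<lambda>_. borel :: real measure))" "B2 \<in> sets (PiM {a..<b} (\<lambda>_. borel :: real measure))"
      "D1 = Y -` B1 \<inter> space P" "D2 = Y -` B2 \<inter> space P" by (auto simp: \<D>_def)
    then show "D1 \<inter> D2 \<in> \<D>" unfolding \<D>_def by (intro CollectI exI[of _ "B1 \<inter> B2"]) auto
  qed
  have "indep_set \<C> \<D>"
    using C_indep by (intro indep_setI) (auto simp: \<C>_def \<D>_def)
  then have ind: "indep_set (sigma_sets (space P) \<C>) (sigma_sets (space P) \<D>)"
    by (rule indep_set_sigma_sets) (fact C_stable D_stable)+
  have "{W r -` B \<inter> space P | r B. 0 \<le> r \<and> r \<le> u \<and> B \<in> sets borel} \<union> null_sets P \<subseteq> \<C>"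
  proof safe
    fix r and B :: "real set" assume r: "0 \<le> r" "r \<le> u" "B \<in> sets borel"
    have "(\<lambda>x. x r) -` B \<inter> space (PiM {r} (\<lambda>_. borel)) \<in> sets (PiM {r} (\<lambda>_. borel :: real measure))"
      using r(3) by measurable
    then show "W r -` B \<inter> space P \<in> \<C>"
      unfolding \<C>_def using r
      by (intro CollectI conjI exI[of _ "{r}"] exI[of _ "(\<lambda>x. x r) -` B \<inter> space (PiM {r} (\<lambda>_. borel))"])
         (auto simp: space_PiM intro!: AE_I2 measurable_sets[OF W_measurable])
  next
    fix N assume N: "N \<in> null_sets P"
    then show "N \<in> \<C>"
      unfolding \<C>_def using AE_not_in[OF N]
      by (intro CollectI conjI exI[of _ "{}"]) auto
  qed
  then have "null_completed_sets P W u \<subseteq> sigma_sets (space P) \<C>"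
    unfolding null_completed_sets_def by (rule sigma_sets_mono')
  then show ?thesis
    using A B by (intro indep_setD[OF ind]) (auto simp: \<D>_def)
qed

text \<open>Needed because the indicator of \<open>X \<le> c\<close> is a continuous function of \<open>X\<close> only away from
  \<open>c\<close>.\<close>

lemma increment_no_atom:
  assumes "0 \<le> r" "r < t"
  shows "AE \<omega> in P. W t \<omega> - W r \<omega> \<noteq> c"
proof -
  note d = increment_distributed[OF assms]
  have "AE x in lborel. x \<noteq> c" using AE_lborel_singleton[of c] by eventually_elim auto
  then have "AE x in density lborel (\<lambda>x. ennreal (normal_density 0 (sqrt (t - r)) x)). x \<noteq> c"
    by (subst AE_density) auto
  then have "AE x in distr P lborel (\<lambda>\<omega>. W t \<omega> - W r \<omega>). x \<noteq> c"
    unfolding distributed_distr_eq_density[OF d] .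
  then show ?thesis by (rule AE_distrD[OF distributed_measurable[OF d]])
qed

text \<open>An event of the right-continuous filtration at time \<open>t\<close> belongs to the completed past of every \<open>u >
  t\<close>. It is thus independent of the future increments if the first of them starts at \<open>u\<close> instead of
  \<open>t\<close>; now let \<open>u\<close> decrease to \<open>t\<close> and use the continuity of the paths.\<close>

lemma augmented_indep_box:
  fixes c :: "nat \<Rightarrow> real"
  assumes t: "0 \<le> t" and s: "s a = t" "strict_mono_on {a..b} s" "a \<le> b"
    and A: "A \<in> sets (augmented P W t)"
  defines "E \<equiv> {\<omega> \<in> space P. \<forall>j\<in>{a..<b}. W (s (Suc j)) \<omega> - W (s j) \<omega> \<le> c j}"
  shows "prob (A \<inter> E) = prob A * prob E"
proof (cases "a = b")
  case True
  then have "E = space P" by (auto simp: E_def)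
  moreover have "A \<subseteq> space P" using A sets.sets_into_space by fastforce
  ultimately show ?thesis by (simp add: Int_absorb2 prob_space)
next
  case False
  then have ab: "a < b" using s(3) by simp
  have s_ge: "s j \<ge> 0" if "j \<in> {a..b}" for j
    using that t s strict_mono_onD[OF s(2), of a j] by (cases "j = a") auto
  have s_Suc: "t < s (Suc a)" using ab s(1) by (intro strict_mono_onD[OF s(2), of a, unfolded s(1)]) auto
  have A_P: "A \<in> sets P" using A subalgebra_augmented[of t] by (auto simp: subalgebra_def)
  \<comment> \<open>times decreasing to \<open>t\<close>, below the end of the first increment\<close>
  define u where "u k = t + (s (Suc a) - t) / real (k + 2)" for k
  have u: "t < u k" "u k < s (Suc a)" for k
  proof -
    have "(s (Suc a) - t) / real (k + 2) < (s (Suc a) - t) / 1"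
      using s_Suc by (intro divide_strict_left_mono) auto
    then show "t < u k" "u k < s (Suc a)" using s_Suc by (auto simp: u_def)
  qed
  have u_lim: "u \<longlonglongrightarrow> t"
  proof -
    have "(\<lambda>k. (s (Suc a) - t) / real (k + 2)) \<longlonglongrightarrow> 0"
      by (rule LIMSEQ_ignore_initial_segment[OF lim_const_over_n])
    from tendsto_add[OF tendsto_const[of t] this] show ?thesis unfolding u_def by simp
  qed
  define v where "v k = s(a := u k)" for k
  have v_mono: "strict_mono_on {a..b} (v k)" for k
  proof (rule strict_mono_onI)
    fix i j assume ij: "i \<in> {a..b}" "j \<in> {a..b}" "i < j"
    show "v k i < v k j"
    proof (cases "i = a")
      case True
      have "s (Suc a) \<le> s j"
        using ij True strict_mono_onD[OF s(2), of "Suc a" j] by (cases "j = Suc a") auto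
      then show ?thesis using True ij u(2)[of k] by (simp add: v_def)
    next
      case False
      then show ?thesis using ij strict_mono_onD[OF s(2), of i j] by (auto simp: v_def)
    qed
  qed
  define F where "F k = {\<omega> \<in> space P. \<forall>j\<in>{a..<b}. W (v k (Suc j)) \<omega> - W (v k j) \<omega> \<le> c j}" for k
  have v_ge: "v k j \<ge> 0" if "j \<in> {a..b}" for k j
    using s_ge[OF that] u(1)[of k] t by (auto simp: v_def)
  have F_sets [measurable]: "F k \<in> sets P" for k
    unfolding F_def using v_ge by measurable
  have E_sets [measurable]: "E \<in> sets P"
    unfolding E_def using s_ge by measurable
  have indep: "prob (A \<inter> F k) = prob A * prob (F k)" for k
  proof -
    define B where "B = (\<Pi>\<^sub>E j\<in>{a..<b}. {..c j})"
    have B: "B \<in> sets (PiM {a..<b} (\<lambda>_. borel))" unfolding B_def by (intro sets_PiM_I_finite) auto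
    have "F k = (\<lambda>\<omega>. \<lambda>j\<in>{a..<b}. W (v k (Suc j)) \<omega> - W (v k j) \<omega>) -` B \<inter> space P"
      by (auto simp: F_def B_def Pi_iff)
    then show ?thesis
      using null_completed_indep_future[OF _ _ v_mono s(3) _ B, of "u k" k A] u[of k] t A
      by (simp add: v_def sets_augmented)
  qed
  have ind_lim: "AE \<omega> in P. (\<lambda>k. indicator (F k) \<omega> :: real) \<longlonglongrightarrow> indicator E \<omega>"
    using W_continuous increment_no_atom[OF t s_Suc, of "c a"] AE_space
  proof eventually_elim
    case (elim \<omega>)
    have "((\<lambda>r. W r \<omega>) \<longlongrightarrow> W t \<omega>) (at t within {0..})"
      using elim(1) t by (auto simp: continuous_on_def)
    then have "(\<lambda>k. W (u k) \<omega>) \<longlonglongrightarrow> W t \<omega>"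
    proof (rule filterlim_compose)
      have "u k \<in> {0..} \<and> u k \<noteq> t" for k using u(1)[of k] t by simp
      then show "filterlim u (at t within {0..}) sequentially" using u_lim by (auto simp: filterlim_at)
    qed
    then have lim: "(\<lambda>k. W (s (Suc a)) \<omega> - W (u k) \<omega>) \<longlonglongrightarrow> W (s (Suc a)) \<omega> - W t \<omega>"
      by (intro tendsto_intros)
    have "\<forall>\<^sub>F k in sequentially. (W (s (Suc a)) \<omega> - W (u k) \<omega> \<le> c a) = (W (s (Suc a)) \<omega> - W t \<omega> \<le> c a)"
    proof (cases "W (s (Suc a)) \<omega> - W t \<omega> < c a")
      case True
      show ?thesis using order_tendstoD(2)[OF lim True] by eventually_elim (use True in auto)
    next
      case False
      then have gt: "W (s (Suc a)) \<omega> - W t \<omega> > c a" using elim(2) by simp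
      show ?thesis using order_tendstoD(1)[OF lim gt] by eventually_elim (use gt in auto)
    qed
    then have "\<forall>\<^sub>F k in sequentially. indicator (F k) \<omega> = (indicator E \<omega> :: real)"
    proof eventually_elim
      case (elim k)
      have "(\<forall>j\<in>{a..<b}. W (v k (Suc j)) \<omega> - W (v k j) \<omega> \<le> c j) \<longleftrightarrow> (\<forall>j\<in>{a..<b}. W (s (Suc j)) \<omega> - W (s j) \<omega> \<le> c j)"
        using elim ab by (intro ball_cong refl) (auto simp: v_def s(1))
      then show ?case by (simp add: F_def E_def indicator_def)
    qed
    then show ?case by (rule tendsto_eventually)
  qed
  have lim1: "(\<lambda>k. prob (C \<inter> F k)) \<longlonglongrightarrow> prob (C \<inter> E)" if [measurable]: "C \<in> sets P" for C
  proof -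
    have "(\<lambda>k. \<integral>\<omega>. indicator C \<omega> * indicator (F k) \<omega> \<partial>P) \<longlonglongrightarrow> (\<integral>\<omega>. indicator C \<omega> * (indicator E \<omega> :: real) \<partial>P)"
    proof (rule integral_dominated_convergence[where w = "\<lambda>_. 1"])
      show "AE \<omega> in P. (\<lambda>k. indicator C \<omega> * indicator (F k) \<omega> :: real) \<longlonglongrightarrow> indicator C \<omega> * indicator E \<omega>"
        using ind_lim by eventually_elim (intro tendsto_intros)
    qed (auto simp: indicator_def)
    then show ?thesis by (simp flip: indicator_inter_arith)
  qed
  have "(\<lambda>k. prob A * prob (F k)) \<longlonglongrightarrow> prob (A \<inter> E)"
    using lim1[OF A_P] by (simp add: indep)
  moreover have "(\<lambda>k. prob A * prob (F k)) \<longlonglongrightarrow> prob A * prob E"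
    using lim1[of "space P"] F_sets E_sets sets.sets_into_space
    by (intro tendsto_intros) (simp add: Int_absorb1)
  ultimately show ?thesis by (rule LIMSEQ_unique)
qed

text \<open>The boxes of the preceding lemma form a generator that is stable under intersection.\<close>

lemma augmented_indep_future:
  assumes t: "0 \<le> t" and s: "s a = t" "strict_mono_on {a..b} s" "a \<le> b"
    and A: "A \<in> sets (augmented P W t)"
    and B: "B \<in> sets (PiM {a..<b} (\<lambda>_. borel))"
  defines "Y \<equiv> \<lambda>\<omega>. \<lambda>j\<in>{a..<b}. W (s (Suc j)) \<omega> - W (s j) \<omega>"
  shows "prob (A \<inter> (Y -` B \<inter> space P)) = prob A * prob (Y -` B \<inter> space P)"
proof -
  define \<B> where "\<B> = {{f \<in> {a..<b} \<rightarrow>\<^sub>E UNIV. \<forall>j\<in>{a..<b}. f j \<in> C j} | C. C \<in> {a..<b} \<rightarrow> range (\<lambda>x::real. {..x})}"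
  define \<D> where "\<D> = {Y -` B \<inter> space P | B. B \<in> \<B>}"
  have s_ge: "s j \<ge> 0" if "j \<in> {a..b}" for j
    using that t s strict_mono_onD[OF s(2), of a j] by (cases "j = a") auto
  have Y_meas [measurable]: "Y \<in> measurable P (PiM {a..<b} (\<lambda>_. borel))"
    unfolding Y_def using s_ge by (intro measurable_restrict borel_measurable_diff W_measurable) auto
  have "sets (PiM {a..<b} (\<lambda>_. borel :: real measure)) = sets (PiM {a..<b} (\<lambda>_. sigma UNIV (range (\<lambda>x::real. {..x}))))"
    by (simp add: borel_eq_atMost)
  also have "\<dots> = sets (sigma ({a..<b} \<rightarrow>\<^sub>E UNIV) {{f \<in> {a..<b} \<rightarrow>\<^sub>E UNIV. \<forall>i\<in>j. f i \<in> C i} | C j. j \<in> {{a..<b}} \<and> C \<in> j \<rightarrow> range (\<lambda>x::real. {..x})})"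
  proof (rule sets_PiM_sigma)
    show "\<exists>S\<subseteq>range (\<lambda>x::real. {..x}). countable S \<and> UNIV = \<Union> S" for i :: nat
    proof (intro exI conjI)
      show "(UNIV::real set) = \<Union> (range (\<lambda>n::nat. {..real n}))"
        by (auto simp: real_arch_simple)
    qed auto
  qed auto
  also have "\<dots> = sigma_sets ({a..<b} \<rightarrow>\<^sub>E UNIV) \<B>"
    unfolding \<B>_def by (subst sets_measure_of) auto
  finally have gen: "sets (PiM {a..<b} (\<lambda>_. borel :: real measure)) = sigma_sets ({a..<b} \<rightarrow>\<^sub>E UNIV) \<B>" .
  have "indep_set (sets (augmented P W t)) \<D>"
  proof (rule indep_setI)
    show "sets (augmented P W t) \<subseteq> sets P" using subalgebra_augmented[of t] by (simp add: subalgebra_def)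
    have "\<B> \<subseteq> sets (PiM {a..<b} (\<lambda>_. borel :: real measure))" unfolding gen by auto
    then show "\<D> \<subseteq> sets P" unfolding \<D>_def using measurable_sets[OF Y_meas] by blast
    fix A D assume AD: "A \<in> sets (augmented P W t)" "D \<in> \<D>"
    then obtain C where C: "C \<in> {a..<b} \<rightarrow> range (\<lambda>x::real. {..x})"
      and D: "D = Y -` {f \<in> {a..<b} \<rightarrow>\<^sub>E UNIV. \<forall>j\<in>{a..<b}. f j \<in> C j} \<inter> space P"
      unfolding \<D>_def \<B>_def by blast
    from C have "\<forall>j\<in>{a..<b}. \<exists>x. C j = {..x}" by blast
    then obtain c where c: "\<And>j. j \<in> {a..<b} \<Longrightarrow> C j = {..c j}" by metis
    have "D = {\<omega> \<in> space P. \<forall>j\<in>{a..<b}. W (s (Suc j)) \<omega> - W (s j) \<omega> \<le> c j}"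
      unfolding D using c by (auto simp: Y_def)
    then show "prob (A \<inter> D) = prob A * prob D"
      using augmented_indep_box[OF t s AD(1), of c] by simp
  qed
  then have "indep_set (sigma_sets (space P) (sets (augmented P W t))) (sigma_sets (space P) \<D>)"
  proof (rule indep_set_sigma_sets)
    show "Int_stable (sets (augmented P W t))" by (auto simp: Int_stable_def)
    show "Int_stable \<D>"
    proof (rule Int_stableI)
      fix D1 D2 assume "D1 \<in> \<D>" "D2 \<in> \<D>"
      then obtain C1 C2 where C: "C1 \<in> {a..<b} \<rightarrow> range (\<lambda>x::real. {..x})" "C2 \<in> {a..<b} \<rightarrow> range (\<lambda>x::real. {..x})"
        and D: "D1 = Y -` {f \<in> {a..<b} \<rightarrow>\<^sub>E UNIV. \<forall>j\<in>{a..<b}. f j \<in> C1 j} \<inter> space P"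
          "D2 = Y -` {f \<in> {a..<b} \<rightarrow>\<^sub>E UNIV. \<forall>j\<in>{a..<b}. f j \<in> C2 j} \<inter> space P"
        unfolding \<D>_def \<B>_def by blast
      have "(\<lambda>j. C1 j \<inter> C2 j) \<in> {a..<b} \<rightarrow> range (\<lambda>x::real. {..x})"
      proof (rule Pi_I)
        fix j assume "j \<in> {a..<b}"
        then obtain x y where "C1 j = {..x}" "C2 j = {..y}" using C by blast
        then have "C1 j \<inter> C2 j = {..min x y}" by auto
        then show "C1 j \<inter> C2 j \<in> range (\<lambda>x::real. {..x})" by blast
      qed
      moreover have "D1 \<inter> D2 = Y -` {f \<in> {a..<b} \<rightarrow>\<^sub>E UNIV. \<forall>j\<in>{a..<b}. f j \<in> C1 j \<inter> C2 j} \<inter> space P"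
        unfolding D by auto
      ultimately show "D1 \<inter> D2 \<in> \<D>"
        unfolding \<D>_def \<B>_def mem_Collect_eq
        by (intro exI[of _ "{f \<in> {a..<b} \<rightarrow>\<^sub>E UNIV. \<forall>j\<in>{a..<b}. f j \<in> C1 j \<inter> C2 j}"] conjI
          exI[of _ "\<lambda>j. C1 j \<inter> C2 j"] refl)
    qed
  qed
  moreover have "Y -` B \<inter> space P \<in> sigma_sets (space P) \<D>"
  proof -
    have "Y \<in> space P \<rightarrow> ({a..<b} \<rightarrow>\<^sub>E UNIV)" by (auto simp: Y_def)
    from sigma_sets_vimage_commute[OF this, of \<B>] B show ?thesis
      unfolding \<D>_def gen by blast
  qed
  ultimately show ?thesis using sigma_sets.Basic[OF A] by (blast intro: indep_setD)
qed

end

section \<open>Freezing and normalised increments\<close>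

text \<open>If \<open>V\<close> is independent of \<open>N\<close>, then the pair of the identity, as a map into \<open>N\<close>,
  and \<open>V\<close> is distributed as a product measure, and Fubini's theorem computes the integral of \<open>h (\<omega>, V
  \<omega>)\<close> over an event of \<open>N\<close> by integrating over the second argument first.\<close>

lemma (in prob_space) real_cond_exp_freeze:
  fixes h :: "'a \<times> 'b \<Rightarrow> real"
  assumes sub: "subalgebra M N" and V [measurable]: "V \<in> measurable M T"
    and indep: "\<And>A B. A \<in> sets N \<Longrightarrow> B \<in> sets T \<Longrightarrow>
      prob (A \<inter> (V -` B \<inter> space M)) = prob A * prob (V -` B \<inter> space M)"
    and h [measurable]: "h \<in> borel_measurable (N \<Otimes>\<^sub>M T)"
    and int: "integrable M (\<lambda>\<omega>. h (\<omega>, V \<omega>))"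
  shows "AE \<omega> in M. real_cond_exp M N (\<lambda>\<omega>. h (\<omega>, V \<omega>)) \<omega> = (\<integral>v. h (\<omega>, v) \<partial>distr M T V)"
    and "AE \<omega> in M. integrable (distr M T V) (\<lambda>v. h (\<omega>, v))"
proof -
  interpret N: finite_measure_subalgebra M N by unfold_locales (rule sub)
  have id [measurable]: "(\<lambda>\<omega>. \<omega>) \<in> measurable M N"
    by (rule measurable_from_subalg[OF sub]) simp
  have space_N: "space N = space M" and sets_N: "sets N \<subseteq> sets M"
    using sub by (auto simp: subalgebra_def)
  define N' where "N' = distr M N (\<lambda>\<omega>. \<omega>)"
  define T' where "T' = distr M T V"
  have [measurable_cong]: "sets N' = sets N" "sets T' = sets T" by (simp_all add: N'_def T'_def)
  have sets_NT: "sets (N' \<Otimes>\<^sub>M T') = sets (N \<Otimes>\<^sub>M T)"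
    by (rule sets_pair_measure_cong) (simp_all add: N'_def T'_def)
  interpret N': prob_space N' unfolding N'_def by (rule prob_space_distr) measurable
  interpret T': prob_space T' unfolding T'_def by (rule prob_space_distr) measurable
  interpret NT: pair_sigma_finite N' T' ..
  have law: "N' \<Otimes>\<^sub>M T' = distr M (N \<Otimes>\<^sub>M T) (\<lambda>\<omega>. (\<omega>, V \<omega>))"
  proof (rule pair_measure_eqI)
    fix A B assume "A \<in> sets N'" "B \<in> sets T'"
    then have AB: "A \<in> sets N" "B \<in> sets T" by (auto simp: N'_def T'_def)
    then have A: "A \<in> sets M" "A \<subseteq> space M" using sets_N sets.sets_into_space by auto
    have "emeasure N' A * emeasure T' B = ennreal (prob A * prob (V -` B \<inter> space M))"
      using AB A by (simp add: N'_def T'_def emeasure_distr emeasure_eq_measure ennreal_mult Int_absorb2)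
    also have "\<dots> = emeasure M (A \<inter> (V -` B \<inter> space M))"
      using indep[OF AB] by (simp add: emeasure_eq_measure)
    also have "A \<inter> (V -` B \<inter> space M) = (\<lambda>\<omega>. (\<omega>, V \<omega>)) -` (A \<times> B) \<inter> space M"
      by auto
    also have "emeasure M \<dots> = emeasure (distr M (N \<Otimes>\<^sub>M T) (\<lambda>\<omega>. (\<omega>, V \<omega>))) (A \<times> B)"
      using AB by (subst emeasure_distr) auto
    finally show "emeasure N' A * emeasure T' B = emeasure (distr M (N \<Otimes>\<^sub>M T) (\<lambda>\<omega>. (\<omega>, V \<omega>))) (A \<times> B)" .
  qed (simp_all add: sets_NT N'.sigma_finite_measure_axioms T'.sigma_finite_measure_axioms)
  have int': "integrable (N' \<Otimes>\<^sub>M T') h"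
    unfolding law using int by (subst integrable_distr_eq) auto
  define g where "g \<omega> = (\<integral>v. h (\<omega>, v) \<partial>T')" for \<omega>
  have g_meas [measurable]: "g \<in> borel_measurable N"
    unfolding g_def by measurable
  have "integrable N' g" unfolding g_def using NT.integrable_fst[of "\<lambda>\<omega> v. h (\<omega>, v)"] int' by simp
  then have g_int: "integrable M g" unfolding N'_def by (subst (asm) integrable_distr_eq) auto
  have "AE \<omega> in M. real_cond_exp M N (\<lambda>\<omega>. h (\<omega>, V \<omega>)) \<omega> = g \<omega>"
  proof (rule N.real_cond_exp_charact)
    fix A assume A [measurable]: "A \<in> sets N"
    define hA where "hA p = indicator A (fst p) * h p" for p :: "'a \<times> 'b"
    have [measurable]: "hA \<in> borel_measurable (N \<Otimes>\<^sub>M T)" unfolding hA_def by measurable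
    have hA_int: "integrable (N' \<Otimes>\<^sub>M T') hA"
      unfolding hA_def by (rule Bochner_Integration.integrable_bound[OF int']) (auto simp: indicator_def)
    have "(\<integral>\<omega>\<in>A. h (\<omega>, V \<omega>) \<partial>M) = (\<integral>\<omega>. hA (\<omega>, V \<omega>) \<partial>M)"
      by (simp add: set_lebesgue_integral_def hA_def)
    also have "\<dots> = (\<integral>p. hA p \<partial>(N' \<Otimes>\<^sub>M T'))"
      unfolding law by (subst integral_distr) (auto simp: hA_def)
    also have "\<dots> = (\<integral>\<omega>. (\<integral>v. hA (\<omega>, v) \<partial>T') \<partial>N')"
      using NT.integral_fst[of "\<lambda>\<omega> v. hA (\<omega>, v)"] hA_int by simp
    also have "\<dots> = (\<integral>\<omega>. indicator A \<omega> * g \<omega> \<partial>N')"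
      by (simp add: hA_def g_def)
    also have "\<dots> = (\<integral>\<omega>. indicator A \<omega> * g \<omega> \<partial>M)"
      unfolding N'_def by (subst integral_distr) auto
    also have "\<dots> = (\<integral>\<omega>\<in>A. g \<omega> \<partial>M)" by (simp add: set_lebesgue_integral_def)
    finally show "(\<integral>\<omega>\<in>A. h (\<omega>, V \<omega>) \<partial>M) = (\<integral>\<omega>\<in>A. g \<omega> \<partial>M)" .
  qed (use int g_int in auto)
  then show "AE \<omega> in M. real_cond_exp M N (\<lambda>\<omega>. h (\<omega>, V \<omega>)) \<omega> = (\<integral>v. h (\<omega>, v) \<partial>distr M T V)"
    unfolding g_def T'_def .
  have "AE \<omega> in N'. integrable T' (\<lambda>v. h (\<omega>, v))"
    using NT.AE_integrable_fst'[OF int'] .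
  then show "AE \<omega> in M. integrable (distr M T V) (\<lambda>v. h (\<omega>, v))"
    unfolding N'_def T'_def by (rule AE_distrD[OF id])
qed

locale brownian_grid = brownian +
  fixes \<Delta> :: real
  assumes Delta_pos: "\<Delta> > 0"
begin

definition std_increment :: "nat \<Rightarrow> 'a \<Rightarrow> real" where
  "std_increment j \<omega> = (W (real (j + 1) * \<Delta>) \<omega> - W (real j * \<Delta>) \<omega>) / sqrt \<Delta>"

lemma grid_nonneg [simp]: "0 \<le> real j * \<Delta>"
  using Delta_pos by simp

lemma std_increment_measurable [measurable]: "std_increment j \<in> borel_measurable P"
  unfolding std_increment_def by (intro borel_measurable_divide borel_measurable_diff W_measurable grid_nonneg) simp

lemma grid_strict_mono: "strict_mono_on S (\<lambda>j::nat. real j * \<Delta>)"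
  using Delta_pos by (intro strict_mono_onI) simp

lemma indep_vars_std_increment: "indep_vars (\<lambda>_. borel) std_increment {..<n}"
proof -
  have "indep_vars (\<lambda>_. borel) (\<lambda>i \<omega>. (W (real (Suc i) * \<Delta>) \<omega> - W (real i * \<Delta>) \<omega>) / sqrt \<Delta>) {..<n}"
    using indep_increments[of "\<lambda>j. real j * \<Delta>" n, OF _ grid_strict_mono]
    by (intro indep_vars_compose2[where Y = "\<lambda>_ x. x / sqrt \<Delta>"]) auto
  then show ?thesis by (simp add: std_increment_def[abs_def] add.commute)
qed

lemma distr_std_increment: "distr P borel (std_increment j) = gauss"
proof -
  have "distributed P lborel (\<lambda>\<omega>. W (real (j + 1) * \<Delta>) \<omega> - W (real j * \<Delta>) \<omega>)
      (normal_density 0 (sqrt (real (j + 1) * \<Delta> - real j * \<Delta>)))"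
    using Delta_pos by (intro increment_distributed) auto
  also have "real (j + 1) * \<Delta> - real j * \<Delta> = \<Delta>" by (simp add: algebra_simps)
  finally have "distributed P lborel (\<lambda>\<omega>. 0 + 1 / sqrt \<Delta> * (W (real (j + 1) * \<Delta>) \<omega> - W (real j * \<Delta>) \<omega>))
      (normal_density (0 + 1 / sqrt \<Delta> * 0) (\<bar>1 / sqrt \<Delta>\<bar> * sqrt \<Delta>))"
    using Delta_pos by (intro normal_density_affine) auto
  then have "distributed P lborel (std_increment j) std_normal_density"
    using Delta_pos by (simp add: std_increment_def[abs_def])
  from distributed_distr_eq_density[OF this] show ?thesis
    unfolding gauss_def by (subst distr_cong[OF refl sets_lborel[symmetric]]) auto
qed

text \<open>The law of independent variables is a product measure for a nonempty index set; restriction from a larger index set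
  covers the case \<open>J = {}\<close>, which occurs for the last grid interval.\<close>

lemma distr_std_increment_PiM:
  assumes "J \<subseteq> {..<n}"
  shows "distr P (PiM J (\<lambda>_. borel)) (\<lambda>\<omega>. \<lambda>j\<in>J. std_increment j \<omega>) = PiM J (\<lambda>_. gauss)"
proof -
  have "distr P (PiM {..<Suc n} (\<lambda>_. borel)) (\<lambda>\<omega>. \<lambda>j\<in>{..<Suc n}. std_increment j \<omega>) = PiM {..<Suc n} (\<lambda>j. distr P borel (std_increment j))"
    using indep_vars_std_increment[of "Suc n"] by (subst (asm) indep_vars_iff_distr_eq_PiM') (auto simp: lessThan_empty_iff)
  then have law: "distr P (PiM {..<Suc n} (\<lambda>_. borel)) (\<lambda>\<omega>. \<lambda>j\<in>{..<Suc n}. std_increment j \<omega>) = PiM {..<Suc n} (\<lambda>_. gauss)"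
    by (simp add: distr_std_increment)
  interpret G: product_prob_space "\<lambda>_::nat. gauss" "{..<Suc n}" ..
  have J: "J \<subseteq> {..<Suc n}" "finite J" using assms finite_subset by auto
  have "PiM J (\<lambda>_. gauss) = distr (PiM {..<Suc n} (\<lambda>_. gauss)) (PiM J (\<lambda>_. gauss)) (\<lambda>x. restrict x J)"
    using J by (intro G.distr_restrict) auto
  also have "\<dots> = distr (PiM {..<Suc n} (\<lambda>_. gauss)) (PiM J (\<lambda>_. borel)) (\<lambda>x. restrict x J)"
    by (intro distr_cong sets_PiM_cong) auto
  also have "\<dots> = distr P (PiM J (\<lambda>_. borel)) ((\<lambda>x. restrict x J) \<circ> (\<lambda>\<omega>. \<lambda>j\<in>{..<Suc n}. std_increment j \<omega>))"
    unfolding law[symmetric] using J(1) by (intro distr_distr measurable_restrict_subset measurable_restrict) auto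
  also have "(\<lambda>x. restrict x J) \<circ> (\<lambda>\<omega>. \<lambda>j\<in>{..<Suc n}. std_increment j \<omega>) = (\<lambda>\<omega>. \<lambda>j\<in>J. std_increment j \<omega>)"
    using J(1) by (auto simp: fun_eq_iff restrict_def)
  finally show ?thesis by (rule sym)
qed

lemma real_cond_exp_std_increment_freeze:
  assumes "k \<le> n"
    and h: "h \<in> borel_measurable (augmented P W (real k * \<Delta>) \<Otimes>\<^sub>M PiM {k..<n} (\<lambda>_. borel))"
    and int: "integrable P (\<lambda>\<omega>. h (\<omega>, \<lambda>j\<in>{k..<n}. std_increment j \<omega>))"
  shows "AE \<omega> in P. real_cond_exp P (augmented P W (real k * \<Delta>)) (\<lambda>\<omega>. h (\<omega>, \<lambda>j\<in>{k..<n}. std_increment j \<omega>)) \<omega>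
      = (\<integral>v. h (\<omega>, v) \<partial>PiM {k..<n} (\<lambda>_. gauss))"
    and "AE \<omega> in P. integrable (PiM {k..<n} (\<lambda>_. gauss)) (\<lambda>v. h (\<omega>, v))"
proof -
  define Y where "Y = (\<lambda>\<omega>. \<lambda>j\<in>{k..<n}. W (real (Suc j) * \<Delta>) \<omega> - W (real j * \<Delta>) \<omega>)"
  have indep: "prob (A \<inter> ((\<lambda>\<omega>. \<lambda>j\<in>{k..<n}. std_increment j \<omega>) -` B \<inter> space P))
      = prob A * prob ((\<lambda>\<omega>. \<lambda>j\<in>{k..<n}. std_increment j \<omega>) -` B \<inter> space P)"
    if A: "A \<in> sets (augmented P W (real k * \<Delta>))" and B: "B \<in> sets (PiM {k..<n} (\<lambda>_. borel :: real measure))" for A B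
  proof -
    define sc where "sc x = (\<lambda>j\<in>{k..<n}. x j / sqrt \<Delta>)" for x :: "nat \<Rightarrow> real"
    have sc: "sc \<in> measurable (PiM {k..<n} (\<lambda>_. borel)) (PiM {k..<n} (\<lambda>_. borel))"
      unfolding sc_def by (intro measurable_restrict borel_measurable_divide measurable_component_singleton) auto
    define B' where "B' = sc -` B \<inter> space (PiM {k..<n} (\<lambda>_. borel :: real measure))"
    have B': "B' \<in> sets (PiM {k..<n} (\<lambda>_. borel))" unfolding B'_def using measurable_sets[OF sc B] .
    have "(\<lambda>\<omega>. \<lambda>j\<in>{k..<n}. std_increment j \<omega>) -` B \<inter> space P = Y -` B' \<inter> space P"
    proof -
      have "(\<lambda>j\<in>{k..<n}. std_increment j \<omega>) = sc (Y \<omega>)" for \<omega>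
        by (auto simp: sc_def Y_def std_increment_def fun_eq_iff add.commute)
      moreover have "Y \<omega> \<in> space (PiM {k..<n} (\<lambda>_. borel))" for \<omega>
        by (simp add: Y_def space_PiM)
      ultimately show ?thesis by (auto simp: B'_def)
    qed
    moreover have "prob (A \<inter> (Y -` B' \<inter> space P)) = prob A * prob (Y -` B' \<inter> space P)"
      unfolding Y_def using assms(1) A B'
      by (intro augmented_indep_future[where s = "\<lambda>j. real j * \<Delta>" and t = "real k * \<Delta>"] grid_strict_mono) auto
    ultimately show "prob (A \<inter> ((\<lambda>\<omega>. \<lambda>j\<in>{k..<n}. std_increment j \<omega>) -` B \<inter> space P))
        = prob A * prob ((\<lambda>\<omega>. \<lambda>j\<in>{k..<n}. std_increment j \<omega>) -` B \<inter> space P)" by simp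
  qed
  have meas: "(\<lambda>\<omega>. \<lambda>j\<in>{k..<n}. std_increment j \<omega>) \<in> measurable P (PiM {k..<n} (\<lambda>_. borel))"
    by (intro measurable_restrict std_increment_measurable)
  have law: "distr P (PiM {k..<n} (\<lambda>_. borel)) (\<lambda>\<omega>. \<lambda>j\<in>{k..<n}. std_increment j \<omega>) = PiM {k..<n} (\<lambda>_. gauss)"
    by (rule distr_std_increment_PiM[of _ n]) auto
  note freeze = real_cond_exp_freeze[OF subalgebra_augmented meas indep h int]
  show "AE \<omega> in P. real_cond_exp P (augmented P W (real k * \<Delta>)) (\<lambda>\<omega>. h (\<omega>, \<lambda>j\<in>{k..<n}. std_increment j \<omega>)) \<omega>
      = (\<integral>v. h (\<omega>, v) \<partial>PiM {k..<n} (\<lambda>_. gauss))"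
    by (rule freeze(1)[unfolded law])
  show "AE \<omega> in P. integrable (PiM {k..<n} (\<lambda>_. gauss)) (\<lambda>v. h (\<omega>, v))"
    by (rule freeze(2)[unfolded law])
qed

lemma W_grid_eq_sum: "AE \<omega> in P. \<forall>i. W (real (i + 1) * \<Delta>) \<omega> = sqrt \<Delta> * (\<Sum>j\<le>i. std_increment j \<omega>)"
  using W_0
proof eventually_elim
  case (elim \<omega>)
  have "sqrt \<Delta> * (\<Sum>j\<le>i. std_increment j \<omega>) = W (real (i + 1) * \<Delta>) \<omega>" for i
  proof -
    have "sqrt \<Delta> * (\<Sum>j\<le>i. std_increment j \<omega>) = (\<Sum>j\<le>i. W (real (Suc j) * \<Delta>) \<omega> - W (real j * \<Delta>) \<omega>)"
      using Delta_pos by (simp add: sum_distrib_left std_increment_def add.commute)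
    also have "\<dots> = W (real (Suc i) * \<Delta>) \<omega> - W (real 0 * \<Delta>) \<omega>"
      using sum_lessThan_telescope[of "\<lambda>j. W (real j * \<Delta>) \<omega>" "Suc i"] by (simp only: lessThan_Suc_atMost)
    finally show ?thesis using elim by (simp add: add.commute)
  qed
  then show ?case by simp
qed

end

section \<open>Calculus of smooth functions of several variables\<close>

lemma tendsto_coordinatewise:
  fixes f :: "'b \<Rightarrow> 'i \<Rightarrow> 'c::topological_space"
  assumes "\<And>i. ((\<lambda>x. f x i) \<longlongrightarrow> l i) F"
  shows "(f \<longlongrightarrow> l) F"
proof -
  have "limitin (product_topology (\<lambda>_. euclidean) UNIV) f l F"
    using assms by (subst limitin_componentwise) auto
  then show ?thesis by (simp add: euclidean_product_topology)
qed

lemma fun_upd_in_Rn: "x \<in> Rn n \<Longrightarrow> i < n \<Longrightarrow> x(i := y) \<in> Rn n"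
  by (auto simp: Rn_def PiE_def extensional_def)

lemma smooth_fun_continuous: "smooth_fun n f \<Longrightarrow> continuous_on (Rn n) f"
  unfolding smooth_fun_def by (drule bspec[of _ _ "[]"]) auto

lemma smooth_fun_differentiable:
  "smooth_fun n f \<Longrightarrow> x \<in> Rn n \<Longrightarrow> i < n \<Longrightarrow> (\<lambda>y. f (x(i := y))) differentiable at (x i)"
  unfolding smooth_fun_def by (drule bspec[of _ _ "[]"]) auto

lemma smooth_fun_partial:
  assumes "smooth_fun n f" "i < n"
  shows "smooth_fun n (partial i f)"
  unfolding smooth_fun_def
proof
  fix js assume "js \<in> lists {..<n}"
  then have "js @ [i] \<in> lists {..<n}" using assms(2) by simp
  with assms(1) have "continuous_on (Rn n) (foldr partial (js @ [i]) f) \<and>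
      (\<forall>x\<in>Rn n. \<forall>k<n. (\<lambda>y. foldr partial (js @ [i]) f (x(k := y))) differentiable at (x k))"
    unfolding smooth_fun_def by blast
  then show "continuous_on (Rn n) (foldr partial js (partial i f)) \<and>
      (\<forall>x\<in>Rn n. \<forall>k<n. (\<lambda>y. foldr partial js (partial i f) (x(k := y))) differentiable at (x k))"
    by simp
qed

lemma smooth_fun_has_partial:
  assumes "smooth_fun n f" "x \<in> Rn n" "i < n"
  shows "((\<lambda>z. f (x(i := z))) has_real_derivative partial i f (x(i := y))) (at y)"
proof -
  have "(\<lambda>z. f ((x(i := y))(i := z))) differentiable at ((x(i := y)) i)"
    using smooth_fun_differentiable[OF assms(1) fun_upd_in_Rn[OF assms(2,3)] assms(3)] .
  then show ?thesis
    by (simp add: partial_def DERIV_deriv_iff_real_differentiable)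
qed

text \<open>The derivative in the direction \<open>c\<close>. Moving \<open>W\<close> on \<open>[(m + 1) \<Delta>,
  \<infinity>)\<close> by a constant moves exactly the arguments with index \<open>i \<ge> m\<close>, so the Malliavin derivative
  at time \<open>(m + 1) \<Delta>\<close> is the case \<open>c i = (if m \<le> i then 1 else 0)\<close>.\<close>

definition directional_derivative :: "nat \<Rightarrow> (nat \<Rightarrow> real) \<Rightarrow> ((nat \<Rightarrow> real) \<Rightarrow> real) \<Rightarrow> (nat \<Rightarrow> real) \<Rightarrow> real" where
  "directional_derivative n c f x = (\<Sum>i<n. c i * partial i f x)"

lemma foldr_partial_directional_derivative:
  assumes f: "smooth_fun n f" and js: "js \<in> lists {..<n}" and x: "x \<in> Rn n"
  shows "foldr partial js (directional_derivative n c f) x = (\<Sum>i<n. c i * foldr partial js (partial i f) x)"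
  using js x
proof (induction js arbitrary: x rule: list.induct)
  case Nil
  then show ?case by (simp add: directional_derivative_def)
next
  case (Cons j js)
  then have j: "j < n" "js \<in> lists {..<n}" by auto
  have D: "((\<lambda>y. foldr partial js (partial i f) (x(j := y))) has_real_derivative
      partial j (foldr partial js (partial i f)) x) (at (x j))" if "i < n" for i
  proof -
    have "(\<lambda>y. foldr partial js (partial i f) (x(j := y))) differentiable at (x j)"
      using smooth_fun_partial[OF f that] j Cons.prems(2) unfolding smooth_fun_def by blast
    then show ?thesis by (simp add: partial_def DERIV_deriv_iff_real_differentiable)
  qed
  have "partial j (foldr partial js (directional_derivative n c f)) x
      = deriv (\<lambda>y. \<Sum>i<n. c i * foldr partial js (partial i f) (x(j := y))) (x j)"
    unfolding partial_def[of j "foldr partial js (directional_derivative n c f)"]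
      Cons.IH[OF j(2) fun_upd_in_Rn[OF Cons.prems(2) j(1)]] ..
  also have "\<dots> = (\<Sum>i<n. c i * partial j (foldr partial js (partial i f)) x)"
    by (intro DERIV_imp_deriv DERIV_sum DERIV_cmult D) auto
  finally show ?case by simp
qed

lemma smooth_fun_directional_derivative:
  assumes f: "smooth_fun n f"
  shows "smooth_fun n (directional_derivative n c f)"
  unfolding smooth_fun_def
proof (intro ballI conjI allI impI)
  fix js assume js: "js \<in> lists {..<n}"
  have "continuous_on (Rn n) (\<lambda>x. \<Sum>i<n. c i * foldr partial js (partial i f) x)"
    using smooth_fun_partial[OF f] js unfolding smooth_fun_def
    by (intro continuous_on_sum continuous_on_mult_left) auto
  then show "continuous_on (Rn n) (foldr partial js (directional_derivative n c f))"
    by (rule continuous_on_eq) (simp add: foldr_partial_directional_derivative[OF f js])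
  fix x i assume x: "x \<in> Rn n" "i < n"
  have "(\<lambda>y. \<Sum>k<n. c k * foldr partial js (partial k f) (x(i := y))) differentiable at (x i)"
    using smooth_fun_partial[OF f] js x unfolding smooth_fun_def
    by (intro differentiable_sum differentiable_mult differentiable_const ballI) auto
  then show "(\<lambda>y. foldr partial js (directional_derivative n c f) (x(i := y))) differentiable at (x i)"
    using fun_upd_in_Rn[OF x] by (simp add: foldr_partial_directional_derivative[OF f js])
qed

lemma smooth_fun_iterate: "smooth_fun M g \<Longrightarrow> smooth_fun M ((directional_derivative M c ^^ l) g)"
  by (induction l) (auto intro: smooth_fun_directional_derivative)

lemma mean_value_unordered:
  fixes \<phi> \<phi>' :: "real \<Rightarrow> real"
  assumes "\<And>z. (\<phi> has_real_derivative \<phi>' z) (at z)"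
  shows "\<exists>z. \<bar>z - a\<bar> \<le> \<bar>b - a\<bar> \<and> \<phi> b - \<phi> a = (b - a) * \<phi>' z"
proof -
  consider "a < b" | "b < a" | "a = b" by linarith
  then show ?thesis
  proof cases
    case 1
    then obtain z where "a < z" "z < b" "\<phi> b - \<phi> a = (b - a) * \<phi>' z"
      using MVT2[OF 1, of \<phi> \<phi>'] assms by blast
    then show ?thesis by (intro exI[of _ z]) auto
  next
    case 2
    then obtain z where z: "b < z" "z < a" "\<phi> a - \<phi> b = (a - b) * \<phi>' z"
      using MVT2[OF 2, of \<phi> \<phi>'] assms by blast
    from z(3) have "\<phi> b - \<phi> a = (b - a) * \<phi>' z" by (simp add: algebra_simps)
    with z show ?thesis by (intro exI[of _ z]) auto
  qed auto
qed

text \<open>Smoothness is formulated by continuous partial derivatives, so differentiability in a general direction is shown in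
  the classical way: the coordinates are moved one after the other, and each move is controlled by the mean value theorem.\<close>

lemma smooth_fun_directional_limit:
  assumes f: "smooth_fun n f" and x: "x \<in> Rn n" and "k \<le> n"
  shows "((\<lambda>h. (f (\<lambda>i. if i < k then x i + h * c i else x i) - f x) / h) \<longlongrightarrow> (\<Sum>i<k. c i * partial i f x)) (at 0)"
  using \<open>k \<le> n\<close>
proof (induction k)
  case (Suc k)
  then have k: "k < n" by simp
  define p where "p h = (\<lambda>i. if i < k then x i + h * c i else x i)" for h
  have p: "p h \<in> Rn n" for h using x k by (auto simp: p_def Rn_def PiE_def extensional_def)
  have "\<exists>z. \<bar>z - x k\<bar> \<le> \<bar>(x k + h * c k) - x k\<bar> \<and>
      f ((p h)(k := x k + h * c k)) - f ((p h)(k := x k)) = ((x k + h * c k) - x k) * partial k f ((p h)(k := z))" for h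
    by (rule mean_value_unordered) (rule smooth_fun_has_partial[OF f p k])
  then obtain z where z: "\<And>h. \<bar>z h - x k\<bar> \<le> \<bar>h * c k\<bar>"
    "\<And>h. f ((p h)(k := x k + h * c k)) - f ((p h)(k := x k)) = (h * c k) * partial k f ((p h)(k := z h))"
    by (simp only: add_diff_cancel_left') metis
  have pk: "(p h)(k := x k) = p h" "(p h)(k := x k + h * c k) = (\<lambda>i. if i < Suc k then x i + h * c i else x i)" for h
    by (auto simp: p_def fun_eq_iff less_Suc_eq)
  have "((\<lambda>h. (p h)(k := z h)) \<longlongrightarrow> x) (at 0)"
  proof (rule tendsto_coordinatewise)
    fix i
    have "((\<lambda>h. \<bar>h * c k\<bar>) \<longlongrightarrow> \<bar>0 * c k\<bar>) (at 0)" by (intro tendsto_intros)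
    then have "((\<lambda>h. z h - x k) \<longlongrightarrow> 0) (at 0)"
      by (intro Lim_null_comparison[of "\<lambda>h. z h - x k" "\<lambda>h. \<bar>h * c k\<bar>"]) (use z(1) in auto)
    then have 1: "(z \<longlongrightarrow> x k) (at 0)" by (rule LIM_zero_cancel)
    have "((\<lambda>h. x i + h * c i) \<longlongrightarrow> x i + 0 * c i) (at 0)" by (intro tendsto_intros)
    then have 2: "((\<lambda>h. p h i) \<longlongrightarrow> x i) (at 0)" by (cases "i < k") (auto simp: p_def)
    show "((\<lambda>h. ((p h)(k := z h)) i) \<longlongrightarrow> x i) (at 0)"
      using 1 2 by (cases "i = k") auto
  qed
  then have "((\<lambda>h. partial k f ((p h)(k := z h))) \<longlongrightarrow> partial k f x) (at 0)"
    by (intro continuous_on_tendsto_compose[OF smooth_fun_continuous[OF smooth_fun_partial[OF f k]]])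
       (use x p k in \<open>auto intro!: always_eventually fun_upd_in_Rn\<close>)
  then have "((\<lambda>h. (f (p h) - f x) / h + c k * partial k f ((p h)(k := z h))) \<longlongrightarrow> (\<Sum>i<k. c i * partial i f x) + c k * partial k f x) (at 0)"
    using Suc unfolding p_def[symmetric] by (intro tendsto_intros) auto
  then show ?case
    unfolding sum.lessThan_Suc
  proof (rule Lim_transform_eventually)
    have "(f (p h) - f x) / h + c k * partial k f ((p h)(k := z h))
        = (f (\<lambda>i. if i < Suc k then x i + h * c i else x i) - f x) / h" if "h \<noteq> 0" for h
    proof -
      have "c k * partial k f ((p h)(k := z h)) = (f ((p h)(k := x k + h * c k)) - f ((p h)(k := x k))) / h"
        unfolding z(2) using that by simp
      then show ?thesis unfolding pk by (simp flip: add_divide_distrib)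
    qed
    then show "\<forall>\<^sub>F h in at 0. (f (p h) - f x) / h + c k * partial k f ((p h)(k := z h))
        = (f (\<lambda>i. if i < Suc k then x i + h * c i else x i) - f x) / h"
      by (auto simp: eventually_at intro!: exI[of _ 1])
  qed
qed simp

lemma smooth_fun_chain_rule:
  assumes f: "smooth_fun n f"
  shows "((\<lambda>y. f (\<lambda>i\<in>{..<n}. v i + y * c i)) has_real_derivative
    directional_derivative n c f (\<lambda>i\<in>{..<n}. v i + y * c i)) (at y)"
proof -
  define x where "x = (\<lambda>i\<in>{..<n}. v i + y * c i)"
  have x: "x \<in> Rn n" by (auto simp: x_def Rn_def)
  have "(\<lambda>i\<in>{..<n}. v i + (y + h) * c i) = (\<lambda>i. if i < n then x i + h * c i else x i)" for h
    by (auto simp: x_def fun_eq_iff algebra_simps)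
  then show ?thesis
    unfolding DERIV_def directional_derivative_def x_def[symmetric]
    using smooth_fun_directional_limit[OF f x order_refl, of c] by simp
qed

text \<open>\<open>Rn n\<close> sits inside the space of all sequences, where the Borel sets of the product topology are the
  product of the Borel sets.\<close>

lemma continuous_on_Rn_measurable:
  assumes "continuous_on (Rn n) f"
  shows "f \<in> borel_measurable (PiM {..<n} (\<lambda>_. borel))"
proof -
  have "(\<lambda>x. x i) \<in> borel_measurable (PiM {..<n} (\<lambda>_. borel :: real measure))" for i
  proof (cases "i < n")
    case False
    have "(\<lambda>x::nat \<Rightarrow> real. x i) \<in> borel_measurable (PiM {..<n} (\<lambda>_. borel :: real measure)) \<longleftrightarrow>
        (\<lambda>x. undefined :: real) \<in> borel_measurable (PiM {..<n} (\<lambda>_. borel :: real measure))"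
      using False by (intro measurable_cong) (auto simp: space_PiM PiE_def extensional_def)
    then show ?thesis by simp
  qed simp
  then have "(\<lambda>x. x) \<in> borel_measurable (PiM {..<n} (\<lambda>_. borel :: real measure))"
    by (rule measurable_coordinatewise_then_product)
  then have "(\<lambda>x. x) \<in> measurable (PiM {..<n} (\<lambda>_. borel :: real measure)) (restrict_space borel (Rn n))"
    by (intro measurable_restrict_space2) (auto simp: space_PiM Rn_def)
  from measurable_compose[OF this borel_measurable_continuous_on_restrict[OF assms]] show ?thesis .
qed

section \<open>Malliavin derivatives as derivatives in one increment\<close>

text \<open>Jensen's inequality for the square.\<close>

lemma (in prob_space) real_cond_exp_L2_contraction:
  fixes X :: "'a \<Rightarrow> real"
  assumes sub: "subalgebra M N" and X [measurable]: "X \<in> borel_measurable M" and X2: "integrable M (\<lambda>\<omega>. (X \<omega>)\<^sup>2)"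
  shows "integrable M (\<lambda>\<omega>. (real_cond_exp M N X \<omega>)\<^sup>2)"
    and "(\<integral>\<omega>. (real_cond_exp M N X \<omega>)\<^sup>2 \<partial>M) \<le> (\<integral>\<omega>. (X \<omega>)\<^sup>2 \<partial>M)"
proof -
  interpret N: finite_measure_subalgebra M N by unfold_locales (rule sub)
  have X1: "integrable M X" using square_integrable_imp_integrable[OF X X2] .
  have J: "AE \<omega> in M. (real_cond_exp M N X \<omega>)\<^sup>2 \<le> real_cond_exp M N (\<lambda>\<omega>. (X \<omega>)\<^sup>2) \<omega>"
    using N.real_cond_exp_jensens_inequality(2)[OF X1, where I = UNIV and q = power2] X2 convex_power2 by simp
  have i: "integrable M (real_cond_exp M N (\<lambda>\<omega>. (X \<omega>)\<^sup>2))" using N.real_cond_exp_int(1)[OF X2] .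
  show I: "integrable M (\<lambda>\<omega>. (real_cond_exp M N X \<omega>)\<^sup>2)"
    by (rule Bochner_Integration.integrable_bound[OF i]) (use J in \<open>auto elim!: eventually_mono\<close>)
  have "(\<integral>\<omega>. (real_cond_exp M N X \<omega>)\<^sup>2 \<partial>M) \<le> (\<integral>\<omega>. real_cond_exp M N (\<lambda>\<omega>. (X \<omega>)\<^sup>2) \<omega> \<partial>M)"
    by (rule integral_mono_AE[OF I i J])
  then show "(\<integral>\<omega>. (real_cond_exp M N X \<omega>)\<^sup>2 \<partial>M) \<le> (\<integral>\<omega>. (X \<omega>)\<^sup>2 \<partial>M)"
    using N.real_cond_exp_int(2)[OF X2] by simp
qed

text \<open>Square integrability is part of having a chaos expansion.\<close>

lemma malliavin_derivatives_L2:
  assumes "malliavin_derivatives P W F D" "ss \<in> lists {0..}"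
  shows "D ss \<in> L2_space P"
  using assms unfolding malliavin_derivatives_def is_malliavin_derivative_def chaos_derivative_def
    chaos_expansion_def L2_sums_def L2_tendsto_def by blast

lemma iterated_malliavin_derivative:
  assumes D: "malliavin_derivatives P W F D" and g: "smooth_fun M g" and \<Delta>: "\<Delta> > 0"
    and F: "AE \<omega> in P. F \<omega> = g (\<lambda>i\<in>{..<M}. W (real (i + 1) * \<Delta>) \<omega>)"
  shows "AE \<omega> in P. D (replicate l (real (m + 1) * \<Delta>)) \<omega>
    = (directional_derivative M (\<lambda>i. if m \<le> i then 1 else 0) ^^ l) g (\<lambda>i\<in>{..<M}. W (real (i + 1) * \<Delta>) \<omega>)"
proof (induction l)
  case 0
  show ?case using D F unfolding malliavin_derivatives_def by (simp only: replicate_0 funpow.simps id_apply)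
next
  case (Suc l)
  define G where "G = (directional_derivative M (\<lambda>i. if m \<le> i then 1 else 0) ^^ l) g"
  define \<tau> where "\<tau> = real (m + 1) * \<Delta>"
  define t where "t i = real (i + 1) * \<Delta>" for i
  have \<tau>: "\<tau> \<ge> 0" using \<Delta> by (simp add: \<tau>_def)
  have "replicate l \<tau> \<in> lists {0..}" using \<tau> by (auto simp: in_lists_conv_set)
  then have "is_malliavin_derivative P W (D (replicate l \<tau>)) (\<lambda>s. D (s # replicate l \<tau>))"
    using D by (simp add: malliavin_derivatives_def)
  then have deriv_rule: "\<And>f. (\<forall>i<M. 0 < t i) \<Longrightarrow> smooth_fun M f \<Longrightarrow>
      (AE \<omega> in P. D (replicate l \<tau>) \<omega> = f (\<lambda>j\<in>{..<M}. W (t j) \<omega>)) \<Longrightarrow>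
      (AE \<omega> in P. D (\<tau> # replicate l \<tau>) \<omega> = cylinder_derivative W M t f \<tau> \<omega>)"
    unfolding is_malliavin_derivative_def using \<tau> by blast
  have "AE \<omega> in P. D (replicate l \<tau>) \<omega> = G (\<lambda>j\<in>{..<M}. W (t j) \<omega>)"
    using Suc unfolding G_def \<tau>_def t_def .
  moreover have "smooth_fun M G" unfolding G_def by (rule smooth_fun_iterate[OF g])
  moreover have "\<forall>i<M. 0 < t i" using \<Delta> by (simp add: t_def)
  ultimately have main: "AE \<omega> in P. D (\<tau> # replicate l \<tau>) \<omega> = cylinder_derivative W M t G \<tau> \<omega>"
    by (intro deriv_rule)
  \<comment> \<open>the weight of the \<open>i\<close>-th partial derivative is \<open>1\<close> exactly when \<open>\<tau> \<le> (i + 1) \<Delta>\<close>\<close>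
  have cyl: "cylinder_derivative W M t G \<tau> \<omega>
      = directional_derivative M (\<lambda>i. if m \<le> i then 1 else 0) G (\<lambda>i\<in>{..<M}. W (t i) \<omega>)" for \<omega>
    unfolding cylinder_derivative_def directional_derivative_def using \<Delta> \<tau>
    by (intro sum.cong) (auto simp: indicator_def \<tau>_def t_def)
  show ?case
    using main[unfolded cyl] unfolding G_def \<tau>_def t_def replicate_Suc funpow.simps o_apply .
qed

context brownian_grid
begin

text \<open>\<open>sqrt \<Delta> ^ l\<close> times the \<open>l\<close>-th Malliavin derivative at time \<open>(m + 1)
  \<Delta>\<close>, as a function of the normalised increments \<open>x\<close>, of which \<open>W\<close> at the grid points is a
  multiple of the partial sums. The scaling makes these functions successive derivatives in \<open>x m\<close>.\<close>

definition increment_fun :: "nat \<Rightarrow> nat \<Rightarrow> ((nat \<Rightarrow> real) \<Rightarrow> real) \<Rightarrow> nat \<Rightarrow> (nat \<Rightarrow> real) \<Rightarrow> real" where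
  "increment_fun M m g l x = sqrt \<Delta> ^ l *
    (directional_derivative M (\<lambda>i. if m \<le> i then 1 else 0) ^^ l) g (\<lambda>i\<in>{..<M}. sqrt \<Delta> * (\<Sum>j\<le>i. x j))"

lemma increment_fun_measurable:
  assumes "smooth_fun M g"
  shows "increment_fun M m g l \<in> borel_measurable (PiM {..<M} (\<lambda>_. borel))"
proof -
  have a: "(directional_derivative M (\<lambda>i. if m \<le> i then 1 else 0) ^^ l) g \<in> borel_measurable (PiM {..<M} (\<lambda>_. borel))"
    by (intro continuous_on_Rn_measurable smooth_fun_continuous smooth_fun_iterate assms)
  have b: "(\<lambda>x. \<lambda>i\<in>{..<M}. sqrt \<Delta> * (\<Sum>j\<le>i. x j)) \<in> measurable (PiM {..<M} (\<lambda>_. borel)) (PiM {..<M} (\<lambda>_. borel))"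
    by (intro measurable_restrict borel_measurable_times borel_measurable_sum measurable_component_singleton) auto
  show ?thesis
    unfolding increment_fun_def by (intro borel_measurable_times borel_measurable_const measurable_compose[OF b a])
qed

lemma increment_fun_has_derivative:
  assumes "smooth_fun M g" "m < M"
  shows "((\<lambda>y. increment_fun M m g l (x(m := y))) has_real_derivative increment_fun M m g (Suc l) (x(m := y))) (at y)"
proof -
  define c where "c i = (if m \<le> i then 1 else 0 :: real)" for i
  define G where "G = (directional_derivative M c ^^ l) g"
  define v where "v i = sqrt \<Delta> * (\<Sum>j\<le>i. (x(m := 0)) j)" for i
  have point: "(\<lambda>i\<in>{..<M}. sqrt \<Delta> * (\<Sum>j\<le>i. (x(m := y)) j)) = (\<lambda>i\<in>{..<M}. v i + y * (sqrt \<Delta> * c i))" for y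
  proof (rule restrict_ext)
    fix i
    have "(\<Sum>j\<le>i. (x(m := y)) j) = (\<Sum>j\<le>i. (x(m := 0)) j + (if j = m then y else 0))"
      by (intro sum.cong) auto
    also have "\<dots> = (\<Sum>j\<le>i. (x(m := 0)) j) + y * c i"
      by (simp add: sum.distrib c_def)
    finally show "sqrt \<Delta> * (\<Sum>j\<le>i. (x(m := y)) j) = v i + y * (sqrt \<Delta> * c i)"
      by (simp add: v_def algebra_simps)
  qed
  have scale: "directional_derivative M (\<lambda>i. sqrt \<Delta> * c i) G z = sqrt \<Delta> * directional_derivative M c G z" for z
    by (simp add: directional_derivative_def sum_distrib_left mult.assoc)
  have "smooth_fun M G" unfolding G_def by (rule smooth_fun_iterate[OF assms(1)])
  from smooth_fun_chain_rule[OF this, of v "\<lambda>i. sqrt \<Delta> * c i" y]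
  have "((\<lambda>y. G (\<lambda>i\<in>{..<M}. v i + y * (sqrt \<Delta> * c i))) has_real_derivative
      sqrt \<Delta> * directional_derivative M c G (\<lambda>i\<in>{..<M}. v i + y * (sqrt \<Delta> * c i))) (at y)"
    unfolding scale .
  from DERIV_cmult[OF this, of "sqrt \<Delta> ^ l"] show ?thesis
    unfolding increment_fun_def point c_def[abs_def, symmetric] by (simp add: G_def mult.assoc mult.left_commute)
qed

lemma std_increment_measurable_augmented:
  assumes "j < k"
  shows "std_increment j \<in> borel_measurable (augmented P W (real k * \<Delta>))"
proof -
  have "real (j + 1) * \<Delta> \<le> real k * \<Delta>" "real j * \<Delta> \<le> real k * \<Delta>"
    using assms Delta_pos by (auto intro!: mult_right_mono)
  then have "W (real (j + 1) * \<Delta>) \<in> borel_measurable (augmented P W (real k * \<Delta>))"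
    "W (real j * \<Delta>) \<in> borel_measurable (augmented P W (real k * \<Delta>))"
    using W_measurable_augmented[OF grid_nonneg] by blast+
  then show ?thesis
    unfolding std_increment_def by (intro borel_measurable_divide borel_measurable_diff borel_measurable_const)
qed

lemma integral_coordinate_measurable:
  fixes \<Phi> :: "(nat \<Rightarrow> real) \<Rightarrow> real"
  assumes m: "m < M" and \<Phi>: "\<Phi> \<in> borel_measurable (PiM {..<M} (\<lambda>_. borel))"
  shows "(\<lambda>x. \<integral>y. \<Phi> (x(m := y)) \<partial>gauss) \<in> borel_measurable (PiM {..<M} (\<lambda>_. borel))"
proof (rule gauss.borel_measurable_lebesgue_integral)
  have "(\<lambda>p. (fst p)(m := snd p)) \<in> measurable (PiM {..<M} (\<lambda>_. borel) \<Otimes>\<^sub>M gauss) (PiM {..<M} (\<lambda>_. borel))"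
    using m by (intro measurable_fun_upd[where J = "{..<M}"]) auto
  from measurable_compose[OF this \<Phi>]
  show "(\<lambda>(x, y). \<Phi> (x(m := y))) \<in> borel_measurable (PiM {..<M} (\<lambda>_. borel) \<Otimes>\<^sub>M gauss)"
    by (simp add: case_prod_beta')
qed

text \<open>Both sides are computed by freezing the past: on the right, the increments with index \<open>j \<ge> m\<close> are
  integrated out, on the left, first the one with index \<open>m\<close> (in \<open>\<Psi>\<close>) and then those with \<open>j >
  m\<close>.\<close>

lemma real_cond_exp_averaged_increment:
  fixes \<Phi> :: "(nat \<Rightarrow> real) \<Rightarrow> real"
  assumes m: "m < M" and \<Phi>: "\<Phi> \<in> borel_measurable (PiM {..<M} (\<lambda>_. borel))"
    and int: "integrable P (\<lambda>\<omega>. \<Phi> (\<lambda>j\<in>{..<M}. std_increment j \<omega>))"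
  defines "\<Psi> \<equiv> \<lambda>x. \<integral>y. \<Phi> (x(m := y)) \<partial>gauss"
  assumes int': "integrable P (\<lambda>\<omega>. \<Psi> (\<lambda>j\<in>{..<M}. std_increment j \<omega>))"
  shows "AE \<omega> in P. real_cond_exp P (augmented P W (real (m + 1) * \<Delta>)) (\<lambda>\<omega>. \<Psi> (\<lambda>j\<in>{..<M}. std_increment j \<omega>)) \<omega>
    = real_cond_exp P (augmented P W (real m * \<Delta>)) (\<lambda>\<omega>. \<Phi> (\<lambda>j\<in>{..<M}. std_increment j \<omega>)) \<omega>"
proof -
  \<comment> \<open>the past increments of \<open>\<omega>\<close> together with the future increments \<open>v\<close>\<close>
  define glue where "glue k \<omega> v = (\<lambda>j\<in>{..<M}. if j < k then std_increment j \<omega> else v j)" for k \<omega> and v :: "nat \<Rightarrow> real"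
  have glue_meas: "(\<lambda>p. glue k (fst p) (snd p)) \<in> measurable (augmented P W (real k * \<Delta>) \<Otimes>\<^sub>M PiM {k..<M} (\<lambda>_. borel)) (PiM {..<M} (\<lambda>_. borel))" for k
    unfolding glue_def
  proof (rule measurable_restrict)
    fix j assume j: "j \<in> {..<M}"
    show "(\<lambda>p. if j < k then std_increment j (fst p) else snd p j) \<in> borel_measurable (augmented P W (real k * \<Delta>) \<Otimes>\<^sub>M PiM {k..<M} (\<lambda>_. borel))"
    proof (cases "j < k")
      case True
      then show ?thesis using measurable_compose[OF measurable_fst std_increment_measurable_augmented[OF True]] by simp
    next
      case False
      then show ?thesis using measurable_compose[OF measurable_snd measurable_component_singleton[of j "{k..<M}" "\<lambda>_. borel"]] j by simp
    qed
  qed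
  have glue_std_increment: "glue k \<omega> (\<lambda>j\<in>{k..<M}. std_increment j \<omega>) = (\<lambda>j\<in>{..<M}. std_increment j \<omega>)" for k \<omega>
    by (auto simp: glue_def fun_eq_iff)
  have \<Psi>: "\<Psi> \<in> borel_measurable (PiM {..<M} (\<lambda>_. borel))"
    unfolding \<Psi>_def by (rule integral_coordinate_measurable[OF m \<Phi>])
  have int1: "integrable P (\<lambda>\<omega>. (\<lambda>p. \<Psi> (glue (m + 1) (fst p) (snd p))) (\<omega>, \<lambda>j\<in>{m + 1..<M}. std_increment j \<omega>))"
    using int' by (simp only: fst_conv snd_conv glue_std_increment)
  have int2: "integrable P (\<lambda>\<omega>. (\<lambda>p. \<Phi> (glue m (fst p) (snd p))) (\<omega>, \<lambda>j\<in>{m..<M}. std_increment j \<omega>))"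
    using int by (simp only: fst_conv snd_conv glue_std_increment)
  have mM: "m + 1 \<le> M" "m \<le> M" using m by auto
  note freeze1 = real_cond_exp_std_increment_freeze[OF mM(1) measurable_compose[OF glue_meas \<Psi>] int1, unfolded fst_conv snd_conv glue_std_increment]
  note freeze2 = real_cond_exp_std_increment_freeze[OF mM(2) measurable_compose[OF glue_meas \<Phi>] int2, unfolded fst_conv snd_conv glue_std_increment]
  interpret G: product_sigma_finite "\<lambda>_::nat. gauss" ..
  have ins: "{m..<M} = insert m {m + 1..<M}" using m by auto
  show ?thesis
    using freeze1(1) freeze2
  proof eventually_elim
    case (elim \<omega>)
    have eq: "glue m \<omega> (v(m := y)) = (glue (m + 1) \<omega> v)(m := y)" for v y
      using m by (auto simp: glue_def fun_eq_iff less_Suc_eq)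
    have "(\<integral>v. \<Phi> (glue m \<omega> v) \<partial>PiM {m..<M} (\<lambda>_. gauss))
        = (\<integral>v. (\<integral>y. \<Phi> (glue m \<omega> (v(m := y))) \<partial>gauss) \<partial>PiM {m + 1..<M} (\<lambda>_. gauss))"
      using elim(3) unfolding ins by (intro G.product_integral_insert) auto
    also have "\<dots> = (\<integral>v. \<Psi> (glue (m + 1) \<omega> v) \<partial>PiM {m + 1..<M} (\<lambda>_. gauss))"
      unfolding \<Psi>_def eq ..
    finally show ?case using elim(1,2) by (simp only:)
  qed
qed

text \<open>The increment with index \<open>m\<close> is split off as the last factor of a product, the form in which the
  expansion with parameters is stated.\<close>

lemma distr_std_increment_split:
  assumes "m < M"
  shows "distr P (PiM {..<M} (\<lambda>_. borel)) (\<lambda>\<omega>. \<lambda>j\<in>{..<M}. std_increment j \<omega>)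
    = distr (PiM ({..<M} - {m}) (\<lambda>_. gauss) \<Otimes>\<^sub>M gauss) (PiM {..<M} (\<lambda>_. borel)) (\<lambda>(b, y). b(m := y))"
proof -
  let ?Q = "PiM ({..<M} - {m}) (\<lambda>_. gauss)"
  interpret Q: prob_space ?Q by (intro prob_space_PiM prob_space_gauss)
  interpret pair_sigma_finite ?Q gauss ..
  have ins: "insert m ({..<M} - {m}) = {..<M}" using assms by auto
  have upd: "(\<lambda>(y, b). b(m := y)) \<in> measurable (gauss \<Otimes>\<^sub>M ?Q) (PiM {..<M} (\<lambda>_. gauss))"
    unfolding case_prod_beta' using ins by (intro measurable_fun_upd[where J = "{..<M} - {m}"]) auto
  have "distr P (PiM {..<M} (\<lambda>_. borel)) (\<lambda>\<omega>. \<lambda>j\<in>{..<M}. std_increment j \<omega>) = PiM {..<M} (\<lambda>_. gauss)"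
    by (rule distr_std_increment_PiM[of _ M]) auto
  also have "\<dots> = distr (gauss \<Otimes>\<^sub>M ?Q) (PiM {..<M} (\<lambda>_. gauss)) (\<lambda>(y, b). b(m := y))"
    using distr_pair_PiM_eq_PiM[of "{..<M} - {m}" "\<lambda>_. gauss" m] prob_space_gauss unfolding ins by simp
  also have "gauss \<Otimes>\<^sub>M ?Q = distr (?Q \<Otimes>\<^sub>M gauss) (gauss \<Otimes>\<^sub>M ?Q) (\<lambda>(x, y). (y, x))"
  proof -
    interpret swap: pair_sigma_finite gauss ?Q ..
    show ?thesis by (rule swap.distr_pair_swap)
  qed
  also have "distr \<dots> (PiM {..<M} (\<lambda>_. gauss)) (\<lambda>(y, b). b(m := y))
      = distr (?Q \<Otimes>\<^sub>M gauss) (PiM {..<M} (\<lambda>_. gauss)) ((\<lambda>(y, b). b(m := y)) \<circ> (\<lambda>(x, y). (y, x)))"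
    by (intro distr_distr upd measurable_pair_swap')
  also have "(\<lambda>(y, b). b(m := y)) \<circ> (\<lambda>(x, y). (y, x)) = (\<lambda>(b, y). b(m := y))"
    by (auto simp: fun_eq_iff)
  also have "distr (?Q \<Otimes>\<^sub>M gauss) (PiM {..<M} (\<lambda>_. gauss)) \<dots> = distr (?Q \<Otimes>\<^sub>M gauss) (PiM {..<M} (\<lambda>_. borel)) \<dots>"
    by (intro distr_cong sets_PiM_cong) auto
  finally show ?thesis .
qed

text \<open>The unconditional expansion: the series of \<open>\<gamma>(m, l) D\<^sup>l F\<close>, written in the normalised
  increments, converges in \<open>L\<^sup>2\<close> to the average \<open>A\<close> of \<open>F\<close> over the increment with
  index \<open>m\<close>.\<close>

lemma expansion_before_conditioning:
  fixes D :: "nat \<Rightarrow> 'a \<Rightarrow> real"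
  assumes g: "smooth_fun M g" and m: "m < M"
    and D_L2: "\<And>l. D l \<in> L2_space P"
    and D_eq: "\<And>l. AE \<omega> in P. sqrt \<Delta> ^ l * D l \<omega> = increment_fun M m g l (\<lambda>j\<in>{..<M}. std_increment j \<omega>)"
    and lim: "(\<lambda>L. \<Sum>i\<le>L. (L2_norm P (D (2 * L - i)))\<^sup>2 * real (L choose i) ^ 4 * (fact i / (fact L)\<^sup>2) * \<Delta> ^ (2 * L - i)) \<longlonglongrightarrow> 0"
  defines "R \<equiv> \<lambda>N \<omega>. \<Sum>l<N. mean_taylor l (std_increment m \<omega>) * increment_fun M m g l (\<lambda>j\<in>{..<M}. std_increment j \<omega>)"
    and "A \<equiv> \<lambda>\<omega>. \<integral>y. increment_fun M m g 0 ((\<lambda>j\<in>{..<M}. std_increment j \<omega>)(m := y)) \<partial>gauss"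
  shows "\<And>N. R N \<in> L2_space P" and "A \<in> L2_space P"
    and "(\<lambda>N. \<integral>\<omega>. (R N \<omega> - A \<omega>)\<^sup>2 \<partial>P) \<longlonglongrightarrow> 0"
proof -
  let ?Q = "PiM ({..<M} - {m}) (\<lambda>_. gauss)"
  define Z where "Z \<omega> = (\<lambda>j\<in>{..<M}. std_increment j \<omega>)" for \<omega>
  define f where "f = increment_fun M m g"
  define T where "T = (\<lambda>(b :: nat \<Rightarrow> real, y :: real). b(m := y))"
  define S where "S N x = (\<Sum>l<N. mean_taylor l (x m) * f l x)" for N x
  define \<psi> where "\<psi> x = (\<integral>y. f 0 (x(m := y)) \<partial>gauss)" for x
  have Qp: "prob_space ?Q" by (intro prob_space_PiM prob_space_gauss)
  have ins: "insert m ({..<M} - {m}) = {..<M}" using m by auto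
  have f_meas: "f l \<in> borel_measurable (PiM {..<M} (\<lambda>_. borel))" for l
    unfolding f_def by (rule increment_fun_measurable[OF g])
  have Z_meas: "Z \<in> measurable P (PiM {..<M} (\<lambda>_. borel))"
    unfolding Z_def by (intro measurable_restrict std_increment_measurable)
  have T_meas: "T \<in> measurable (?Q \<Otimes>\<^sub>M gauss) (PiM {..<M} (\<lambda>_. borel))"
  proof -
    have "(\<lambda>p. (fst p)(m := snd p)) \<in> measurable (?Q \<Otimes>\<^sub>M gauss) (PiM {..<M} (\<lambda>_. gauss))"
      using ins by (intro measurable_fun_upd[where J = "{..<M} - {m}"]) auto
    also have "measurable (?Q \<Otimes>\<^sub>M gauss) (PiM {..<M} (\<lambda>_. gauss)) = measurable (?Q \<Otimes>\<^sub>M gauss) (PiM {..<M} (\<lambda>_. borel))"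
      by (intro measurable_cong_sets sets_PiM_cong) auto
    finally show ?thesis unfolding T_def case_prod_beta' .
  qed
  have law: "distr P (PiM {..<M} (\<lambda>_. borel)) Z = distr (?Q \<Otimes>\<^sub>M gauss) (PiM {..<M} (\<lambda>_. borel)) T"
    using distr_std_increment_split[OF m] unfolding Z_def[abs_def] T_def .
  have tr: "integrable P (\<lambda>\<omega>. \<Phi> (Z \<omega>)) \<longleftrightarrow> integrable (?Q \<Otimes>\<^sub>M gauss) (\<lambda>p. \<Phi> (T p))"
    "(\<integral>\<omega>. \<Phi> (Z \<omega>) \<partial>P) = (\<integral>p. \<Phi> (T p) \<partial>(?Q \<Otimes>\<^sub>M gauss))"
    if "\<Phi> \<in> borel_measurable (PiM {..<M} (\<lambda>_. borel))" for \<Phi> :: "(nat \<Rightarrow> real) \<Rightarrow> real"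
    using integrable_distr_eq[OF Z_meas that] integrable_distr_eq[OF T_meas that]
      integral_distr[OF Z_meas that] integral_distr[OF T_meas that] law by simp_all
  have sq_meas: "(\<lambda>x. (\<Phi> x)\<^sup>2) \<in> borel_measurable (PiM {..<M} (\<lambda>_. borel))"
    if "\<Phi> \<in> borel_measurable (PiM {..<M} (\<lambda>_. borel))" for \<Phi> :: "(nat \<Rightarrow> real) \<Rightarrow> real"
    using that by (rule borel_measurable_power)
  have fZ_int: "integrable P (\<lambda>\<omega>. (f l (Z \<omega>))\<^sup>2)"
    and fZ_norm: "(\<integral>\<omega>. (f l (Z \<omega>))\<^sup>2 \<partial>P) = \<Delta> ^ l * (L2_norm P (D l))\<^sup>2" for l
  proof -
    have D_meas: "D l \<in> borel_measurable P" and D_int: "integrable P (\<lambda>\<omega>. (D l \<omega>)\<^sup>2)"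
      using D_L2[of l] by (auto simp: L2_space_def)
    have "(sqrt \<Delta> ^ l)\<^sup>2 = \<Delta> ^ l"
      using Delta_pos by (simp add: power2_eq_square flip: power_mult_distrib)
    note sq = this
    have ae: "AE \<omega> in P. (f l (Z \<omega>))\<^sup>2 = \<Delta> ^ l * (D l \<omega>)\<^sup>2"
      using D_eq[of l] unfolding f_def Z_def by eventually_elim (metis power_mult_distrib sq)
    have meas: "(\<lambda>\<omega>. (f l (Z \<omega>))\<^sup>2) \<in> borel_measurable P"
      by (rule measurable_compose[OF Z_meas sq_meas[OF f_meas]])
    have meas2: "(\<lambda>\<omega>. \<Delta> ^ l * (D l \<omega>)\<^sup>2) \<in> borel_measurable P"
      using D_meas by measurable
    show "integrable P (\<lambda>\<omega>. (f l (Z \<omega>))\<^sup>2)"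
      using D_int integrable_cong_AE[OF meas meas2 ae] by simp
    have "(\<integral>\<omega>. (f l (Z \<omega>))\<^sup>2 \<partial>P) = (\<integral>\<omega>. \<Delta> ^ l * (D l \<omega>)\<^sup>2 \<partial>P)"
      by (rule integral_cong_AE[OF meas meas2 ae])
    then show "(\<integral>\<omega>. (f l (Z \<omega>))\<^sup>2 \<partial>P) = \<Delta> ^ l * (L2_norm P (D l))\<^sup>2"
      by (simp add: L2_norm_def)
  qed
  have energy: "summable (\<lambda>k. (2 + 53 / 10) ^ k / fact k * (\<integral>\<omega>. (f k (Z \<omega>))\<^sup>2 \<partial>P))"
  proof -
    have "summable (\<lambda>k. (73 / 10) ^ k / fact k * (\<integral>\<omega>. (f k (Z \<omega>))\<^sup>2 \<partial>P))"
      by (rule summable_energy) (use lim Delta_pos in \<open>simp_all add: fZ_norm mult_ac\<close>)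
    then show ?thesis by simp
  qed
  note core = L2_expansion_product[OF Qp, where \<beta> = "5 / 21" and \<mu> = "53 / 10" and f = "\<lambda>l b y. f l (b(m := y))"]
  have S_eq: "(\<lambda>(b, y). \<Sum>l<N. mean_taylor l y * f l (b(m := y))) = (\<lambda>p. S N (T p))" for N
    by (auto simp: S_def T_def fun_eq_iff)
  have \<psi>_eq: "(\<lambda>(b, y :: real). \<integral>z. f 0 (b(m := z)) \<partial>gauss) = (\<lambda>p. \<psi> (T p))"
    by (auto simp: \<psi>_def T_def fun_eq_iff)
  have f_eq: "(\<lambda>(b, y). (f l (b(m := y)))\<^sup>2) = (\<lambda>p. (f l (T p))\<^sup>2)" for l
    by (auto simp: T_def fun_eq_iff)
  have f_eq': "(\<lambda>(b, y). f l (b(m := y))) = (\<lambda>p. f l (T p))" for l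
    by (auto simp: T_def fun_eq_iff)
  have prem: "(\<lambda>(b, y). f l (b(m := y))) \<in> borel_measurable (?Q \<Otimes>\<^sub>M gauss)"
    "((\<lambda>y. f l (b(m := y))) has_real_derivative f (Suc l) (b(m := y))) (at y)"
    "integrable (?Q \<Otimes>\<^sub>M gauss) (\<lambda>(b, y). (f l (b(m := y)))\<^sup>2)"
    "summable (\<lambda>k. (2 + 53 / 10) ^ k / fact k * (\<integral>(b, y). (f k (b(m := y)))\<^sup>2 \<partial>(?Q \<Otimes>\<^sub>M gauss)))" for l b y
  proof -
    show "(\<lambda>(b, y). f l (b(m := y))) \<in> borel_measurable (?Q \<Otimes>\<^sub>M gauss)"
      unfolding f_eq' by (rule measurable_compose[OF T_meas f_meas])
    show "((\<lambda>y. f l (b(m := y))) has_real_derivative f (Suc l) (b(m := y))) (at y)"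
      unfolding f_def by (rule increment_fun_has_derivative[OF g m])
    show "integrable (?Q \<Otimes>\<^sub>M gauss) (\<lambda>(b, y). (f l (b(m := y)))\<^sup>2)"
      unfolding f_eq using fZ_int tr(1)[OF sq_meas[OF f_meas]] by simp
    show "summable (\<lambda>k. (2 + 53 / 10) ^ k / fact k * (\<integral>(b, y). (f k (b(m := y)))\<^sup>2 \<partial>(?Q \<Otimes>\<^sub>M gauss)))"
      unfolding f_eq using energy unfolding tr(2)[OF sq_meas[OF f_meas]] .
  qed
  have core1: "integrable (?Q \<Otimes>\<^sub>M gauss) (\<lambda>p. (S N (T p))\<^sup>2)"
    and core2: "integrable (?Q \<Otimes>\<^sub>M gauss) (\<lambda>p. (\<psi> (T p))\<^sup>2)"
    and core3: "(\<lambda>N. \<integral>p. (S N (T p) - \<psi> (T p))\<^sup>2 \<partial>(?Q \<Otimes>\<^sub>M gauss)) \<longlonglongrightarrow> 0" for N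
    using core[OF _ _ _ prem, unfolded S_eq \<psi>_eq] by simp_all
  have S_meas: "S N \<in> borel_measurable (PiM {..<M} (\<lambda>_. borel))" for N
    unfolding S_def using m
    by (intro borel_measurable_sum borel_measurable_times f_meas measurable_compose[OF _ mean_taylor_measurable]
        measurable_component_singleton) auto
  have \<psi>_meas: "\<psi> \<in> borel_measurable (PiM {..<M} (\<lambda>_. borel))"
    unfolding \<psi>_def by (rule integral_coordinate_measurable[OF m f_meas])
  have R_eq: "R N = (\<lambda>\<omega>. S N (Z \<omega>))" for N using m by (simp add: R_def S_def Z_def f_def)
  have A_eq: "A = (\<lambda>\<omega>. \<psi> (Z \<omega>))" by (simp add: A_def \<psi>_def Z_def f_def)
  show "R N \<in> L2_space P" for N
    unfolding R_eq L2_space_def using core1 tr(1)[OF sq_meas[OF S_meas]] measurable_compose[OF Z_meas S_meas] by simp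
  show "A \<in> L2_space P"
    unfolding A_eq L2_space_def using core2 tr(1)[OF sq_meas[OF \<psi>_meas]] measurable_compose[OF Z_meas \<psi>_meas] by simp
  show "(\<lambda>N. \<integral>\<omega>. (R N \<omega> - A \<omega>)\<^sup>2 \<partial>P) \<longlonglongrightarrow> 0"
    using core3 tr(2)[OF sq_meas[OF borel_measurable_diff[OF S_meas \<psi>_meas]]] unfolding R_eq A_eq by simp
qed

end

section \<open>The expansion of the conditional expectation\<close>

text \<open>The unconditional expansion is projected onto the augmented past of \<open>(m + 1) \<Delta>\<close>. The projection
  does not increase \<open>L\<^sup>2\<close> norms, commutes with multiplication by \<open>\<gamma>(m, l)\<close>, which depends
  on the past only, and maps the average of \<open>F\<close> over one increment to the conditional expectation given the past of
  \<open>m \<Delta>\<close>.\<close>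

theorem theorem2p1:
  fixes P :: "'a measure" and W :: "real \<Rightarrow> 'a \<Rightarrow> real"
    and M :: nat and \<Delta> :: real
    and F :: "'a \<Rightarrow> real" and g :: "(nat \<Rightarrow> real) \<Rightarrow> real"
    and D :: "real list \<Rightarrow> 'a \<Rightarrow> real"
  assumes "prob_space P" and "complete_measure P" and "brownian_motion P W"
    and "M \<ge> 1" and "\<Delta> > 0"
    and "F \<in> D_infty P W (real M * \<Delta>)"
    and "smooth_fun M g"
    and "AE \<omega> in P. F \<omega> = g (\<lambda>i\<in>{..<M}. W (real (i + 1) * \<Delta>) \<omega>)"
    and "malliavin_derivatives P W F D"
    and "\<forall>m<M. (\<lambda>L. \<Sum>i\<le>L. (L2_norm P (D (replicate (2 * L - i) (real (m + 1) * \<Delta>))))\<^sup>2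
            * real (L choose i) ^ 4 * (fact i / (fact L)\<^sup>2) * \<Delta> ^ (2 * L - i)) \<longlonglongrightarrow> 0"
  shows "\<forall>m<M. L2_sums P
      (\<lambda>l \<omega>. gamma_coeff W \<Delta> m l \<omega> *
        real_cond_exp P (augmented P W (real (m + 1) * \<Delta>))
          (D (replicate l (real (m + 1) * \<Delta>))) \<omega>)
      (real_cond_exp P (augmented P W (real m * \<Delta>)) F)"
proof (intro allI impI)
  fix m assume m: "m < M"
  interpret prob_space P by fact
  interpret brownian_grid P W \<Delta> by unfold_locales fact+
  define \<tau> where "\<tau> = real (m + 1) * \<Delta>"
  define DD where "DD l = D (replicate l \<tau>)" for l
  define Z where "Z \<omega> = (\<lambda>j\<in>{..<M}. std_increment j \<omega>)" for \<omega>
  define f where "f = increment_fun M m g"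
  let ?F1 = "augmented P W \<tau>" and ?F0 = "augmented P W (real m * \<Delta>)"
  interpret F1: finite_measure_subalgebra P ?F1 by unfold_locales (rule subalgebra_augmented)
  interpret F0: finite_measure_subalgebra P ?F0 by unfold_locales (rule subalgebra_augmented)
  have \<tau>: "\<tau> \<ge> 0" unfolding \<tau>_def by (rule grid_nonneg)
  have DD_L2: "DD l \<in> L2_space P" for l
    unfolding DD_def by (rule malliavin_derivatives_L2[OF assms(9)]) (use \<tau> in \<open>auto simp: in_lists_conv_set\<close>)
  have DD_meas: "DD l \<in> borel_measurable P" for l using DD_L2[of l] by (simp add: L2_space_def)
  have DD_eq: "AE \<omega> in P. sqrt \<Delta> ^ l * DD l \<omega> = increment_fun M m g l (\<lambda>j\<in>{..<M}. std_increment j \<omega>)" for l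
    using iterated_malliavin_derivative(1)[OF assms(9,7,5,8), of l m] W_grid_eq_sum
  proof eventually_elim
    case (elim \<omega>)
    have "(\<lambda>i\<in>{..<M}. W (real (i + 1) * \<Delta>) \<omega>) = (\<lambda>i\<in>{..<M}. sqrt \<Delta> * (\<Sum>j\<le>i. (\<lambda>j\<in>{..<M}. std_increment j \<omega>) j))"
      using elim(2) by (intro restrict_ext) (auto intro!: sum.cong)
    then show ?case unfolding DD_def \<tau>_def elim(1) increment_fun_def by (simp only:)
  qed
  have F_L2: "F \<in> L2_space P" using assms(6) by (simp add: D_infty_def)
  have D0: "DD 0 = F" using assms(9) by (simp add: DD_def malliavin_derivatives_def)
  define R where "R N \<omega> = (\<Sum>l<N. mean_taylor l (std_increment m \<omega>) * increment_fun M m g l (\<lambda>j\<in>{..<M}. std_increment j \<omega>))" for N \<omega>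
  define A where "A \<omega> = (\<integral>y. increment_fun M m g 0 ((\<lambda>j\<in>{..<M}. std_increment j \<omega>)(m := y)) \<partial>gauss)" for \<omega>
  have lim: "(\<lambda>L. \<Sum>i\<le>L. (L2_norm P (DD (2 * L - i)))\<^sup>2 * real (L choose i) ^ 4 * (fact i / (fact L)\<^sup>2) * \<Delta> ^ (2 * L - i)) \<longlonglongrightarrow> 0"
    using assms(10) m unfolding DD_def \<tau>_def by blast
  note expansion = expansion_before_conditioning[OF assms(7) m DD_L2 DD_eq lim, folded R_def A_def]
  have R_L2: "R N \<in> L2_space P" for N using expansion(1)[of N] unfolding R_def[abs_def] .
  have A_L2: "A \<in> L2_space P" using expansion(2) unfolding A_def[abs_def] .
  have RA: "(\<lambda>N. \<integral>\<omega>. (R N \<omega> - A \<omega>)\<^sup>2 \<partial>P) \<longlonglongrightarrow> 0" using expansion(3) unfolding R_def A_def .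
  have L2_D: "X \<in> borel_measurable P" "integrable P (\<lambda>\<omega>. (X \<omega>)\<^sup>2)" "integrable P X" if "X \<in> L2_space P" for X
  proof -
    show 1: "X \<in> borel_measurable P" and 2: "integrable P (\<lambda>\<omega>. (X \<omega>)\<^sup>2)"
      using that by (simp_all add: L2_space_def)
    show "integrable P X" by (rule square_integrable_imp_integrable[OF 1 2])
  qed
  define c where "c l \<omega> = gamma_coeff W \<Delta> m l \<omega>" for l \<omega>
  have c_eq: "c l = (\<lambda>\<omega>. sqrt \<Delta> ^ l * mean_taylor l (std_increment m \<omega>))" for l
    unfolding c_def std_increment_def by (rule ext) (rule gamma_coeff_eq_mean_taylor[OF assms(5)])
  have std_increment_F1: "std_increment m \<in> borel_measurable ?F1"
    unfolding \<tau>_def by (rule std_increment_measurable_augmented) simp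
  have c_F1: "c l \<in> borel_measurable ?F1" for l
    unfolding c_eq by (intro borel_measurable_times borel_measurable_const measurable_compose[OF std_increment_F1 mean_taylor_measurable])
  have c_meas: "c l \<in> borel_measurable P" for l
    by (rule measurable_from_subalg[OF subalgebra_augmented c_F1])
  define X where "X l \<omega> = c l \<omega> * DD l \<omega>" for l \<omega>
  have X_meas: "X l \<in> borel_measurable P" for l
    unfolding X_def using c_meas DD_meas by (rule borel_measurable_times)
  have X_eq: "AE \<omega> in P. X l \<omega> = mean_taylor l (std_increment m \<omega>) * increment_fun M m g l (\<lambda>j\<in>{..<M}. std_increment j \<omega>)" for l
    using DD_eq[of l]
  proof eventually_elim
    case (elim \<omega>)
    have "X l \<omega> = mean_taylor l (std_increment m \<omega>) * (sqrt \<Delta> ^ l * DD l \<omega>)"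
      unfolding X_def c_eq by (simp only: mult_ac)
    then show ?case unfolding elim .
  qed
  have X_int: "integrable P (X l)" for l
  proof -
    have "integrable P (\<lambda>\<omega>. R (Suc l) \<omega> - R l \<omega>)"
      by (intro Bochner_Integration.integrable_diff L2_D(3) R_L2)
    moreover have "AE \<omega> in P. R (Suc l) \<omega> - R l \<omega> = X l \<omega>"
      using X_eq[of l] by eventually_elim (simp add: R_def)
    ultimately show ?thesis
      using integrable_cong_AE[OF _ X_meas, of "\<lambda>\<omega>. R (Suc l) \<omega> - R l \<omega>" l] borel_measurable_integrable by blast
  qed
  have R_eq: "AE \<omega> in P. (\<Sum>l<N. X l \<omega>) = R N \<omega>" for N
  proof -
    have "AE \<omega> in P. \<forall>l. X l \<omega> = mean_taylor l (std_increment m \<omega>) * increment_fun M m g l (\<lambda>j\<in>{..<M}. std_increment j \<omega>)"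
      using X_eq by (simp add: AE_all_countable)
    then show ?thesis by eventually_elim (simp add: R_def)
  qed
  define Y where "Y N \<omega> = (\<Sum>l<N. c l \<omega> * real_cond_exp P ?F1 (DD l) \<omega>)" for N \<omega>
  define Ylim where "Ylim = real_cond_exp P ?F0 F"
  have Y_meas: "Y N \<in> borel_measurable P" for N
    unfolding Y_def by (intro borel_measurable_sum borel_measurable_times c_meas borel_measurable_cond_exp2)
  have Y_eq: "AE \<omega> in P. Y N \<omega> = real_cond_exp P ?F1 (R N) \<omega>" for N
  proof -
    have "AE \<omega> in P. \<forall>l. real_cond_exp P ?F1 (X l) \<omega> = c l \<omega> * real_cond_exp P ?F1 (DD l) \<omega>"
      unfolding AE_all_countable X_def
      by (intro allI F1.real_cond_exp_mult c_F1 DD_meas) (use X_int in \<open>simp add: X_def[abs_def]\<close>)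
    moreover have "AE \<omega> in P. real_cond_exp P ?F1 (\<lambda>\<omega>. \<Sum>l<N. X l \<omega>) \<omega> = (\<Sum>l<N. real_cond_exp P ?F1 (X l) \<omega>)"
      by (rule F1.real_cond_exp_sum[OF X_int])
    moreover have "AE \<omega> in P. real_cond_exp P ?F1 (\<lambda>\<omega>. \<Sum>l<N. X l \<omega>) \<omega> = real_cond_exp P ?F1 (R N) \<omega>"
      by (rule F1.real_cond_exp_cong[OF R_eq]) (intro borel_measurable_sum X_meas L2_D(1) R_L2)+
    ultimately show ?thesis by eventually_elim (simp add: Y_def)
  qed
  have Ylim_eq: "AE \<omega> in P. Ylim \<omega> = real_cond_exp P ?F1 A \<omega>"
  proof -
    have ae: "AE \<omega> in P. F \<omega> = f 0 (\<lambda>j\<in>{..<M}. std_increment j \<omega>)"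
      using DD_eq[of 0] by (simp add: D0 f_def)
    have f_meas: "f 0 \<in> borel_measurable (PiM {..<M} (\<lambda>_. borel))"
      unfolding f_def by (rule increment_fun_measurable[OF assms(7)])
    have fZ: "(\<lambda>\<omega>. f 0 (\<lambda>j\<in>{..<M}. std_increment j \<omega>)) \<in> borel_measurable P"
      by (intro measurable_compose[OF _ f_meas] measurable_restrict std_increment_measurable)
    have fZ_int: "integrable P (\<lambda>\<omega>. f 0 (\<lambda>j\<in>{..<M}. std_increment j \<omega>))"
      using integrable_cong_AE[OF L2_D(1)[OF F_L2] fZ ae] L2_D(3)[OF F_L2] by simp
    have "AE \<omega> in P. real_cond_exp P ?F0 F \<omega> = real_cond_exp P ?F0 (\<lambda>\<omega>. f 0 (\<lambda>j\<in>{..<M}. std_increment j \<omega>)) \<omega>"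
      by (rule F0.real_cond_exp_cong[OF ae L2_D(1)[OF F_L2] fZ])
    moreover have "AE \<omega> in P. real_cond_exp P ?F1 A \<omega> = real_cond_exp P ?F0 (\<lambda>\<omega>. f 0 (\<lambda>j\<in>{..<M}. std_increment j \<omega>)) \<omega>"
      using real_cond_exp_averaged_increment[OF m f_meas fZ_int] L2_D(3)[OF A_L2]
      unfolding A_def[abs_def] \<tau>_def f_def by blast
    ultimately show ?thesis by eventually_elim (simp add: Ylim_def)
  qed
  have RA_meas: "(\<lambda>\<omega>. R N \<omega> - A \<omega>) \<in> borel_measurable P" for N
    by (intro borel_measurable_diff L2_D(1) R_L2 A_L2)
  have RA_int: "integrable P (\<lambda>\<omega>. (R N \<omega> - A \<omega>)\<^sup>2)" for N
  proof (rule Bochner_Integration.integrable_bound)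
    show "integrable P (\<lambda>\<omega>. 2 * (R N \<omega>)\<^sup>2 + 2 * (A \<omega>)\<^sup>2)"
      by (intro Bochner_Integration.integrable_add integrable_mult_right L2_D(2) R_L2 A_L2)
    have "(R N \<omega> - A \<omega>)\<^sup>2 \<le> 2 * (R N \<omega>)\<^sup>2 + 2 * (A \<omega>)\<^sup>2" for \<omega>
      using zero_le_power2[of "R N \<omega> + A \<omega>"] by (simp add: power2_eq_square algebra_simps)
    then show "AE \<omega> in P. norm ((R N \<omega> - A \<omega>)\<^sup>2) \<le> norm (2 * (R N \<omega>)\<^sup>2 + 2 * (A \<omega>)\<^sup>2)"
      by simp
  qed (intro borel_measurable_power RA_meas)
  have diff_eq: "AE \<omega> in P. Y N \<omega> - Ylim \<omega> = real_cond_exp P ?F1 (\<lambda>\<omega>. R N \<omega> - A \<omega>) \<omega>" for N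
    using Y_eq[of N] Ylim_eq F1.real_cond_exp_diff[OF L2_D(3)[OF R_L2[of N]] L2_D(3)[OF A_L2]]
    by eventually_elim simp
  have Ylim_meas: "Ylim \<in> borel_measurable P"
    unfolding Ylim_def by (rule borel_measurable_cond_exp2)
  have Ylim_L2: "Ylim \<in> L2_space P"
    using real_cond_exp_L2_contraction(1)[OF subalgebra_augmented L2_D(1,2)[OF F_L2]] Ylim_meas
    unfolding L2_space_def Ylim_def by simp
  have Y_L2: "Y N \<in> L2_space P" for N
  proof -
    have "integrable P (\<lambda>\<omega>. (real_cond_exp P ?F1 (R N) \<omega>)\<^sup>2)"
      by (rule real_cond_exp_L2_contraction(1)[OF subalgebra_augmented L2_D(1,2)[OF R_L2]])
    moreover have "AE \<omega> in P. (real_cond_exp P ?F1 (R N) \<omega>)\<^sup>2 = (Y N \<omega>)\<^sup>2"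
      using Y_eq[of N] by eventually_elim simp
    ultimately have "integrable P (\<lambda>\<omega>. (Y N \<omega>)\<^sup>2)"
      using integrable_cong_AE[of "\<lambda>\<omega>. (real_cond_exp P ?F1 (R N) \<omega>)\<^sup>2" P "\<lambda>\<omega>. (Y N \<omega>)\<^sup>2"] Y_meas[of N]
      by (simp add: borel_measurable_power borel_measurable_cond_exp2)
    then show ?thesis using Y_meas[of N] by (simp add: L2_space_def)
  qed
  have norm_le: "L2_norm P (\<lambda>\<omega>. Y N \<omega> - Ylim \<omega>) \<le> sqrt (\<integral>\<omega>. (R N \<omega> - A \<omega>)\<^sup>2 \<partial>P)" for N
  proof -
    have "(\<integral>\<omega>. (Y N \<omega> - Ylim \<omega>)\<^sup>2 \<partial>P) = (\<integral>\<omega>. (real_cond_exp P ?F1 (\<lambda>\<omega>. R N \<omega> - A \<omega>) \<omega>)\<^sup>2 \<partial>P)"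
    proof (rule integral_cong_AE)
      show "AE \<omega> in P. (Y N \<omega> - Ylim \<omega>)\<^sup>2 = (real_cond_exp P ?F1 (\<lambda>\<omega>. R N \<omega> - A \<omega>) \<omega>)\<^sup>2"
        using diff_eq[of N] by eventually_elim simp
    qed (intro borel_measurable_power borel_measurable_diff Y_meas Ylim_meas borel_measurable_cond_exp2)+
    also have "\<dots> \<le> (\<integral>\<omega>. (R N \<omega> - A \<omega>)\<^sup>2 \<partial>P)"
      by (rule real_cond_exp_L2_contraction(2)[OF subalgebra_augmented RA_meas RA_int])
    finally show ?thesis unfolding L2_norm_def by (rule real_sqrt_le_mono)
  qed
  have "(\<lambda>N. sqrt (\<integral>\<omega>. (R N \<omega> - A \<omega>)\<^sup>2 \<partial>P)) \<longlonglongrightarrow> 0"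
    using tendsto_real_sqrt[OF RA] by simp
  then have "(\<lambda>N. L2_norm P (\<lambda>\<omega>. Y N \<omega> - Ylim \<omega>)) \<longlonglongrightarrow> 0"
  proof (rule Lim_null_comparison[rotated])
    show "\<forall>\<^sub>F N in sequentially. norm (L2_norm P (\<lambda>\<omega>. Y N \<omega> - Ylim \<omega>)) \<le> sqrt (\<integral>\<omega>. (R N \<omega> - A \<omega>)\<^sup>2 \<partial>P)"
      using norm_le by (intro always_eventually allI) (simp add: L2_norm_def)
  qed
  with Y_L2 Ylim_L2 have "L2_tendsto P Y Ylim" by (simp add: L2_tendsto_def)
  then show "L2_sums P (\<lambda>l \<omega>. gamma_coeff W \<Delta> m l \<omega> *
        real_cond_exp P (augmented P W (real (m + 1) * \<Delta>)) (D (replicate l (real (m + 1) * \<Delta>))) \<omega>)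
      (real_cond_exp P (augmented P W (real m * \<Delta>)) F)"
    unfolding L2_sums_def Y_def[abs_def] Ylim_def c_def DD_def \<tau>_def .
qed

end
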